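(* Let $m\ge 2$. Consider the nonlinear Schrödinger-type system $$(\mathrm{NLS})\quad\begin{cases} iq_t-q_{z\bar z}+2uq-2(\bar p q)_z+2pq_{\bar z}+4|p|^2q=0,\\ ir_t+r_{z\bar z}-2ur-2(\bar p r)_z+2pr_{\bar z}-4|p|^2r=0,\\ ip_t=(qr)_{\bar z}-u_z\end{cases}$$ for a real function $u$ and complex functions $p,q,r$ of $(t,x,y)\in\mathbf{R}^3$ subject to the restrictions $$(\mathrm{R})\quad \bar p_z+p_{\bar z}=|q|^2-|r|^2,\qquad \bar r_z+q_{\bar z}=2(p\bar r-\bar p q),$$ and the $1+2$ dimensional isotropic Landau-Lifshitz equation in matrix form $$(\mathrm{LL})\quad S_t=-\frac{1}{2i}[S,S_{z\bar z}],\qquad S=\begin{pmatrix} s_3 & s_1+is_2\\ s_1-is_2 & -s_3\end{pmatrix},\quad S^2=I.$$ For any $C^m$-solution $(p,q,r,u)$ of (NLS) with the restrictions (R) there is a gauge matrix function $G(t,x,y)\in SU(2)$ such that $(p,q,r,u)$ is transformed to a solution $S$ of (LL) by the gauge transformation of $G$. Moreover, if the gauge matrix $G$ is required to satisfy $G|_{x=y=t=0}=I$, then any $C^m$-solution of (NLS) with the restrictions (R) corresponds uniquely, by the gauge transformation, to a $C^{m+1}$-solution of (LL), and vice versa.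
   Context: Here $z=\frac{x+iy}{2}$, $\bar z=\frac{x-iy}{2}$, so $\partial_z=\partial_x-i\partial_y$, $\partial_{\bar z}=\partial_x+i\partial_y$ and $\partial_z\partial_{\bar z}=\partial_x^2+\partial_y^2$. The vector $\mathbf{s}=(s_1,s_2,s_3)$ (real entries) takes values in the unit sphere of $\mathbf{R}^3$, and (LL) is the matrix form of $\mathbf{s}_t=\mathbf{s}\times(\partial_x^2+\partial_y^2)\mathbf{s}$. $[\cdot,\cdot]$ is the matrix commutator and $\bar p_z$ means $\partial_z(\bar p)$, etc. Gauge transformation: put $\sigma_3=\mathrm{diag}(1,-1)$, $U=\begin{pmatrix} p&q\\ r&-p\end{pmatrix}$, $U^{(\text{off-diag})}=\begin{pmatrix}0&q\\ r&0\end{pmatrix}$, $Q=\begin{pmatrix}0&-2q\bar p\\ -2r\bar p&0\end{pmatrix}$. A matrix function $S$ and a quadruple $(p,q,r,u)$ are transformed into each other by (correspond under) the gauge transformation of $G:\mathbf{R}^3\to SU(2)$ when $$S=-G\sigma_3G^{-1},\qquad G_z=-GU,\qquad G_t=-iG\Big(\big(uI+U^{(\text{off-diag})}_{\bar z}\big)\sigma_3+Q\Big).$$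
   Formalization: S, S_x, S_y are shown to be C^m, and S is C^{m+1} exactly when q_zbar, r_zbar are C^m; the converse, for S=-sigma_3 at the origin (forced by G=I there), has (p,q,r,u) unique only up to G -> G diag(e^{i theta}, e^{-i theta}); as worded both claims fail. *)

theory Defs
  imports "HOL-Analysis.Analysis"
begin

text \<open>Points of space-time are triples \<open>(t, x, y)\<close>.\<close>

type_synonym spacetime = "real \<times> real \<times> real"
type_synonym cmat = "complex ^ 2 ^ 2"

definition partial_t :: "(spacetime \<Rightarrow> 'a::real_normed_vector) \<Rightarrow> spacetime \<Rightarrow> 'a" where
  "partial_t f = (\<lambda>(t, x, y). vector_derivative (\<lambda>\<tau>. f (\<tau>, x, y)) (at t))"

definition partial_x :: "(spacetime \<Rightarrow> 'a::real_normed_vector) \<Rightarrow> spacetime \<Rightarrow> 'a" where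
  "partial_x f = (\<lambda>(t, x, y). vector_derivative (\<lambda>\<xi>. f (t, \<xi>, y)) (at x))"

definition partial_y :: "(spacetime \<Rightarrow> 'a::real_normed_vector) \<Rightarrow> spacetime \<Rightarrow> 'a" where
  "partial_y f = (\<lambda>(t, x, y). vector_derivative (\<lambda>\<eta>. f (t, x, \<eta>)) (at y))"

definition has_partials :: "(spacetime \<Rightarrow> 'a::real_normed_vector) \<Rightarrow> bool" where
  "has_partials f \<longleftrightarrow> (\<forall>t x y. (\<lambda>\<tau>. f (\<tau>, x, y)) differentiable (at t) \<and>
     (\<lambda>\<xi>. f (t, \<xi>, y)) differentiable (at x) \<and> (\<lambda>\<eta>. f (t, x, \<eta>)) differentiable (at y))"

text \<open>Joint \<open>C\<^sup>k\<close> regularity on all of \<open>\<real>\<^sup>3\<close>: every iterated partial derivative, in \<open>t\<close>, \<open>x\<close>, \<open>y\<close>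
  in any order, of total order at most \<open>k\<close> exists and is continuous.\<close>

primrec Ck :: "nat \<Rightarrow> (spacetime \<Rightarrow> 'a::real_normed_vector) \<Rightarrow> bool" where
  "Ck 0 f \<longleftrightarrow> continuous_on UNIV f"
| "Ck (Suc k) f \<longleftrightarrow> continuous_on UNIV f \<and> has_partials f \<and>
     Ck k (partial_t f) \<and> Ck k (partial_x f) \<and> Ck k (partial_y f)"

text \<open>With \<open>z = (x + \<i>y)/2\<close> there is no factor \<open>1/2\<close> in the Wirtinger operators.\<close>

definition D_z :: "(spacetime \<Rightarrow> complex) \<Rightarrow> spacetime \<Rightarrow> complex" where
  "D_z f w = partial_x f w - \<i> * partial_y f w"

definition D_zbar :: "(spacetime \<Rightarrow> complex) \<Rightarrow> spacetime \<Rightarrow> complex" where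
  "D_zbar f w = partial_x f w + \<i> * partial_y f w"

definition cscale :: "complex \<Rightarrow> cmat \<Rightarrow> cmat" where
  "cscale c A = map_matrix (\<lambda>a. c * a) A"

definition matD_z :: "(spacetime \<Rightarrow> cmat) \<Rightarrow> spacetime \<Rightarrow> cmat" where
  "matD_z F w = partial_x F w - cscale \<i> (partial_y F w)"

definition matD_zbar :: "(spacetime \<Rightarrow> cmat) \<Rightarrow> spacetime \<Rightarrow> cmat" where
  "matD_zbar F w = partial_x F w + cscale \<i> (partial_y F w)"

definition mat22 :: "complex \<Rightarrow> complex \<Rightarrow> complex \<Rightarrow> complex \<Rightarrow> cmat" where
  "mat22 a b c d = vector [vector [a, b], vector [c, d]]"

definition sigma3 :: cmat where
  "sigma3 = mat22 1 0 0 (-1)"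

definition commutator :: "cmat \<Rightarrow> cmat \<Rightarrow> cmat" where
  "commutator A B = A ** B - B ** A"

definition SU2 :: "cmat set" where
  "SU2 = {A. A ** map_matrix cnj (transpose A) = mat 1 \<and> det A = 1}"

text \<open>\<open>C\<^sup>k\<close>-solutions of the Schroedinger-type system; they are used for \<open>k \<ge> 2\<close> only, so all the
  derivatives below exist.\<close>

definition nls_solution ::
  "nat \<Rightarrow> (spacetime \<Rightarrow> complex) \<Rightarrow> (spacetime \<Rightarrow> complex) \<Rightarrow> (spacetime \<Rightarrow> complex)
     \<Rightarrow> (spacetime \<Rightarrow> real) \<Rightarrow> bool" where
  "nls_solution k p q r u \<longleftrightarrow> Ck k p \<and> Ck k q \<and> Ck k r \<and> Ck k u \<and>
     (\<forall>w.
       \<i> * partial_t q w - D_zbar (D_z q) w + 2 * of_real (u w) * q w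
         - 2 * D_z (\<lambda>v. cnj (p v) * q v) w + 2 * p w * D_zbar q w
         + 4 * of_real ((cmod (p w))\<^sup>2) * q w = 0 \<and>
       \<i> * partial_t r w + D_zbar (D_z r) w - 2 * of_real (u w) * r w
         - 2 * D_z (\<lambda>v. cnj (p v) * r v) w + 2 * p w * D_zbar r w
         - 4 * of_real ((cmod (p w))\<^sup>2) * r w = 0 \<and>
       \<i> * partial_t p w = D_zbar (\<lambda>v. q v * r v) w - D_z (\<lambda>v. of_real (u v)) w)"

definition nls_restrictions ::
  "(spacetime \<Rightarrow> complex) \<Rightarrow> (spacetime \<Rightarrow> complex) \<Rightarrow> (spacetime \<Rightarrow> complex) \<Rightarrow> bool" where
  "nls_restrictions p q r \<longleftrightarrow> (\<forall>w.
     D_z (\<lambda>v. cnj (p v)) w + D_zbar p w = of_real ((cmod (q w))\<^sup>2 - (cmod (r w))\<^sup>2) \<and>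
     D_z (\<lambda>v. cnj (r v)) w + D_zbar q w = 2 * (p w * cnj (r w) - cnj (p w) * q w))"

definition spin_matrix :: "real \<Rightarrow> real \<Rightarrow> real \<Rightarrow> cmat" where
  "spin_matrix s1 s2 s3 = mat22 (of_real s3) (of_real s1 + \<i> * of_real s2)
                                (of_real s1 - \<i> * of_real s2) (- of_real s3)"

definition ll_solution :: "nat \<Rightarrow> (spacetime \<Rightarrow> cmat) \<Rightarrow> bool" where
  "ll_solution k S \<longleftrightarrow> Ck k S \<and>
     (\<exists>s1 s2 s3. \<forall>w. S w = spin_matrix (s1 w) (s2 w) (s3 w)) \<and>
     (\<forall>w. S w ** S w = mat 1) \<and>
     (\<forall>w. partial_t S w = cscale (- (1 / (2 * \<i>))) (commutator (S w) (matD_zbar (matD_z S) w)))"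

definition U_matrix ::
  "(spacetime \<Rightarrow> complex) \<Rightarrow> (spacetime \<Rightarrow> complex) \<Rightarrow> (spacetime \<Rightarrow> complex) \<Rightarrow> spacetime \<Rightarrow> cmat" where
  "U_matrix p q r w = mat22 (p w) (q w) (r w) (- p w)"

definition U_offdiag :: "(spacetime \<Rightarrow> complex) \<Rightarrow> (spacetime \<Rightarrow> complex) \<Rightarrow> spacetime \<Rightarrow> cmat" where
  "U_offdiag q r w = mat22 0 (q w) (r w) 0"

definition Q_matrix ::
  "(spacetime \<Rightarrow> complex) \<Rightarrow> (spacetime \<Rightarrow> complex) \<Rightarrow> (spacetime \<Rightarrow> complex) \<Rightarrow> spacetime \<Rightarrow> cmat" where
  "Q_matrix p q r w = mat22 0 (- 2 * q w * cnj (p w)) (- 2 * r w * cnj (p w)) 0"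

definition gauge_transformation ::
  "(spacetime \<Rightarrow> cmat) \<Rightarrow> (spacetime \<Rightarrow> complex) \<Rightarrow> (spacetime \<Rightarrow> complex) \<Rightarrow> (spacetime \<Rightarrow> complex)
     \<Rightarrow> (spacetime \<Rightarrow> real) \<Rightarrow> (spacetime \<Rightarrow> cmat) \<Rightarrow> bool" where
  "gauge_transformation G p q r u S \<longleftrightarrow> Ck 1 G \<and> (\<forall>w.
     G w \<in> SU2 \<and>
     S w = - (G w ** sigma3 ** matrix_inv (G w)) \<and>
     matD_z G w = - (G w ** U_matrix p q r w) \<and>
     partial_t G w = cscale (- \<i>) (G w **
       ((mat (of_real (u w)) + matD_zbar (U_offdiag q r) w) ** sigma3 + Q_matrix p q r w)))"

definition normalized_correspondence ::
  "(spacetime \<Rightarrow> complex) \<Rightarrow> (spacetime \<Rightarrow> complex) \<Rightarrow> (spacetime \<Rightarrow> complex)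
     \<Rightarrow> (spacetime \<Rightarrow> real) \<Rightarrow> (spacetime \<Rightarrow> cmat) \<Rightarrow> bool" where
  "normalized_correspondence p q r u S \<longleftrightarrow>
     (\<exists>G. gauge_transformation G p q r u S \<and> G (0, 0, 0) = mat 1)"

text \<open>The normalization at the origin leaves the freedom of replacing \<open>G\<close> by
  \<open>G diag(e\<^bsup>\<i>\<theta>\<^esup>, e\<^bsup>-\<i>\<theta>\<^esup>)\<close> with \<open>\<theta>\<close> real and \<open>\<theta>(0,0,0) = 0\<close>. This does not change \<open>S\<close>; its effect on
  \<open>(p, q, r, u)\<close> is the following. For instance \<open>(0, 0, 0, 0)\<close> and \<open>(0, 0, 0, -1)\<close>, with
  \<open>\<theta> = t\<close>, both correspond to the constant solution \<open>S = - \<sigma>\<^sub>3\<close>.\<close>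

definition residual_gauge ::
  "nat \<Rightarrow> (spacetime \<Rightarrow> complex) \<Rightarrow> (spacetime \<Rightarrow> complex) \<Rightarrow> (spacetime \<Rightarrow> complex)
     \<Rightarrow> (spacetime \<Rightarrow> real) \<Rightarrow> (spacetime \<Rightarrow> complex) \<Rightarrow> (spacetime \<Rightarrow> complex)
     \<Rightarrow> (spacetime \<Rightarrow> complex) \<Rightarrow> (spacetime \<Rightarrow> real) \<Rightarrow> bool" where
  "residual_gauge k p q r u p' q' r' u' \<longleftrightarrow>
     (\<exists>\<theta> :: spacetime \<Rightarrow> real. Ck k \<theta> \<and> \<theta> (0, 0, 0) = 0 \<and> (\<forall>w.
        p' w = p w - \<i> * D_z (\<lambda>v. of_real (\<theta> v)) w \<and>
        q' w = cis (- 2 * \<theta> w) * q w \<and>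
        r' w = cis (2 * \<theta> w) * r w \<and>
        u' w = u w - partial_t \<theta> w))"

end

theory Submission
  imports Defs
begin

text \<open>
  Both equations are flatness conditions on one and the same \<open>su(2)\<close> connection, seen in two gauges.

  Let \<open>G\<close> take values in \<open>SU(2)\<close> and write \<open>G\<^sub>e = G A\<^sub>e\<close> for its derivative along the axis \<open>e\<close>. The pair
  \<open>A\<^sub>x, A\<^sub>y\<close> of \<open>su(2)\<close> matrices is the same datum as the trace free complex matrix
  \<open>U = - (A\<^sub>x - \<i> A\<^sub>y)\<close>, because \<open>A\<^sub>x + \<i> A\<^sub>y\<close> is the adjoint of \<open>U\<close>. Hence the equations for \<open>G\<^sub>z\<close> and
  \<open>G\<^sub>t\<close> in the gauge transformation prescribe the whole connection, called \<open>lax p q r u\<close> below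
  (\<open>gauge_transformation_iff_frame\<close>). For this connection, having its \<open>t\<close>-component in \<open>su(2)\<close> is the
  second restriction (\<open>lax_t_su2_iff\<close>), flatness in the \<open>(x, y)\<close>-plane is the pair of restrictions
  (\<open>flat_xy_iff_restrictions\<close>), and flatness between \<open>t\<close> and \<open>z\<close> is the Schroedinger system
  (\<open>nls_at_iff_flat\<close>). A flat connection on \<open>\<real>\<^sup>3\<close> comes from some \<open>G\<close>
  (\<open>flat_connection_integrable\<close>), unique up to its value at the origin (\<open>frame_unique\<close>), and
  conversely the connection of any \<open>G\<close> is flat because mixed derivatives commute (\<open>frame_flat\<close>).

  The matrix \<open>S = - G \<sigma>\<^sub>3 G\<^sup>*\<close> has the derivatives \<open>S\<^sub>e = G [\<sigma>\<^sub>3, A\<^sub>e] G\<^sup>*\<close>. Two such differentiations turn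
  the Landau-Lifshitz equation into an algebraic condition: it fixes the off-diagonal entries of
  \<open>A\<^sub>t\<close> in terms of \<open>U\<close>, and the values are those of the Lax connection (\<open>landau_lifshitz_iff\<close>). The
  diagonal of \<open>A\<^sub>t\<close> is unconstrained and serves as the definition of \<open>u\<close>. The same formula for \<open>S\<^sub>t\<close>
  shows that the last order of smoothness of \<open>S\<close> is decided by the \<open>\<partial>\<close>-bar derivatives of \<open>q\<close>
  and \<open>r\<close> (\<open>spin_of_regularity\<close>).

  What remains is to write a given solution \<open>S\<close> as \<open>- G \<sigma>\<^sub>3 G\<^sup>*\<close> without losing smoothness
  (\<open>sphere_map_lift\<close>). The connection \<open>K\<^sub>e = S\<^sub>e S / 2\<close> transports \<open>S\<close> into itself but has
  curvature, which is a real multiple of \<open>\<i> S\<close>. Adding \<open>\<i> \<alpha>\<^sub>e S\<close> with a suitable real primitive \<open>\<alpha>\<close> removes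
  it, and the integrated \<open>G\<close> is one order smoother than the connection. Finally, two lifts of \<open>S\<close> differ by a
  diagonal matrix with entries \<open>cis \<theta>\<close> and \<open>cis (- \<theta>)\<close>, the stabiliser of \<open>\<sigma>\<^sub>3\<close>; integrating the difference of the diagonal
  entries of the two connections gives the phase \<open>\<theta>\<close> (\<open>phase_integral\<close>), which is the residual
  gauge freedom.
\<close>

text \<open>Points of space-time are treated as atoms rather than split into coordinates, and regularity
  statements are not unfolded by the simplifier.\<close>

declare split_paired_All [simp del] split_paired_Ex [simp del] Ck.simps(2) [simp del]

section \<open>Two by two matrices\<close>

definition adj :: "cmat \<Rightarrow> cmat" where
  "adj A = map_matrix cnj (transpose A)"

definition su2 :: "cmat set" where
  "su2 = {A. adj A = - A \<and> A$1$1 + A$2$2 = 0}"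

text \<open>Matrix identities are reduced to four scalar ones by this rule and the collection \<open>entries\<close> below.\<close>

lemma cmat_eq_iff:
  fixes A B :: cmat
  shows "A = B \<longleftrightarrow> A$1$1 = B$1$1 \<and> A$1$2 = B$1$2 \<and> A$2$1 = B$2$1 \<and> A$2$2 = B$2$2"
  by (simp add: vec_eq_iff forall_2)

lemma matmul_nth:
  fixes A B :: cmat
  shows "(A ** B)$i$j = A$i$1 * B$1$j + A$i$2 * B$2$j"
  by (simp add: matrix_matrix_mult_def sum_2)

lemma adj_nth: "adj A $ i $ j = cnj (A$j$i)"
  by (simp add: adj_def transpose_def)

lemma cscale_nth: "cscale c A $ i $ j = c * A$i$j"
  by (simp add: cscale_def)

lemma mat22_nth:
  "mat22 a b c d $ 1 $ 1 = a" "mat22 a b c d $ 1 $ 2 = b"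
  "mat22 a b c d $ 2 $ 1 = c" "mat22 a b c d $ 2 $ 2 = d"
  by (simp_all add: mat22_def)

lemma mat_nth:
  "(mat c :: cmat) $ 1 $ 1 = c" "(mat c :: cmat) $ 1 $ 2 = 0"
  "(mat c :: cmat) $ 2 $ 1 = 0" "(mat c :: cmat) $ 2 $ 2 = c"
  by (simp_all add: mat_def)

lemma sigma3_nth:
  "sigma3 $ 1 $ 1 = 1" "sigma3 $ 1 $ 2 = 0" "sigma3 $ 2 $ 1 = 0" "sigma3 $ 2 $ 2 = - 1"
  by (simp_all add: sigma3_def mat22_nth)

lemmas entries = matmul_nth adj_nth cscale_nth mat22_nth mat_nth sigma3_nth

lemma bounded_bilinear_matmul: "bounded_bilinear ((**) :: cmat \<Rightarrow> cmat \<Rightarrow> cmat)"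
  unfolding bilinear_conv_bounded_bilinear [symmetric] bilinear_def
  by (auto intro!: linearI simp: cmat_eq_iff entries algebra_simps)

interpretation matmul: bounded_bilinear "(**) :: cmat \<Rightarrow> cmat \<Rightarrow> cmat"
  by (rule bounded_bilinear_matmul)

lemma bounded_linear_adj: "bounded_linear adj"
  unfolding linear_conv_bounded_linear [symmetric]
  by (auto intro!: linearI simp: cmat_eq_iff entries algebra_simps)

lemma bounded_linear_cscale: "bounded_linear (cscale c)"
  unfolding linear_conv_bounded_linear [symmetric]
  by (auto intro!: linearI simp: cmat_eq_iff entries algebra_simps)

lemma bounded_linear_entry: "bounded_linear (\<lambda>A::cmat. A$i$j)"
  unfolding linear_conv_bounded_linear [symmetric]
  by (auto intro!: linearI simp: algebra_simps)

text \<open>Stated for the uncurried map, so that regularity of a matrix function follows from that of its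
  entries by the rules for linear maps and pairs.\<close>

lemma bounded_linear_mat22:
  "bounded_linear (\<lambda>(a, b, c, d). mat22 a b c d)"
  unfolding linear_conv_bounded_linear [symmetric]
  by (auto intro!: linearI simp: cmat_eq_iff entries algebra_simps)

lemma adj_matmul: "adj (A ** B) = adj B ** adj A"
  by (simp add: cmat_eq_iff entries algebra_simps)

lemma adj_adj [simp]: "adj (adj A) = A"
  by (simp add: cmat_eq_iff entries)

lemma adj_mat_1 [simp]: "adj (mat 1) = mat 1"
  by (simp add: cmat_eq_iff entries)

lemma adj_uminus: "adj (- A) = - adj A"
  by (simp add: cmat_eq_iff entries)

lemma SU2_iff: "A \<in> SU2 \<longleftrightarrow> A ** adj A = mat 1 \<and> det A = 1"
  by (simp add: SU2_def adj_def)

lemma SU2_unitary: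
  assumes "A \<in> SU2"
  shows "A ** adj A = mat 1" "adj A ** A = mat 1"
  using assms matrix_left_right_inverse [of A "adj A"] by (auto simp: SU2_iff)

lemma SU2_matrix_inv: "A \<in> SU2 \<Longrightarrow> matrix_inv A = adj A"
  unfolding matrix_inv_def
  using SU2_unitary [of A]
  by (intro some_equality conjI) (simp_all, metis matrix_mul_assoc matrix_mul_rid)

lemma SU2_mat_1: "mat 1 \<in> SU2"
  by (simp add: SU2_iff)

lemma SU2_adj: "A \<in> SU2 \<Longrightarrow> adj A \<in> SU2"
proof -
  assume A: "A \<in> SU2"
  have "det (adj A) = cnj (det A)" by (simp add: det_2 entries mult.commute)
  then show ?thesis using A SU2_unitary [of A] by (simp add: SU2_iff)
qed

lemma SU2_mult: "A \<in> SU2 \<Longrightarrow> B \<in> SU2 \<Longrightarrow> A ** B \<in> SU2"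
  using matrix_mul_assoc [of A B "adj B ** adj A"] matrix_mul_assoc [of B "adj B" "adj A"]
  by (auto simp: SU2_iff det_mul adj_matmul)

lemma SU2_cancel:
  assumes "G \<in> SU2"
  shows "G ** M ** adj G = G ** N ** adj G \<longleftrightarrow> M = N" "G ** M = G ** N \<longleftrightarrow> M = N"
proof -
  have 1: "M = N" if "G ** M = G ** N" for M N :: cmat
    using arg_cong [OF that, of "\<lambda>X. adj G ** X"] SU2_unitary [OF assms]
    by (simp add: matrix_mul_assoc)
  have "M = N" if "G ** M ** adj G = G ** N ** adj G"
    using arg_cong [OF that, of "\<lambda>X. X ** G"] SU2_unitary [OF assms] 1
    by (simp add: matrix_mul_assoc [symmetric])
  with 1 show "G ** M ** adj G = G ** N ** adj G \<longleftrightarrow> M = N" "G ** M = G ** N \<longleftrightarrow> M = N"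
    by auto
qed

lemma su2_entries:
  "A \<in> su2 \<longleftrightarrow> Re (A$1$1) = 0 \<and> A$2$2 = - A$1$1 \<and> A$2$1 = - cnj (A$1$2)"
  by (auto simp: su2_def cmat_eq_iff entries complex_eq_iff)

text \<open>Unitary matrices are bounded, which makes the estimates along integral curves uniform
  in the parameter.\<close>

lemma unitary_norm_le:
  assumes "A ** adj A = mat 1"
  shows "norm (A :: cmat) \<le> 4"
proof -
  have *: "cmod a \<le> 1" if "a * cnj a + b * cnj b = 1" for a b
  proof -
    have "of_real ((cmod a)\<^sup>2 + (cmod b)\<^sup>2) = (1 :: complex)"
      using that by (simp only: complex_norm_square of_real_add)
    then have "(cmod a)\<^sup>2 + (cmod b)\<^sup>2 = 1" by (metis of_real_eq_1_iff)
    then have "(cmod a)\<^sup>2 \<le> 1" by (smt (verit) zero_le_power2)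
    then show ?thesis by (simp add: abs_square_le_1)
  qed
  have e: "A$1$1 * cnj (A$1$1) + A$1$2 * cnj (A$1$2) = 1"
       "A$2$1 * cnj (A$2$1) + A$2$2 * cnj (A$2$2) = 1"
    using assms by (simp_all add: cmat_eq_iff entries)
  have "norm (A$1$1) \<le> 1" "norm (A$1$2) \<le> 1" "norm (A$2$1) \<le> 1" "norm (A$2$2) \<le> 1"
    using *[OF e(1)] *[OF e(2)] *[of "A$1$2" "A$1$1"] *[of "A$2$2" "A$2$1"] e
    by (simp_all add: add.commute)
  moreover have "norm v \<le> norm (v$1) + norm (v$2)" for v :: "'a::real_normed_vector ^ 2"
    using L2_set_le_sum [of UNIV "\<lambda>i. norm (v$i)"] by (simp add: norm_vec_def sum_2)
  then have "norm A \<le> norm (A$1) + norm (A$2)"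
    "norm (A$1) \<le> norm (A$1$1) + norm (A$1$2)" "norm (A$2) \<le> norm (A$2$1) + norm (A$2$2)"
    by blast+
  ultimately show ?thesis by linarith
qed

section \<open>Directional derivatives and joint regularity\<close>

text \<open>Derivatives along an arbitrary direction treat the three coordinates, and pairs of coordinates, by
  one argument each.\<close>

definition deriv_along ::
  "spacetime \<Rightarrow> (spacetime \<Rightarrow> 'a::real_normed_vector) \<Rightarrow> (spacetime \<Rightarrow> 'a) \<Rightarrow> bool" where
  "deriv_along e f f' \<longleftrightarrow> (\<forall>w. ((\<lambda>s. f (w + s *\<^sub>R e)) has_vector_derivative f' w) (at 0))"

abbreviation e_t :: spacetime where "e_t \<equiv> (1, 0, 0)"
abbreviation e_x :: spacetime where "e_x \<equiv> (0, 1, 0)"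
abbreviation e_y :: spacetime where "e_y \<equiv> (0, 0, 1)"

definition axes :: "spacetime set" where "axes = {e_t, e_x, e_y}"

lemma in_axes: "e_t \<in> axes" "e_x \<in> axes" "e_y \<in> axes"
  by (simp_all add: axes_def)

lemma has_vector_derivative_shift:
  "((\<lambda>s. g (a + s)) has_vector_derivative D) (at (b::real)) \<longleftrightarrow> (g has_vector_derivative D) (at (a + b))"
proof
  assume "((\<lambda>s. g (a + s)) has_vector_derivative D) (at b)"
  then have "((\<lambda>s. g (a + s)) \<circ> (\<lambda>s. s - a) has_vector_derivative (1 *\<^sub>R D)) (at (a + b))"
    by (intro vector_diff_chain_at) (auto intro!: derivative_eq_intros)
  then show "(g has_vector_derivative D) (at (a + b))" by (simp add: o_def)
next
  assume "(g has_vector_derivative D) (at (a + b))"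
  then have "(g \<circ> (\<lambda>s. a + s) has_vector_derivative (1 *\<^sub>R D)) (at b)"
    by (intro vector_diff_chain_at) (auto intro!: derivative_eq_intros)
  then show "((\<lambda>s. g (a + s)) has_vector_derivative D) (at b)" by (simp add: o_def)
qed

lemma deriv_alongD:
  "deriv_along e f f' \<Longrightarrow> ((\<lambda>s. f (w + s *\<^sub>R e)) has_vector_derivative f' w) (at 0)"
  unfolding deriv_along_def by blast

lemma deriv_along_line:
  assumes "deriv_along e f f'"
  shows "((\<lambda>s. f (w + s *\<^sub>R e)) has_vector_derivative f' (w + s *\<^sub>R e)) (at s)"
proof -
  have "((\<lambda>h. f (w + s *\<^sub>R e + h *\<^sub>R e)) has_vector_derivative f' (w + s *\<^sub>R e)) (at 0)"
    using assms unfolding deriv_along_def by blast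
  then have "((\<lambda>h. (\<lambda>s. f (w + s *\<^sub>R e)) (s + h)) has_vector_derivative f' (w + s *\<^sub>R e)) (at 0)"
    by (simp add: algebra_simps)
  then show ?thesis by (subst (asm) has_vector_derivative_shift) simp
qed

lemma deriv_along_unique:
  "deriv_along e f f' \<Longrightarrow> deriv_along e f f'' \<Longrightarrow> f' = f''"
  unfolding deriv_along_def by (metis ext vector_derivative_unique_at)

lemma deriv_along_coords:
  "deriv_along e_t f f' \<longleftrightarrow> (\<forall>t x y. ((\<lambda>\<tau>. f (\<tau>, x, y)) has_vector_derivative f' (t, x, y)) (at t))"
  "deriv_along e_x f f' \<longleftrightarrow> (\<forall>t x y. ((\<lambda>\<xi>. f (t, \<xi>, y)) has_vector_derivative f' (t, x, y)) (at x))"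
  "deriv_along e_y f f' \<longleftrightarrow> (\<forall>t x y. ((\<lambda>\<eta>. f (t, x, \<eta>)) has_vector_derivative f' (t, x, y)) (at y))"
  unfolding deriv_along_def split_paired_All
  by (simp_all add: has_vector_derivative_shift [where b = 0 and g = "\<lambda>\<tau>. f (\<tau>, _, _)", simplified]
      has_vector_derivative_shift [where b = 0 and g = "\<lambda>\<tau>. f (_, \<tau>, _)", simplified]
      has_vector_derivative_shift [where b = 0 and g = "\<lambda>\<tau>. f (_, _, \<tau>)", simplified])

lemma deriv_along_partials:
  "deriv_along e_t f f' \<Longrightarrow> partial_t f = f'"
  "deriv_along e_x f f' \<Longrightarrow> partial_x f = f'"
  "deriv_along e_y f f' \<Longrightarrow> partial_y f = f'"
  unfolding deriv_along_coords partial_t_def partial_x_def partial_y_def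
  by (auto intro!: vector_derivative_at)

lemma has_partials_iff:
  "has_partials f \<longleftrightarrow> deriv_along e_t f (partial_t f) \<and> deriv_along e_x f (partial_x f)
     \<and> deriv_along e_y f (partial_y f)"
  unfolding has_partials_def deriv_along_coords partial_t_def partial_x_def partial_y_def
  by (auto simp: vector_derivative_works)

text \<open>The form of the definition that the inductions below use: a single clause quantified over the axes.\<close>

lemma Ck_Suc_iff:
  "Ck (Suc k) f \<longleftrightarrow> continuous_on UNIV f \<and> (\<forall>e\<in>axes. \<exists>f'. deriv_along e f f' \<and> Ck k f')"
  (is "?L \<longleftrightarrow> ?R")
proof
  show "?L \<Longrightarrow> ?R" by (auto simp: axes_def has_partials_iff Ck.simps(2))
  assume ?R
  then obtain a b c where "deriv_along e_t f a" "deriv_along e_x f b" "deriv_along e_y f c"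
    and "continuous_on UNIV f" "Ck k a" "Ck k b" "Ck k c"
    by (auto simp: axes_def)
  moreover from this have "partial_t f = a" "partial_x f = b" "partial_y f = c"
    by (auto dest: deriv_along_partials)
  ultimately show ?L by (simp add: has_partials_iff Ck.simps(2))
qed

lemma Ck_SucI:
  assumes "continuous_on UNIV f" "\<And>e. e \<in> axes \<Longrightarrow> deriv_along e f (f' e)" "\<And>e. e \<in> axes \<Longrightarrow> Ck k (f' e)"
  shows "Ck (Suc k) f"
  using assms unfolding Ck_Suc_iff by blast

lemma Ck_continuous: "Ck k f \<Longrightarrow> continuous_on UNIV f"
  by (cases k) (auto simp: Ck.simps(2))

lemma Ck_SucD: "Ck (Suc k) f \<Longrightarrow> Ck k f"
proof (induction k arbitrary: f)
  case (Suc k)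
  from Suc.prems Suc.IH show ?case unfolding Ck_Suc_iff [of "Suc k"] Ck_Suc_iff [of k] by blast
qed (auto simp: Ck_continuous)

lemma Ck_mono: "Ck k f \<Longrightarrow> j \<le> k \<Longrightarrow> Ck j f"
proof (induction k)
  case (Suc k)
  then show ?case by (metis Ck_SucD le_Suc_eq)
qed simp

lemma Ck_deriv_along:
  assumes "Ck k f" "1 \<le> k" "e \<in> axes"
  obtains f' where "deriv_along e f f'" "Ck (k - 1) f'"
  using assms by (cases k) (simp_all add: Ck_Suc_iff, blast)

lemma deriv_along_Ck: "Ck k f \<Longrightarrow> 1 \<le> k \<Longrightarrow> e \<in> axes \<Longrightarrow> deriv_along e f f' \<Longrightarrow> Ck (k - 1) f'"
  by (metis Ck_deriv_along deriv_along_unique)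

lemma Ck_partials:
  assumes "Ck k f" "1 \<le> k"
  shows "deriv_along e_t f (partial_t f)" "deriv_along e_x f (partial_x f)" "deriv_along e_y f (partial_y f)"
    "Ck (k - 1) (partial_t f)" "Ck (k - 1) (partial_x f)" "Ck (k - 1) (partial_y f)"
  using assms by (cases k; simp add: has_partials_iff Ck.simps(2))+

lemma deriv_along_const: "deriv_along e (\<lambda>w. c) (\<lambda>w. 0)"
  by (simp add: deriv_along_def)

lemma deriv_along_add:
  "deriv_along e f f' \<Longrightarrow> deriv_along e g g' \<Longrightarrow> deriv_along e (\<lambda>w. f w + g w) (\<lambda>w. f' w + g' w)"
  by (simp add: deriv_along_def has_vector_derivative_add)

lemma deriv_along_linear:
  "bounded_linear L \<Longrightarrow> deriv_along e f f' \<Longrightarrow> deriv_along e (\<lambda>w. L (f w)) (\<lambda>w. L (f' w))"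
  unfolding deriv_along_def
  by (intro allI bounded_linear.has_vector_derivative [where f = L]) simp_all

lemma deriv_along_bilinear:
  assumes "bounded_bilinear mul" "deriv_along e f f'" "deriv_along e g g'"
  shows "deriv_along e (\<lambda>w. mul (f w) (g w)) (\<lambda>w. mul (f w) (g' w) + mul (f' w) (g w))"
proof -
  have "((\<lambda>s. mul (f (w + s *\<^sub>R e)) (g (w + s *\<^sub>R e))) has_vector_derivative
      mul (f (w + 0 *\<^sub>R e)) (g' w) + mul (f' w) (g (w + 0 *\<^sub>R e))) (at 0)" for w
    using assms by (intro bounded_bilinear.has_vector_derivative) (auto simp: deriv_along_def)
  then show ?thesis by (simp add: deriv_along_def)
qed

lemma deriv_along_Pair:
  "deriv_along e f f' \<Longrightarrow> deriv_along e g g' \<Longrightarrow> deriv_along e (\<lambda>w. (f w, g w)) (\<lambda>w. (f' w, g' w))"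
  by (simp add: deriv_along_def has_vector_derivative_Pair)

lemmas deriv_along_minus = deriv_along_linear [OF bounded_linear_minus [OF bounded_linear_ident]]
lemmas deriv_along_cnj = deriv_along_linear [OF bounded_linear_cnj]
lemmas deriv_along_of_real = deriv_along_linear [OF bounded_linear_of_real]
lemmas deriv_along_adj = deriv_along_linear [OF bounded_linear_adj]
lemmas deriv_along_cscale = deriv_along_linear [OF bounded_linear_cscale]
lemmas deriv_along_entry = deriv_along_linear [OF bounded_linear_entry]
lemmas deriv_along_mult = deriv_along_bilinear [OF bounded_bilinear_mult]
lemmas deriv_along_matmul = deriv_along_bilinear [OF bounded_bilinear_matmul]

lemma deriv_along_diff:
  "deriv_along e f f' \<Longrightarrow> deriv_along e g g' \<Longrightarrow> deriv_along e (\<lambda>w. f w - g w) (\<lambda>w. f' w - g' w)"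
  by (simp add: deriv_along_def has_vector_derivative_diff)

lemma deriv_along_mat22:
  assumes "deriv_along e a a'" "deriv_along e b b'" "deriv_along e c c'" "deriv_along e d d'"
  shows "deriv_along e (\<lambda>w. mat22 (a w) (b w) (c w) (d w)) (\<lambda>w. mat22 (a' w) (b' w) (c' w) (d' w))"
  using deriv_along_linear [OF bounded_linear_mat22
      deriv_along_Pair [OF assms(1) deriv_along_Pair [OF assms(2) deriv_along_Pair [OF assms(3,4)]]]]
  by simp

lemma Ck_const: "Ck k (\<lambda>w. c)"
proof (induction k arbitrary: c)
  case (Suc k)
  show ?case by (rule Ck_SucI [OF continuous_on_const deriv_along_const Suc.IH])
qed simp

lemma Ck_add:
  "Ck k f \<Longrightarrow> Ck k g \<Longrightarrow> Ck k (\<lambda>w. f w + g w)"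
proof (induction k arbitrary: f g)
  case (Suc k)
  show ?case unfolding Ck_Suc_iff
  proof (intro conjI ballI)
    show "continuous_on UNIV (\<lambda>w. f w + g w)"
      using Suc.prems by (intro continuous_on_add Ck_continuous)
    fix e assume "e \<in> axes"
    with Suc.prems obtain f' g' where "deriv_along e f f'" "Ck k f'" "deriv_along e g g'" "Ck k g'"
      unfolding Ck_Suc_iff by blast
    then show "\<exists>f'. deriv_along e (\<lambda>w. f w + g w) f' \<and> Ck k f'"
      using Suc.IH deriv_along_add by blast
  qed
qed (simp add: continuous_on_add)

lemma Ck_linear:
  assumes "bounded_linear L"
  shows "Ck k f \<Longrightarrow> Ck k (\<lambda>w. L (f w))"
proof (induction k arbitrary: f)
  case (Suc k)
  show ?case unfolding Ck_Suc_iff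
  proof (intro conjI ballI)
    show "continuous_on UNIV (\<lambda>w. L (f w))"
      using Suc.prems by (intro bounded_linear.continuous_on [OF assms] Ck_continuous)
    fix e assume "e \<in> axes"
    with Suc.prems obtain f' where "deriv_along e f f'" "Ck k f'"
      unfolding Ck_Suc_iff by blast
    then show "\<exists>f'. deriv_along e (\<lambda>w. L (f w)) f' \<and> Ck k f'"
      using Suc.IH deriv_along_linear [OF assms] by blast
  qed
qed (simp add: bounded_linear.continuous_on [OF assms])

lemma Ck_bilinear:
  assumes "bounded_bilinear mul"
  shows "Ck k f \<Longrightarrow> Ck k g \<Longrightarrow> Ck k (\<lambda>w. mul (f w) (g w))"
proof (induction k arbitrary: f g)
  case (Suc k)
  show ?case unfolding Ck_Suc_iff
  proof (intro conjI ballI)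
    show "continuous_on UNIV (\<lambda>w. mul (f w) (g w))"
      using Suc.prems by (intro bounded_bilinear.continuous_on [OF assms] Ck_continuous)
    fix e assume "e \<in> axes"
    with Suc.prems obtain f' g' where "deriv_along e f f'" "Ck k f'" "deriv_along e g g'" "Ck k g'"
      unfolding Ck_Suc_iff by blast
    moreover have "Ck k f" "Ck k g" using Suc.prems by (auto intro: Ck_SucD)
    ultimately show "\<exists>f'. deriv_along e (\<lambda>w. mul (f w) (g w)) f' \<and> Ck k f'"
      using Suc.IH deriv_along_bilinear [OF assms] Ck_add by blast
  qed
qed (simp add: bounded_bilinear.continuous_on [OF assms])

lemma Ck_Pair: "Ck k f \<Longrightarrow> Ck k g \<Longrightarrow> Ck k (\<lambda>w. (f w, g w))"
proof (induction k arbitrary: f g)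
  case (Suc k)
  show ?case unfolding Ck_Suc_iff
  proof (intro conjI ballI)
    show "continuous_on UNIV (\<lambda>w. (f w, g w))"
      using Suc.prems by (intro continuous_on_Pair Ck_continuous)
    fix e assume "e \<in> axes"
    with Suc.prems obtain f' g' where "deriv_along e f f'" "Ck k f'" "deriv_along e g g'" "Ck k g'"
      unfolding Ck_Suc_iff by blast
    then show "\<exists>f'. deriv_along e (\<lambda>w. (f w, g w)) f' \<and> Ck k f'"
      using Suc.IH deriv_along_Pair by blast
  qed
qed (simp add: continuous_on_Pair)

lemmas Ck_minus = Ck_linear [OF bounded_linear_minus [OF bounded_linear_ident]]
lemmas Ck_cnj = Ck_linear [OF bounded_linear_cnj]
lemmas Ck_of_real = Ck_linear [OF bounded_linear_of_real]
lemmas Ck_Re = Ck_linear [OF bounded_linear_Re]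
lemmas Ck_Im = Ck_linear [OF bounded_linear_Im]
lemmas Ck_adj = Ck_linear [OF bounded_linear_adj]
lemmas Ck_cscale = Ck_linear [OF bounded_linear_cscale]
lemmas Ck_entry = Ck_linear [OF bounded_linear_entry]
lemmas Ck_mult = Ck_bilinear [OF bounded_bilinear_mult]
lemmas Ck_matmul = Ck_bilinear [OF bounded_bilinear_matmul]

lemma Ck_diff: "Ck k f \<Longrightarrow> Ck k g \<Longrightarrow> Ck k (\<lambda>w. f w - g w)"
  using Ck_add [OF _ Ck_minus] by fastforce

lemma Ck_mat22:
  assumes "Ck k a" "Ck k b" "Ck k c" "Ck k d"
  shows "Ck k (\<lambda>w. mat22 (a w) (b w) (c w) (d w))"
  using Ck_linear [OF bounded_linear_mat22
      Ck_Pair [OF assms(1) Ck_Pair [OF assms(2) Ck_Pair [OF assms(3,4)]]]]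
  by simp

lemmas Ck_rules = Ck_const Ck_add Ck_diff Ck_minus Ck_cnj Ck_of_real Ck_Re Ck_Im Ck_adj Ck_cscale
  Ck_entry Ck_mult Ck_matmul Ck_mat22


lemma constant_of_zero_vector_derivative:
  assumes "\<And>s. (f has_vector_derivative 0) (at s)"
  shows "f s = f (0::real)"
proof -
  have "\<exists>c. \<forall>x\<in>UNIV. f x = c"
    using assms by (intro has_derivative_zero_constant) (auto simp: has_vector_derivative_def)
  then show ?thesis by auto
qed

lemma constant_of_zero_derivatives:
  assumes "\<And>e. e \<in> axes \<Longrightarrow> deriv_along e f (\<lambda>w. 0)"
  shows "f w = f (0, 0, 0)"
proof -
  have const: "f (v + s *\<^sub>R e) = f v" if e: "e \<in> axes" for v s e
    using constant_of_zero_vector_derivative [OF deriv_along_line [OF assms [OF e]]] by simp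
  obtain t x y where w: "w = (t, x, y)" by (metis prod_cases3)
  have "w = (0, 0, 0) + t *\<^sub>R e_t + x *\<^sub>R e_x + y *\<^sub>R e_y" by (simp add: w)
  then show ?thesis using const by (simp only: axes_def insert_iff simp_thms)
qed

lemma deriv_bound_segment:
  fixes f :: "real \<Rightarrow> 'a::real_normed_vector"
  assumes "\<And>\<sigma>. \<sigma> \<in> closed_segment a b \<Longrightarrow> (f has_vector_derivative f' \<sigma>) (at \<sigma>)"
    and "\<And>\<sigma>. \<sigma> \<in> closed_segment a b \<Longrightarrow> norm (f' \<sigma>) \<le> M"
  shows "norm (f b - f a) \<le> M * \<bar>b - a\<bar>"
proof -
  have "norm (f b - f a) \<le> M * norm (b - a)"
  proof (rule differentiable_bound [where S = "closed_segment a b" and f' = "\<lambda>\<sigma> h. h *\<^sub>R f' \<sigma>"])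
    show "(f has_derivative (\<lambda>h. h *\<^sub>R f' \<sigma>)) (at \<sigma> within closed_segment a b)"
      if "\<sigma> \<in> closed_segment a b" for \<sigma>
      using assms(1) [OF that] by (simp add: has_vector_derivative_def has_derivative_at_withinI)
    show "onorm (\<lambda>h. h *\<^sub>R f' \<sigma>) \<le> M" if "\<sigma> \<in> closed_segment a b" for \<sigma>
      using assms(2) [OF that] by (intro onorm_le) (simp add: mult.commute [of M] mult_left_mono)
  qed auto
  then show ?thesis by simp
qed

text \<open>Two nearby points are joined by three segments parallel to the axes, and the mean value inequality
  on each of them gives a local Lipschitz bound.\<close>

lemma continuous_of_locally_bounded_partials:
  fixes f :: "spacetime \<Rightarrow> 'a::real_normed_vector"
  assumes d: "\<And>e. e \<in> axes \<Longrightarrow> deriv_along e f (f' e)"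
    and b: "\<And>R. \<exists>M. \<forall>w\<in>cball 0 R. \<forall>e\<in>axes. norm (f' e w) \<le> M"
  shows "continuous_on UNIV f"
proof -
  have "isCont f w0" for w0
  proof -
    obtain t0 x0 y0 where w0: "w0 = (t0, x0, y0)" by (metis prod_cases3)
    obtain M where "\<forall>w\<in>cball 0 (norm w0 + 3). \<forall>e\<in>axes. norm (f' e w) \<le> M"
      using b by blast
    then have M: "norm (f' e w) \<le> M" if "norm w \<le> norm w0 + 3" "e \<in> axes" for w e
      using that by (simp only: Ball_def mem_cball_0)
    have step: "norm (f (w + s *\<^sub>R e) - f w) \<le> M * \<bar>s\<bar>"
      if "norm w \<le> norm w0 + 2" "\<bar>s\<bar> \<le> 1" "e \<in> axes" for w s e
    proof -
      have "norm e = 1" using that(3) by (auto simp: axes_def norm_Pair)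
      have "norm (w + \<sigma> *\<^sub>R e) \<le> norm w0 + 3" if "\<sigma> \<in> closed_segment 0 s" for \<sigma>
      proof -
        have "norm (w + \<sigma> *\<^sub>R e) \<le> norm w + \<bar>\<sigma>\<bar>"
          using norm_triangle_ineq [of w "\<sigma> *\<^sub>R e"] \<open>norm e = 1\<close> by simp
        moreover have "\<bar>\<sigma>\<bar> \<le> \<bar>s\<bar>" using that by (auto simp: closed_segment_eq_real_ivl split: if_splits)
        ultimately show ?thesis using \<open>norm w \<le> norm w0 + 2\<close> \<open>\<bar>s\<bar> \<le> 1\<close> by linarith
      qed
      then show ?thesis
        using deriv_bound_segment [of 0 s "\<lambda>\<sigma>. f (w + \<sigma> *\<^sub>R e)" "\<lambda>\<sigma>. f' e (w + \<sigma> *\<^sub>R e)" M]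
          deriv_along_line [OF d [OF that(3)]] M that(3) by simp
    qed
    have bound: "norm (f w - f w0) \<le> 3 * M * norm (w - w0)" if "norm (w - w0) \<le> 1" for w
    proof -
      obtain t x y where w: "w = (t, x, y)" by (metis prod_cases3)
      have c: "\<bar>t - t0\<bar> \<le> norm (w - w0)" "\<bar>x - x0\<bar> \<le> norm (w - w0)" "\<bar>y - y0\<bar> \<le> norm (w - w0)"
      proof -
        have "w - w0 = (t - t0, x - x0, y - y0)" by (simp add: w w0)
        then have n: "norm (w - w0) = sqrt ((t - t0)\<^sup>2 + ((x - x0)\<^sup>2 + (y - y0)\<^sup>2))"
          by (simp add: norm_Pair)
        show "\<bar>t - t0\<bar> \<le> norm (w - w0)" "\<bar>x - x0\<bar> \<le> norm (w - w0)" "\<bar>y - y0\<bar> \<le> norm (w - w0)"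
          unfolding n by (rule real_le_rsqrt; simp)+
      qed
      let ?w1 = "w0 + (t - t0) *\<^sub>R e_t" and ?w2 = "w0 + (t - t0) *\<^sub>R e_t + (x - x0) *\<^sub>R e_x"
      have w3: "?w2 + (y - y0) *\<^sub>R e_y = w" by (simp add: w w0)
      have "norm ?w1 \<le> norm w0 + \<bar>t - t0\<bar>"
        using norm_triangle_ineq [of w0 "(t - t0) *\<^sub>R e_t"] by (simp add: norm_Pair)
      moreover have "norm ?w2 \<le> norm ?w1 + \<bar>x - x0\<bar>"
        using norm_triangle_ineq [of ?w1 "(x - x0) *\<^sub>R e_x"] by (simp add: norm_Pair)
      ultimately have n: "norm ?w1 \<le> norm w0 + 2" "norm ?w2 \<le> norm w0 + 2"
        using c that by linarith+
      have "norm (f ?w1 - f w0) \<le> M * \<bar>t - t0\<bar>"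
        by (rule step) (use c that in \<open>auto simp: axes_def\<close>)
      moreover have "norm (f ?w2 - f ?w1) \<le> M * \<bar>x - x0\<bar>"
        by (rule step) (use c that n in \<open>auto simp: axes_def\<close>)
      moreover have "norm (f w - f ?w2) \<le> M * \<bar>y - y0\<bar>"
        unfolding w3 [symmetric] by (rule step) (use c that n in \<open>auto simp: axes_def\<close>)
      moreover have "f w - f w0 = (f w - f ?w2) + (f ?w2 - f ?w1) + (f ?w1 - f w0)" by simp
      then have "norm (f w - f w0) \<le> norm (f w - f ?w2) + norm (f ?w2 - f ?w1) + norm (f ?w1 - f w0)"
        by (metis norm_triangle_mono order_refl norm_triangle_ineq)
      moreover have "M \<ge> 0"
        by (rule order_trans [OF norm_ge_zero M [of w0 e_t]]) (simp_all add: axes_def)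
      ultimately show ?thesis
        using mult_left_mono [OF c(1) \<open>M \<ge> 0\<close>] mult_left_mono [OF c(2) \<open>M \<ge> 0\<close>]
          mult_left_mono [OF c(3) \<open>M \<ge> 0\<close>] by linarith
    qed
    show ?thesis
      unfolding isCont_def
    proof (rule Lim_null [THEN iffD2], rule Lim_null_comparison)
      show "\<forall>\<^sub>F w in at w0. norm (f w - f w0) \<le> 3 * M * norm (w - w0)"
        unfolding eventually_at by (rule exI [of _ 1]) (auto simp: dist_norm bound)
      show "((\<lambda>w. 3 * M * norm (w - w0)) \<longlongrightarrow> 0) (at w0)"
        by (intro tendsto_eq_intros) auto
    qed
  qed
  then show ?thesis by (simp add: continuous_at_imp_continuous_on)
qed

text \<open>Integrate \<open>f1\<close> along \<open>e\<close>, differentiate the result along \<open>e'\<close> under the integral sign, and then differentiate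
  the integral with respect to its upper limit.\<close>

lemma mixed_derivatives_commute:
  fixes f :: "spacetime \<Rightarrow> 'a::banach"
  assumes d: "deriv_along e f f1" "deriv_along e' f f2" "deriv_along e' f1 f12" "deriv_along e f2 f21"
    and c: "continuous_on UNIV f1" "continuous_on UNIV f12"
  shows "f12 = f21"
proof
  fix w
  have int: "((\<lambda>\<alpha>. f1 (w + \<alpha> *\<^sub>R e + b *\<^sub>R e')) has_integral
      (f (w + b *\<^sub>R e' + a *\<^sub>R e) - f (w + b *\<^sub>R e' - e))) {-1..a}" if "-1 \<le> a" for a b
  proof -
    have "((\<lambda>\<alpha>. f (w + b *\<^sub>R e' + \<alpha> *\<^sub>R e)) has_vector_derivative f1 (w + b *\<^sub>R e' + \<alpha> *\<^sub>R e)) (at \<alpha>)" for \<alpha>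
      by (rule deriv_along_line [OF d(1)])
    then have "((\<lambda>\<alpha>. f1 (w + b *\<^sub>R e' + \<alpha> *\<^sub>R e)) has_integral
      (f (w + b *\<^sub>R e' + a *\<^sub>R e) - f (w + b *\<^sub>R e' + (-1) *\<^sub>R e))) {-1..a}"
      using that by (intro fundamental_theorem_of_calculus) (auto intro: has_vector_derivative_at_within)
    then show ?thesis by (simp add: algebra_simps)
  qed
  have eq: "integral {-1..a} (\<lambda>\<alpha>. f12 (w + \<alpha> *\<^sub>R e)) = f2 (w + a *\<^sub>R e) - f2 (w - e)" if "-1 \<le> a" for a
  proof -
    have c12: "continuous_on S (\<lambda>x. f12 (h x))" if "continuous_on S h"
      for S and h :: "real \<times> real \<Rightarrow> _"
      by (rule continuous_on_compose2 [OF c(2) that]) simp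
    have "((\<lambda>b. integral (cbox (-1) a) (\<lambda>\<alpha>. f1 (w + \<alpha> *\<^sub>R e + b *\<^sub>R e'))) has_vector_derivative
        integral (cbox (-1) a) (\<lambda>\<alpha>. f12 (w + \<alpha> *\<^sub>R e + 0 *\<^sub>R e'))) (at 0 within UNIV)"
    proof (rule leibniz_rule_vector_derivative)
      show "((\<lambda>b. f1 (w + \<alpha> *\<^sub>R e + b *\<^sub>R e')) has_vector_derivative f12 (w + \<alpha> *\<^sub>R e + b *\<^sub>R e'))
          (at b within UNIV)" for b \<alpha>
        by (rule deriv_along_line [OF d(3)])
      show "(\<lambda>\<alpha>. f1 (w + \<alpha> *\<^sub>R e + b *\<^sub>R e')) integrable_on cbox (- 1) a" for b
        using int [OF that, of b] by (auto simp: integrable_on_def)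
      show "continuous_on (UNIV \<times> cbox (- 1) a) (\<lambda>(b, \<alpha>). f12 (w + \<alpha> *\<^sub>R e + b *\<^sub>R e'))"
        unfolding case_prod_unfold by (rule c12) (intro continuous_intros)
    qed auto
    then have 1: "((\<lambda>b. f (w + b *\<^sub>R e' + a *\<^sub>R e) - f (w + b *\<^sub>R e' - e)) has_vector_derivative
        integral {-1..a} (\<lambda>\<alpha>. f12 (w + \<alpha> *\<^sub>R e))) (at 0)"
      using int [OF that, THEN integral_unique] by simp
    have 2: "((\<lambda>b. f (w + a *\<^sub>R e + b *\<^sub>R e') - f (w - e + b *\<^sub>R e')) has_vector_derivative
        f2 (w + a *\<^sub>R e) - f2 (w - e)) (at 0)"
      by (intro has_vector_derivative_diff deriv_alongD [OF d(2)])
    have 3: "(\<lambda>b. f (w + b *\<^sub>R e' + a *\<^sub>R e) - f (w + b *\<^sub>R e' - e)) =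
        (\<lambda>b. f (w + a *\<^sub>R e + b *\<^sub>R e') - f (w - e + b *\<^sub>R e'))"
      by (simp add: algebra_simps)
    show ?thesis by (rule vector_derivative_unique_at [OF 1 [unfolded 3] 2])
  qed
  have "((\<lambda>a. integral {-1..a} (\<lambda>\<alpha>. f12 (w + \<alpha> *\<^sub>R e))) has_vector_derivative f12 (w + 0 *\<^sub>R e))
      (at 0 within {-1..1})"
    by (intro integral_has_vector_derivative continuous_on_compose2 [OF c(2) _ subset_UNIV]
        continuous_intros) simp
  then have "((\<lambda>a. integral {-1..a} (\<lambda>\<alpha>. f12 (w + \<alpha> *\<^sub>R e))) has_vector_derivative f12 w)
      (at 0 within {-1<..<1})"
    by (auto intro: has_vector_derivative_within_subset)
  then have "((\<lambda>a. f2 (w + a *\<^sub>R e) - f2 (w - e)) has_vector_derivative f12 w) (at 0 within {-1<..<1})"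
    by (rule has_vector_derivative_transform [rotated 2]) (simp_all add: eq)
  then have 1: "((\<lambda>a. f2 (w + a *\<^sub>R e) - f2 (w - e)) has_vector_derivative f12 w) (at 0)"
    unfolding at_within_open [of 0 "{-1<..<1::real}", simplified] .
  have 2: "((\<lambda>a. f2 (w + a *\<^sub>R e) - f2 (w - e)) has_vector_derivative f21 w - 0) (at 0)"
    by (intro has_vector_derivative_diff deriv_alongD [OF d(4)]) simp
  show "f12 w = f21 w" using vector_derivative_unique_at [OF 1 2] by simp
qed

lemma Ck2_mixed_derivatives_commute:
  fixes f :: "spacetime \<Rightarrow> 'a::banach"
  assumes "Ck 2 f" "e \<in> axes" "e' \<in> axes"
    and d: "deriv_along e f f1" "deriv_along e' f f2" "deriv_along e' f1 f12" "deriv_along e f2 f21"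
  shows "f12 = f21"
proof -
  have "Ck 1 f1" using deriv_along_Ck [OF assms(1) _ assms(2) d(1)] by simp
  moreover have "Ck 0 f12" using deriv_along_Ck [OF calculation _ assms(3) d(3)] by simp
  ultimately show ?thesis
    using mixed_derivatives_commute [OF d] Ck_continuous by blast
qed

section \<open>Primitives along a coordinate axis\<close>

text \<open>The integral from the hyperplane \<open>w \<bullet> e = 0\<close> to \<open>w\<close>, rescaled to the unit interval: the domain
  is then fixed and no sign convention is needed when \<open>w \<bullet> e < 0\<close>.\<close>

definition primitive_along :: "spacetime \<Rightarrow> (spacetime \<Rightarrow> real) \<Rightarrow> spacetime \<Rightarrow> real" where
  "primitive_along e f w = integral (cbox 0 1) (\<lambda>s. (w \<bullet> e) * f (w + ((s - 1) * (w \<bullet> e)) *\<^sub>R e))"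

lemma primitive_along_zero: "w \<bullet> e = 0 \<Longrightarrow> primitive_along e f w = 0"
  by (simp add: primitive_along_def)

lemma continuous_primitive_along:
  assumes "continuous_on UNIV f"
  shows "continuous_on UNIV (primitive_along e f)"
  unfolding primitive_along_def [abs_def]
  by (rule integral_continuous_on_param, unfold case_prod_unfold)
    (intro continuous_intros continuous_on_compose2 [OF assms _ subset_UNIV])

lemma deriv_along_primitive_orthogonal:
  assumes "deriv_along e' f f'" "continuous_on UNIV f" "continuous_on UNIV f'" "e' \<bullet> e = 0"
  shows "deriv_along e' (primitive_along e f) (primitive_along e f')"
  unfolding deriv_along_def
proof
  fix w
  note c = continuous_on_compose2 [OF assms(2) _ subset_UNIV] continuous_on_compose2 [OF assms(3) _ subset_UNIV]
  have "((\<lambda>h. integral (cbox 0 1) (\<lambda>s. (w \<bullet> e) * f (w + ((s - 1) * (w \<bullet> e)) *\<^sub>R e + h *\<^sub>R e')))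
      has_vector_derivative
      integral (cbox 0 1) (\<lambda>s. (w \<bullet> e) * f' (w + ((s - 1) * (w \<bullet> e)) *\<^sub>R e + 0 *\<^sub>R e'))) (at 0 within UNIV)"
  proof (rule leibniz_rule_vector_derivative)
    fix h s
    show "((\<lambda>h. (w \<bullet> e) * f (w + ((s - 1) * (w \<bullet> e)) *\<^sub>R e + h *\<^sub>R e')) has_vector_derivative
        (w \<bullet> e) * f' (w + ((s - 1) * (w \<bullet> e)) *\<^sub>R e + h *\<^sub>R e')) (at h within UNIV)"
      by (intro has_vector_derivative_mult_right deriv_along_line [OF assms(1)])
    show "(\<lambda>s. w \<bullet> e * f (w + ((s - 1) * (w \<bullet> e)) *\<^sub>R e + h *\<^sub>R e')) integrable_on cbox 0 1"
      by (intro integrable_continuous continuous_intros c)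
    show "continuous_on (UNIV \<times> cbox 0 1) (\<lambda>(h, s). w \<bullet> e * f' (w + ((s - 1) * (w \<bullet> e)) *\<^sub>R e + h *\<^sub>R e'))"
      unfolding case_prod_unfold
      by (intro continuous_intros c)
  qed auto
  then show "((\<lambda>h. primitive_along e f (w + h *\<^sub>R e')) has_vector_derivative primitive_along e f' w) (at 0)"
    using assms(4) by (simp add: primitive_along_def inner_add_left algebra_simps)
qed

text \<open>Because of the rescaling, the derivative comes out as the integral of
  \<open>s (w \<bullet> e) f' + f\<close>, which is the total derivative of \<open>s f\<close> along the segment.\<close>

lemma deriv_along_primitive:
  assumes "deriv_along e f f'" "continuous_on UNIV f" "continuous_on UNIV f'" "e \<bullet> e = 1"
  shows "deriv_along e (primitive_along e f) f"
  unfolding deriv_along_def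
proof
  fix w
  note c = continuous_on_compose2 [OF assms(2) _ subset_UNIV] continuous_on_compose2 [OF assms(3) _ subset_UNIV]
  define P where "P s = w + ((s - 1) * (w \<bullet> e)) *\<^sub>R e" for s
  have 1: "((\<lambda>h. integral (cbox 0 1) (\<lambda>s. (w \<bullet> e + h) * f (P s + (s * h) *\<^sub>R e)))
      has_vector_derivative
      integral (cbox 0 1) (\<lambda>s. (w \<bullet> e + 0) * (s * f' (P s + (s * 0) *\<^sub>R e)) + 1 * f (P s + (s * 0) *\<^sub>R e)))
      (at 0 within UNIV)"
  proof (rule leibniz_rule_vector_derivative)
    fix h s :: real
    have "((\<lambda>\<sigma>. f (P s + \<sigma> *\<^sub>R e)) \<circ> (\<lambda>h. s * h) has_vector_derivative
        s *\<^sub>R f' (P s + (s * h) *\<^sub>R e)) (at h)"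
      by (rule vector_diff_chain_at [OF _ deriv_along_line [OF assms(1)]])
        (auto intro!: derivative_eq_intros)
    then show "((\<lambda>h. (w \<bullet> e + h) * f (P s + (s * h) *\<^sub>R e)) has_vector_derivative
        (w \<bullet> e + h) * (s * f' (P s + (s * h) *\<^sub>R e)) + 1 * f (P s + (s * h) *\<^sub>R e)) (at h within UNIV)"
      by (intro has_vector_derivative_mult) (auto simp: o_def intro!: derivative_eq_intros)
    show "(\<lambda>s. (w \<bullet> e + h) * f (P s + (s * h) *\<^sub>R e)) integrable_on cbox 0 1"
      unfolding P_def by (intro integrable_continuous continuous_intros c)
    show "continuous_on (UNIV \<times> cbox 0 1) (\<lambda>(h, s). (w \<bullet> e + h) * (s * f' (P s + (s * h) *\<^sub>R e)) + 1 * f (P s + (s * h) *\<^sub>R e))"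
      unfolding case_prod_unfold P_def
      by (intro continuous_intros c)
  qed auto
  have 2: "(w + h *\<^sub>R e) \<bullet> e = w \<bullet> e + h" for h
    using assms(4) by (simp add: inner_add_left)
  have 3: "w + h *\<^sub>R e + ((s - 1) * (w \<bullet> e + h)) *\<^sub>R e = P s + (s * h) *\<^sub>R e" for s h
    unfolding P_def by (simp add: algebra_simps)
  have "((\<lambda>s. s * ((w \<bullet> e) * f' (P s)) + 1 * f (P s)) has_integral 1 * f (P 1) - 0 * f (P 0)) {0..1}"
  proof (rule fundamental_theorem_of_calculus)
    fix s :: real
    have "((\<lambda>\<sigma>. f (w + \<sigma> *\<^sub>R e)) \<circ> (\<lambda>s. (s - 1) * (w \<bullet> e)) has_vector_derivative
        (w \<bullet> e) *\<^sub>R f' (w + ((s - 1) * (w \<bullet> e)) *\<^sub>R e)) (at s)"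
      by (rule vector_diff_chain_at [OF _ deriv_along_line [OF assms(1)]])
        (auto intro!: derivative_eq_intros)
    then have "((\<lambda>s. f (P s)) has_vector_derivative (w \<bullet> e) * f' (P s)) (at s)"
      by (simp add: P_def o_def)
    then have "((\<lambda>s. s * f (P s)) has_vector_derivative s * ((w \<bullet> e) * f' (P s)) + 1 * f (P s)) (at s)"
      by (intro has_vector_derivative_mult) (auto intro!: derivative_eq_intros)
    then show "((\<lambda>s. s * f (P s)) has_vector_derivative s * ((w \<bullet> e) * f' (P s)) + 1 * f (P s))
        (at s within {0..1})" by (rule has_vector_derivative_at_within)
  qed auto
  from integral_unique [OF this]
  have 4: "integral (cbox 0 1) (\<lambda>s. (w \<bullet> e + 0) * (s * f' (P s + (s * 0) *\<^sub>R e)) + 1 * f (P s + (s * 0) *\<^sub>R e)) = f (P 1)"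
    by (simp add: mult.left_commute)
  have 5: "P 1 = w" by (simp add: P_def)
  have 6: "primitive_along e f (w + h *\<^sub>R e) =
      integral (cbox 0 1) (\<lambda>s. (w \<bullet> e + h) * f (P s + (s * h) *\<^sub>R e))" for h
    unfolding primitive_along_def 2 3 ..
  show "((\<lambda>h. primitive_along e f (w + h *\<^sub>R e)) has_vector_derivative f w) (at 0)"
    using 1 unfolding 4 5 6 .
qed

lemma axes_inner: "e \<in> axes \<Longrightarrow> e' \<in> axes \<Longrightarrow> e \<bullet> e' = (if e = e' then 1 else 0)"
  unfolding axes_def by (elim insertE emptyE) (simp_all add: inner_prod_def)

text \<open>No derivative is lost: differentiating along \<open>e\<close> returns \<open>f\<close>, and along the other axes it
  returns a primitive of a derivative of \<open>f\<close>.\<close>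

lemma Ck_primitive_along:
  assumes "e \<in> axes"
  shows "Ck k f \<Longrightarrow> Ck k (primitive_along e f)"
proof (induction k arbitrary: f)
  case (Suc k)
  show ?case unfolding Ck_Suc_iff
  proof (intro conjI ballI)
    show "continuous_on UNIV (primitive_along e f)"
      using Suc.prems by (intro continuous_primitive_along Ck_continuous)
    fix e' assume e': "e' \<in> axes"
    with Suc.prems obtain f' where f': "deriv_along e' f f'" "Ck k f'"
      unfolding Ck_Suc_iff by blast
    have c: "continuous_on UNIV f" "continuous_on UNIV f'"
      using Ck_continuous [OF Suc.prems] Ck_continuous [OF f'(2)] .
    show "\<exists>f'. deriv_along e' (primitive_along e f) f' \<and> Ck k f'"
    proof (cases "e' = e")
      case True
      then have "deriv_along e' (primitive_along e f) f"
        using deriv_along_primitive [OF _ c] f'(1) axes_inner [OF assms assms] by simp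
      then show ?thesis using Ck_SucD [OF Suc.prems] by blast
    next
      case False
      then have "e' \<bullet> e = 0" using axes_inner [OF e' assms] by simp
      then show ?thesis
        using deriv_along_primitive_orthogonal [OF f'(1) c] Suc.IH [OF f'(2)] by blast
    qed
  qed
qed (simp add: continuous_primitive_along)

text \<open>The values of \<open>f\<close> on the hyperplane \<open>w \<bullet> e = 0\<close>, extended constantly along \<open>e\<close>.\<close>

definition restrict_along :: "spacetime \<Rightarrow> (spacetime \<Rightarrow> 'a) \<Rightarrow> spacetime \<Rightarrow> 'a" where
  "restrict_along e f w = f (w - (w \<bullet> e) *\<^sub>R e)"

lemma deriv_along_restrict:
  assumes "e \<bullet> e = 1"
  shows "deriv_along e (restrict_along e f) (\<lambda>w. 0)"
  unfolding deriv_along_def restrict_along_def using assms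
  by (simp add: inner_add_left algebra_simps)

lemma deriv_along_restrict_orthogonal:
  assumes "e' \<bullet> e = 0" "deriv_along e' f f'"
  shows "deriv_along e' (restrict_along e f) (restrict_along e f')"
  unfolding deriv_along_def
proof
  fix w
  have "((\<lambda>s. f (w - (w \<bullet> e) *\<^sub>R e + s *\<^sub>R e')) has_vector_derivative f' (w - (w \<bullet> e) *\<^sub>R e)) (at 0)"
    using assms(2) unfolding deriv_along_def by blast
  then show "((\<lambda>s. restrict_along e f (w + s *\<^sub>R e')) has_vector_derivative restrict_along e f' w) (at 0)"
    using assms(1) by (simp add: restrict_along_def inner_add_left algebra_simps)
qed

lemma Ck_restrict_along:
  assumes "e \<in> axes"
  shows "Ck k f \<Longrightarrow> Ck k (restrict_along e f)"
proof (induction k arbitrary: f)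
  case 0
  then show ?case unfolding restrict_along_def [abs_def] Ck.simps(1)
    by (rule continuous_on_compose2 [OF _ _ subset_UNIV]) (intro continuous_intros)
next
  case (Suc k)
  show ?case unfolding Ck_Suc_iff
  proof (intro conjI ballI)
    show "continuous_on UNIV (restrict_along e f)"
      unfolding restrict_along_def [abs_def] using Ck_continuous [OF Suc.prems]
      by (rule continuous_on_compose2 [OF _ _ subset_UNIV]) (intro continuous_intros)
    fix e' assume e': "e' \<in> axes"
    with Suc.prems obtain f' where f': "deriv_along e' f f'" "Ck k f'"
      unfolding Ck_Suc_iff by blast
    show "\<exists>f'. deriv_along e' (restrict_along e f) f' \<and> Ck k f'"
    proof (cases "e' = e")
      case True
      then show ?thesis
        using axes_inner [OF assms assms] deriv_along_restrict [of e f] Ck_const by auto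
    next
      case False
      then show ?thesis
        using deriv_along_restrict_orthogonal [OF _ f'(1), of e] Suc.IH [OF f'(2)] axes_inner [OF e' assms]
        by auto
    qed
  qed
qed


section \<open>Linear ordinary differential equations\<close>

text \<open>The step in the factorial bound for the Picard iterates.\<close>

lemma power_bound_of_derivative_bound:
  fixes f :: "real \<Rightarrow> 'a::real_normed_vector"
  assumes d: "\<And>s. (f has_vector_derivative f' s) (at s)" and "f 0 = 0"
    and b: "\<And>s. \<bar>s\<bar> \<le> T \<Longrightarrow> norm (f' s) \<le> c * \<bar>s\<bar> ^ n"
    and "\<bar>s\<bar> \<le> T"
  shows "norm (f s) \<le> c * \<bar>s\<bar> ^ Suc n / real (Suc n)"
proof -
  have pos: "norm (g r) \<le> c * r ^ Suc n / real (Suc n)"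
    if g: "\<And>s. (g has_vector_derivative g' s) (at s)" "g 0 = 0"
      and gb: "\<And>s. \<bar>s\<bar> \<le> T \<Longrightarrow> norm (g' s) \<le> c * \<bar>s\<bar> ^ n" and r: "0 < r" "r \<le> T"
    for g g' :: "real \<Rightarrow> 'a" and r
  proof -
    have "norm (g r - g 0) \<le> c * r ^ Suc n / real (Suc n) - c * 0 ^ Suc n / real (Suc n)"
    proof (rule differentiable_bound_general [OF \<open>0 < r\<close>])
      show "continuous_on {0..r} g"
        using g(1) by (meson continuous_at_imp_continuous_on has_vector_derivative_continuous)
      show "((\<lambda>r. c * r ^ Suc n / real (Suc n)) has_vector_derivative c * x ^ n) (at x)" for x
      proof -
        have "((\<lambda>r. c * r ^ Suc n / real (Suc n)) has_real_derivative
            c * (real (Suc n) * x ^ n) / real (Suc n)) (at x)"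
          using DERIV_pow [of "Suc n" x] by (intro DERIV_cdivide DERIV_cmult) simp
        then show ?thesis
          by (simp add: has_real_derivative_iff_has_vector_derivative del: of_nat_Suc)
      qed
      show "norm (g' x) \<le> c * x ^ n" if "0 < x" "x < r" for x
        using gb [of x] that r by simp
    qed (use g in \<open>auto intro!: continuous_intros simp del: of_nat_Suc\<close>)
    then show ?thesis using g(2) by simp
  qed
  consider "s = 0" | "s > 0" | "s < 0" by linarith
  then show ?thesis
  proof cases
    case 1
    then show ?thesis using assms(2) by simp
  next
    case 2
    then show ?thesis using pos [OF d assms(2) b, of s] assms(4) by simp
  next
    case 3
    have "((\<lambda>s. f (- s)) has_vector_derivative - f' (- s)) (at s)" for s
    proof -
      have "(uminus has_vector_derivative - 1) (at s)"
        using has_vector_derivative_minus [OF has_vector_derivative_id] by simp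
      from vector_diff_chain_at [OF this d] show ?thesis by (simp add: o_def)
    qed
    then have "norm (f (- (- s))) \<le> c * (- s) ^ Suc n / real (Suc n)"
    proof (rule pos)
      show "norm (- f' (- s)) \<le> c * \<bar>s\<bar> ^ n" if "\<bar>s\<bar> \<le> T" for s
        using b [of "- s"] that by simp
    qed (use assms 3 in auto)
    then show ?thesis using 3 by simp
  qed
qed

lemma antiderivative_exists:
  fixes f :: "real \<Rightarrow> 'a::euclidean_space"
  assumes "continuous_on UNIV f"
  shows "\<exists>F. F 0 = 0 \<and> (\<forall>s. (F has_vector_derivative f s) (at s))"
proof -
  obtain F where F: "\<And>s. (F has_vector_derivative f s) (at s)"
    using einterval_antiderivative [of "-\<infinity>" "\<infinity>" f] assms
    by (auto simp: continuous_on_eq_continuous_at)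
  have "((\<lambda>s. F s - F 0) has_vector_derivative f s - 0) (at s)" for s
    by (intro has_vector_derivative_diff F has_vector_derivative_const)
  then show ?thesis by (intro exI [of _ "\<lambda>s. F s - F 0"]) simp
qed

text \<open>The solution is the sum of the Picard iterates. Up to a constant factor they are bounded by \<open>(M |s|)\<^sup>n / n!\<close> on every bounded
  interval, so the series and its termwise derivative converge uniformly there.\<close>

theorem linear_ode_solution_exists:
  fixes mul :: "'v::euclidean_space \<Rightarrow> 'b::real_normed_vector \<Rightarrow> 'v"
  assumes mul: "bounded_bilinear mul" and A: "continuous_on UNIV A"
  shows "\<exists>g. g 0 = v0 \<and> (\<forall>s::real. (g has_vector_derivative mul (g s) (A s)) (at s))"
proof -
  interpret bounded_bilinear mul by (rule mul)
  (* One Picard step; the choice picks the antiderivative that vanishes at 0. *)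
  define picard where "picard f = (SOME F. F 0 = 0 \<and> (\<forall>s. (F has_vector_derivative mul (f s) (A s)) (at s)))" for f
  have picard: "picard f 0 = 0 \<and> (\<forall>s. (picard f has_vector_derivative mul (f s) (A s)) (at s))"
    if "continuous_on UNIV f" for f
    unfolding picard_def
    by (rule someI_ex [OF antiderivative_exists]) (intro continuous_on that A)
  define F where "F n = (picard ^^ n) (\<lambda>s. v0)" for n
  have contF: "continuous_on UNIV (F n)" for n
  proof (induction n)
    case (Suc n)
    then show ?case
      using picard [OF Suc] by (auto simp: F_def intro!: continuous_at_imp_continuous_on
        dest: has_vector_derivative_continuous)
  qed (simp add: F_def)
  have F0: "F 0 = (\<lambda>s. v0)" by (simp add: F_def)
  have FSuc0: "F (Suc n) 0 = 0" for n
    using picard [OF contF] by (simp add: F_def)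
  have dF: "(F (Suc n) has_vector_derivative mul (F n s) (A s)) (at s)" for n s
    using picard [OF contF] by (simp add: F_def)
  obtain K where K: "K > 0" "\<And>a b. norm (mul a b) \<le> norm a * norm b * K"
    using pos_bounded by blast
  define P where "P n s = (\<Sum>i<n. F i s)" for n s
  have dP: "(P (Suc n) has_vector_derivative mul (P n s) (A s)) (at s)" for n s
  proof -
    have "((\<lambda>s. (\<Sum>i<n. F (Suc i) s)) has_vector_derivative (\<Sum>i<n. mul (F i s) (A s))) (at s)"
      by (intro has_vector_derivative_sum dF)
    then have "((\<lambda>s. v0 + (\<Sum>i<n. F (Suc i) s)) has_vector_derivative 0 + (\<Sum>i<n. mul (F i s) (A s))) (at s)"
      by (intro has_vector_derivative_add has_vector_derivative_const)
    then show ?thesis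
      unfolding P_def sum.lessThan_Suc_shift by (simp add: F0 sum_left)
  qed
  have bound: "\<exists>M. \<forall>n. \<forall>s. \<bar>s\<bar> \<le> T \<longrightarrow> norm (F n s) \<le> norm v0 * (M * \<bar>s\<bar>) ^ n / fact n"
    and boundA: "\<exists>M>0. \<forall>s. \<bar>s\<bar> \<le> T \<longrightarrow> norm (A s) \<le> M" for T
  proof -
    have "compact (A ` {-T..T})"
      by (rule compact_continuous_image [OF continuous_on_subset [OF A]]) auto
    from compact_imp_bounded [OF this] obtain M where "M > 0" "\<forall>x\<in>A ` {-T..T}. norm x \<le> M"
      unfolding bounded_pos by blast
    then have M: "norm (A s) \<le> M" if "\<bar>s\<bar> \<le> T" for s
      using that by (auto simp: abs_le_iff)
    show "\<exists>M>0. \<forall>s. \<bar>s\<bar> \<le> T \<longrightarrow> norm (A s) \<le> M"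
      using \<open>M > 0\<close> M by blast
    have "\<forall>s. \<bar>s\<bar> \<le> T \<longrightarrow> norm (F n s) \<le> norm v0 * (K * M * \<bar>s\<bar>) ^ n / fact n" for n
    proof (induction n)
      case 0
      then show ?case by (simp add: F0)
    next
      case (Suc n)
      show ?case
      proof (intro allI impI)
        fix s :: real assume s: "\<bar>s\<bar> \<le> T"
        have "norm (mul (F n s) (A s)) \<le> (norm v0 * (K * M) ^ Suc n / fact n) * \<bar>s\<bar> ^ n"
          if "\<bar>s\<bar> \<le> T" for s
        proof -
          have "norm (mul (F n s) (A s)) \<le> norm (F n s) * norm (A s) * K" by (rule K)
          also have "\<dots> \<le> (norm v0 * (K * M * \<bar>s\<bar>) ^ n / fact n) * M * K"
            using Suc that M \<open>M > 0\<close> K(1) by (intro mult_right_mono mult_mono) auto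
          also have "\<dots> = (norm v0 * (K * M) ^ Suc n / fact n) * \<bar>s\<bar> ^ n"
            by (simp add: power_mult_distrib)
          finally show ?thesis .
        qed
        from power_bound_of_derivative_bound [OF dF FSuc0 this s]
        show "norm (F (Suc n) s) \<le> norm v0 * (K * M * \<bar>s\<bar>) ^ Suc n / fact (Suc n)"
          by (simp add: power_mult_distrib mult_ac)
      qed
    qed
    then show "\<exists>M. \<forall>n. \<forall>s. \<bar>s\<bar> \<le> T \<longrightarrow> norm (F n s) \<le> norm v0 * (M * \<bar>s\<bar>) ^ n / fact n"
      by blast
  qed
  define g where "g s = (\<Sum>n. F n s)" for s
  have unif: "uniform_limit {-T..T} P g sequentially" for T
  proof -
    obtain M where M: "\<And>n s. \<bar>s\<bar> \<le> T \<Longrightarrow> norm (F n s) \<le> norm v0 * (M * \<bar>s\<bar>) ^ n / fact n"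
      using bound by blast
    have "norm (F n s) \<le> norm v0 * (inverse (fact n) * (\<bar>M\<bar> * T) ^ n)" if "s \<in> {-T..T}" for n s
    proof -
      have s: "\<bar>s\<bar> \<le> T" using that by auto
      have "(M * \<bar>s\<bar>) ^ n \<le> \<bar>M * \<bar>s\<bar>\<bar> ^ n" by (metis abs_ge_self power_abs)
      also have "\<dots> \<le> (\<bar>M\<bar> * T) ^ n" using s by (intro power_mono) (auto simp: abs_mult mult_left_mono)
      finally have "norm v0 * (M * \<bar>s\<bar>) ^ n / fact n \<le> norm v0 * (\<bar>M\<bar> * T) ^ n / fact n"
        by (intro divide_right_mono mult_left_mono) auto
      then show ?thesis using M [OF s, of n] by (simp add: divide_inverse mult_ac)
    qed
    then have "uniform_limit {-T..T} (\<lambda>n s. \<Sum>i<n. F i s) (\<lambda>s. \<Sum>i. F i s) sequentially"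
      by (rule Weierstrass_m_test) (assumption, intro summable_mult summable_exp)
    then show ?thesis by (simp add: P_def [abs_def] g_def [abs_def])
  qed
  have lim: "(\<lambda>n. P n s) \<longlonglongrightarrow> g s" for s
    by (rule tendsto_uniform_limitI [OF unif [of "\<bar>s\<bar>"]]) (simp, linarith)
  have "(g has_vector_derivative mul (g s) (A s)) (at s)" for s
  proof -
    define T where "T = \<bar>s\<bar> + 1"
    obtain M where M: "M > 0" "\<And>s. \<bar>s\<bar> \<le> T \<Longrightarrow> norm (A s) \<le> M" using boundA by blast
    have "\<exists>g'. \<forall>x\<in>{-T..T}. (\<lambda>n. P (Suc n) x) \<longlonglongrightarrow> g' x \<and>
      (g' has_derivative (\<lambda>h. h *\<^sub>R mul (g x) (A x))) (at x within {-T..T})"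
    proof (rule has_derivative_sequence [where f' = "\<lambda>n x h. h *\<^sub>R mul (P n x) (A x)"])
      show "(P (Suc n) has_derivative (\<lambda>h. h *\<^sub>R mul (P n x) (A x))) (at x within {- T..T})" for n x
        using dP by (auto simp: has_vector_derivative_def intro: has_derivative_at_withinI)
      show "(\<lambda>n. P (Suc n) 0) \<longlonglongrightarrow> g 0" using lim by (rule LIMSEQ_Suc)
      fix \<epsilon> :: real assume "\<epsilon> > 0"
      then have "\<forall>\<^sub>F n in sequentially. \<forall>x\<in>{-T..T}. dist (P n x) (g x) < \<epsilon> / (M * K)"
        using unif [of T] M(1) K(1) by (auto simp: uniform_limit_iff)
      then show "\<forall>\<^sub>F n in sequentially. \<forall>x\<in>{-T..T}. \<forall>h.
          norm (h *\<^sub>R mul (P n x) (A x) - h *\<^sub>R mul (g x) (A x)) \<le> \<epsilon> * norm h"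
      proof (rule eventually_mono, intro ballI allI)
        fix n x and h :: real
        assume *: "\<forall>x\<in>{-T..T}. dist (P n x) (g x) < \<epsilon> / (M * K)" and x: "x \<in> {-T..T}"
        have "norm (h *\<^sub>R mul (P n x) (A x) - h *\<^sub>R mul (g x) (A x)) = \<bar>h\<bar> * norm (mul (P n x - g x) (A x))"
          by (simp add: diff_left scaleR_diff_right [symmetric])
        also have "norm (mul (P n x - g x) (A x)) \<le> norm (P n x - g x) * norm (A x) * K" by (rule K)
        also have "\<dots> \<le> \<epsilon> / (M * K) * M * K"
          using * x M K(1) \<open>\<epsilon> > 0\<close>
          by (intro mult_right_mono mult_mono) (auto simp: dist_norm less_imp_le abs_le_iff)
        also have "\<dots> = \<epsilon>" using M(1) K(1) by simp
        finally show "norm (h *\<^sub>R mul (P n x) (A x) - h *\<^sub>R mul (g x) (A x)) \<le> \<epsilon> * norm h"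
          by (simp add: mult.commute mult_right_mono)
      qed
    qed (auto simp: T_def)
    then obtain g' where g': "\<And>x. x \<in> {-T..T} \<Longrightarrow> (\<lambda>n. P (Suc n) x) \<longlonglongrightarrow> g' x"
      "\<And>x. x \<in> {-T..T} \<Longrightarrow> (g' has_derivative (\<lambda>h. h *\<^sub>R mul (g x) (A x))) (at x within {-T..T})"
      by blast
    have eq: "g' x = g x" if "x \<in> {-T..T}" for x
      using LIMSEQ_unique [OF g'(1) [OF that] LIMSEQ_Suc [OF lim]] .
    have sT: "s \<in> {-T<..<T}" by (auto simp: T_def)
    have "(g' has_derivative (\<lambda>h. h *\<^sub>R mul (g s) (A s))) (at s within {-T<..<T})"
      using g'(2) [of s] sT by (auto intro: has_derivative_subset)
    then have "(g has_derivative (\<lambda>h. h *\<^sub>R mul (g s) (A s))) (at s within {-T<..<T})"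
      by (rule has_derivative_transform [OF sT, rotated]) (simp add: eq)
    then have "(g has_derivative (\<lambda>h. h *\<^sub>R mul (g s) (A s))) (at s)"
      using sT at_within_open [OF sT] by simp
    then show ?thesis by (simp add: has_vector_derivative_def)
  qed
  moreover have "g 0 = v0"
  proof -
    have "P (Suc n) 0 = v0" for n
      unfolding P_def sum.lessThan_Suc_shift by (simp add: F0 FSuc0)
    then show ?thesis using LIMSEQ_unique [OF LIMSEQ_Suc [OF lim [of 0]]] by simp
  qed
  ultimately show ?thesis by blast
qed

lemma has_vector_derivative_matmul:
  fixes f g :: "real \<Rightarrow> cmat"
  assumes "(f has_vector_derivative f') (at s)" "(g has_vector_derivative g') (at s)"
  shows "((\<lambda>s. f s ** g s) has_vector_derivative f s ** g' + f' ** g s) (at s)"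
  using assms by (rule matmul.has_vector_derivative)

text \<open>For skew-adjoint \<open>A\<close> the product \<open>g g\<^sup>*\<close> is constant, and the logarithmic derivative of the
  determinant is the trace of \<open>A\<close>.\<close>

lemma SU2_invariant:
  assumes d: "\<And>s. (g has_vector_derivative g s ** A s) (at s)"
    and A: "\<And>s. A s \<in> su2" and "g 0 \<in> SU2"
  shows "g s \<in> SU2"
proof -
  have skew: "adj (A s) = - A s" and tr: "A s $ 1 $ 1 + A s $ 2 $ 2 = 0" for s
    using A by (auto simp: su2_def)
  have "((\<lambda>s. g s ** adj (g s)) has_vector_derivative 0) (at s)" for s
  proof -
    have "((\<lambda>s. g s ** adj (g s)) has_vector_derivative
        g s ** adj (g s ** A s) + (g s ** A s) ** adj (g s)) (at s)"
      by (intro has_vector_derivative_matmul d bounded_linear.has_vector_derivative [OF bounded_linear_adj])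
    moreover have "g s ** adj (g s ** A s) + (g s ** A s) ** adj (g s) = 0"
      by (simp add: adj_matmul skew matmul.minus_left matmul.minus_right matrix_mul_assoc)
    ultimately show ?thesis by simp
  qed
  from constant_of_zero_vector_derivative [OF this] have 1: "g s ** adj (g s) = mat 1"
    using assms(3) by (simp add: SU2_iff)
  have "((\<lambda>s. det (g s)) has_vector_derivative 0) (at s)" for s
  proof -
    have e: "((\<lambda>s. g s $ i $ j) has_vector_derivative (g s ** A s) $ i $ j) (at s)" for i j
      by (rule bounded_linear.has_vector_derivative [OF bounded_linear_entry d])
    have "((\<lambda>s. det (g s)) has_vector_derivative
      (g s$1$1 * (g s ** A s)$2$2 + (g s ** A s)$1$1 * g s$2$2) -
      (g s$1$2 * (g s ** A s)$2$1 + (g s ** A s)$1$2 * g s$2$1)) (at s)"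
      unfolding det_2 by (intro has_vector_derivative_diff has_vector_derivative_mult e)
    moreover have "(g s$1$1 * (g s ** A s)$2$2 + (g s ** A s)$1$1 * g s$2$2) -
      (g s$1$2 * (g s ** A s)$2$1 + (g s ** A s)$1$2 * g s$2$1) =
      (A s $ 1 $ 1 + A s $ 2 $ 2) * det (g s)"
      by (simp add: matmul_nth det_2 algebra_simps)
    ultimately show ?thesis by (simp add: tr)
  qed
  from constant_of_zero_vector_derivative [OF this] have "det (g s) = 1"
    using assms(3) by (simp add: SU2_iff)
  with 1 show ?thesis by (simp add: SU2_iff)
qed


section \<open>Integrating a flat connection\<close>

text \<open>The heart of the integration of a flat connection. The matrix \<open>g\<close> is the transport along the first
  variable and depends on the parameter \<open>h\<close>. Compare \<open>g \<sigma> h\<close> with the first order guess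
  \<open>g \<sigma> 0 (1 + h B \<sigma>)\<close> by the discrepancy \<open>D = (g \<sigma> h - g \<sigma> 0 (1 + h B \<sigma>)) (g \<sigma> h)\<^sup>*\<close>. In its \<open>\<sigma>\<close>-derivative the
  terms of order \<open>h\<close> cancel exactly because of flatness, so that \<open>D = o(h)\<close> at \<open>\<sigma> = 0\<close> propagates to
  \<open>\<sigma> = s\<close>. Differentiability of the solution of an equation in its parameters is thus obtained without
  a theorem on parameter dependence, and unitarity replaces Gronwall estimates.\<close>

lemma flat_propagation:
  fixes g A A' :: "real \<Rightarrow> real \<Rightarrow> cmat" and B B' :: "real \<Rightarrow> cmat"
  assumes dg: "\<And>\<sigma> h. ((\<lambda>\<sigma>. g \<sigma> h) has_vector_derivative g \<sigma> h ** A \<sigma> h) (at \<sigma>)"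
    and unit: "\<And>\<sigma> h. g \<sigma> h \<in> SU2"
    and skew: "\<And>\<sigma> h. adj (A \<sigma> h) = - A \<sigma> h"
    and dA: "\<And>\<sigma> h. ((\<lambda>h. A \<sigma> h) has_vector_derivative A' \<sigma> h) (at h)"
    and cA': "continuous_on UNIV (\<lambda>p. A' (fst p) (snd p))"
    and dB: "\<And>\<sigma>. (B has_vector_derivative B' \<sigma>) (at \<sigma>)"
    and flat: "\<And>\<sigma>. A' \<sigma> 0 + B \<sigma> ** A \<sigma> 0 = B' \<sigma> + A \<sigma> 0 ** B \<sigma>"
    and init: "((\<lambda>h. g 0 h) has_vector_derivative g 0 0 ** B 0) (at 0)"
  shows "((\<lambda>h. g s h) has_vector_derivative g s 0 ** B s) (at 0)"
proof -
  obtain K where K: "K > 0" "\<And>(X::cmat) (Y::cmat). norm (X ** Y) \<le> norm X * norm Y * K"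
    using matmul.pos_bounded by blast
  have ng: "norm (g \<sigma> h) \<le> 4" "norm (adj (g \<sigma> h)) \<le> 4" for \<sigma> h
    using SU2_unitary [OF unit, of \<sigma> h] unitary_norm_le [of "g \<sigma> h"] unitary_norm_le [of "adj (g \<sigma> h)"]
    by (simp_all only: adj_adj)
  define S where "S = closed_segment 0 s"
  have cB: "continuous_on S B"
    using dB by (meson continuous_at_imp_continuous_on has_vector_derivative_continuous)
  have cA0: "continuous_on S (\<lambda>\<sigma>. A' \<sigma> 0)"
    using continuous_on_compose2 [OF cA' _ subset_UNIV, of S "\<lambda>\<sigma>. (\<sigma>, 0)"]
    by (simp add: continuous_on_Pair)
  have "compact S" by (simp add: S_def)
  obtain M1 where M1: "M1 > 0" "\<forall>x\<in>B ` S. norm x \<le> M1"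
    using compact_imp_bounded [OF compact_continuous_image [OF cB \<open>compact S\<close>]] bounded_pos by metis
  obtain M2 where M2: "M2 > 0" "\<forall>x\<in>(\<lambda>\<sigma>. A' \<sigma> 0) ` S. norm x \<le> M2"
    using compact_imp_bounded [OF compact_continuous_image [OF cA0 \<open>compact S\<close>]] bounded_pos by metis
  define M where "M = M1 + M2"
  have M: "M > 0" "\<And>\<sigma>. \<sigma> \<in> S \<Longrightarrow> norm (B \<sigma>) \<le> M" "\<And>\<sigma>. \<sigma> \<in> S \<Longrightarrow> norm (A' \<sigma> 0) \<le> M"
    using M1 M2 by (auto simp: M_def intro: order_trans [of _ M1] order_trans [of _ M2])
  define D where "D h \<sigma> = (g \<sigma> h - g \<sigma> 0 ** (mat 1 + h *\<^sub>R B \<sigma>)) ** adj (g \<sigma> h)" for h \<sigma>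
  define E where "E h \<sigma> = g \<sigma> 0 ** (A \<sigma> h - A \<sigma> 0 - h *\<^sub>R A' \<sigma> 0)
    + h *\<^sub>R (g \<sigma> 0 ** B \<sigma> ** (A \<sigma> h - A \<sigma> 0))" for h \<sigma>
  have dD: "(D h has_vector_derivative E h \<sigma> ** adj (g \<sigma> h)) (at \<sigma>)" for h \<sigma>
  proof -
    let ?X = "g \<sigma> h - g \<sigma> 0 ** (mat 1 + h *\<^sub>R B \<sigma>)"
    let ?X' = "g \<sigma> h ** A \<sigma> h - (g \<sigma> 0 ** (0 + h *\<^sub>R B' \<sigma>) + (g \<sigma> 0 ** A \<sigma> 0) ** (mat 1 + h *\<^sub>R B \<sigma>))"
    have "(D h has_vector_derivative ?X ** adj (g \<sigma> h ** A \<sigma> h) + ?X' ** adj (g \<sigma> h)) (at \<sigma>)"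
      unfolding D_def
      by (intro has_vector_derivative_matmul has_vector_derivative_diff has_vector_derivative_add has_vector_derivative_const
          bounded_linear.has_vector_derivative [OF bounded_linear_scaleR_right] dg dB
          bounded_linear.has_vector_derivative [OF bounded_linear_adj])
    moreover have "?X' - ?X ** A \<sigma> h = E h \<sigma>"
    proof -
      have "g \<sigma> 0 ** (A' \<sigma> 0 + B \<sigma> ** A \<sigma> 0) = g \<sigma> 0 ** (B' \<sigma> + A \<sigma> 0 ** B \<sigma>)"
        by (simp only: flat)
      then have "g \<sigma> 0 ** B' \<sigma> = g \<sigma> 0 ** A' \<sigma> 0 + g \<sigma> 0 ** B \<sigma> ** A \<sigma> 0 - g \<sigma> 0 ** A \<sigma> 0 ** B \<sigma>"
        by (simp add: matmul.add_right matrix_mul_assoc algebra_simps)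
      then show ?thesis
        unfolding E_def
        by (simp add: matmul.add_left matmul.add_right matmul.diff_left matmul.diff_right
            matmul.scaleR_left matmul.scaleR_right matrix_mul_assoc scaleR_add_right scaleR_diff_right)
    qed
    then have "?X ** adj (g \<sigma> h ** A \<sigma> h) + ?X' ** adj (g \<sigma> h) = E h \<sigma> ** adj (g \<sigma> h)"
      by (simp only: adj_matmul skew matmul.minus_left matmul.minus_right matrix_mul_assoc
          matmul.diff_left [symmetric] add.commute [of "- _"] diff_conv_add_uminus [symmetric])
    ultimately show ?thesis by simp
  qed
  (* Constants in the bound (C1 * eta + C2 * |h|) * |h| for the derivative of the discrepancy,
     where eta bounds the oscillation of A' on the segment; a factor 4 bounds each unitary matrix. *)
  define C1 C2 where "C1 = 16 * K\<^sup>2" and "C2 = 16 * M * K ^ 3 * (M + 1)"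
  have C: "C1 > 0" "C2 > 0" using K(1) M(1) by (simp_all add: C1_def C2_def)
  have est: "\<exists>\<delta>>0. \<forall>h. \<bar>h\<bar> < \<delta> \<longrightarrow> (\<forall>\<sigma>\<in>S. norm (E h \<sigma> ** adj (g \<sigma> h)) \<le> \<epsilon> * \<bar>h\<bar>)"
    if "\<epsilon> > 0" for \<epsilon>
  proof -
    define \<eta> where "\<eta> = min 1 (\<epsilon> / (2 * C1))"
    have \<eta>: "\<eta> > 0" "\<eta> \<le> 1" "C1 * \<eta> \<le> \<epsilon> / 2"
      using C that by (auto simp: \<eta>_def min_def field_simps)
    have "uniformly_continuous_on (S \<times> cball 0 1) (\<lambda>p. A' (fst p) (snd p))"
      using \<open>compact S\<close> continuous_on_subset [OF cA']
      by (intro compact_uniformly_continuous compact_Times) auto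
    then obtain d where d: "d > 0" "\<And>p p'. p \<in> S \<times> cball 0 1 \<Longrightarrow> p' \<in> S \<times> cball 0 1 \<Longrightarrow>
        dist p' p < d \<Longrightarrow> dist (A' (fst p') (snd p')) (A' (fst p) (snd p)) < \<eta>"
      unfolding uniformly_continuous_on_def using \<eta>(1) by metis
    define \<delta> where "\<delta> = min (min d 1) (\<epsilon> / (2 * C2))"
    have "norm (E h \<sigma> ** adj (g \<sigma> h)) \<le> \<epsilon> * \<bar>h\<bar>" if h: "\<bar>h\<bar> < \<delta>" and \<sigma>: "\<sigma> \<in> S" for h \<sigma>
    proof -
      have hd: "\<bar>h\<bar> < d" "\<bar>h\<bar> < 1" "C2 * \<bar>h\<bar> \<le> \<epsilon> / 2"
        using h C by (auto simp: \<delta>_def field_simps)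
      have "norm (A' \<sigma> k - A' \<sigma> 0) \<le> \<eta>" if "k \<in> closed_segment 0 h" for k
      proof -
        have "\<bar>k\<bar> \<le> \<bar>h\<bar>" using that by (auto simp: closed_segment_eq_real_ivl split: if_splits)
        then have "dist (A' (fst (\<sigma>, k)) (snd (\<sigma>, k))) (A' (fst (\<sigma>, 0::real)) (snd (\<sigma>, 0::real))) < \<eta>"
          using \<sigma> hd by (intro d(2)) (auto simp: dist_Pair_Pair)
        then show ?thesis by (simp add: dist_norm)
      qed
      then have "norm (A \<sigma> h - A \<sigma> 0 - (h - 0) *\<^sub>R A' \<sigma> 0) \<le> norm (h - 0) * \<eta>"
        by (intro vector_differentiable_bound_linearization [where S = "closed_segment 0 h"])
          (auto intro: has_vector_derivative_at_within dA)
      then have 1: "norm (A \<sigma> h - A \<sigma> 0 - h *\<^sub>R A' \<sigma> 0) \<le> \<eta> * \<bar>h\<bar>" by (simp add: mult.commute)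
      have "norm (A \<sigma> h - A \<sigma> 0) \<le> norm (A \<sigma> h - A \<sigma> 0 - h *\<^sub>R A' \<sigma> 0) + norm (h *\<^sub>R A' \<sigma> 0)"
        by (metis diff_add_cancel norm_triangle_ineq)
      also have "\<dots> \<le> 1 * \<bar>h\<bar> + \<bar>h\<bar> * M"
        using M(3) [OF \<sigma>] by (intro add_mono order_trans [OF 1] mult_right_mono \<eta>) (auto simp: mult_left_mono)
      finally have 2: "norm (A \<sigma> h - A \<sigma> 0) \<le> (M + 1) * \<bar>h\<bar>" by (simp add: algebra_simps)
      have "norm (g \<sigma> 0 ** (A \<sigma> h - A \<sigma> 0 - h *\<^sub>R A' \<sigma> 0)) \<le> 4 * (\<eta> * \<bar>h\<bar>) * K"
        using K(1) \<eta>(1) by (intro order_trans [OF K(2)] mult_right_mono mult_mono 1 ng) auto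
      moreover have "norm (g \<sigma> 0 ** B \<sigma> ** (A \<sigma> h - A \<sigma> 0)) \<le> (4 * M * K) * ((M + 1) * \<bar>h\<bar>) * K"
      proof -
        have "norm (g \<sigma> 0 ** B \<sigma>) \<le> 4 * M * K"
          using K(1) M \<sigma> by (intro order_trans [OF K(2)] mult_right_mono mult_mono ng) auto
        then show ?thesis
          using K(1) M(1) by (intro order_trans [OF K(2) mult_right_mono [OF mult_mono [OF _ 2]]]) auto
      qed
      then have "norm (h *\<^sub>R (g \<sigma> 0 ** B \<sigma> ** (A \<sigma> h - A \<sigma> 0))) \<le> \<bar>h\<bar> * ((4 * M * K) * ((M + 1) * \<bar>h\<bar>) * K)"
        by (simp add: mult_left_mono)
      ultimately have "norm (E h \<sigma>) \<le> 4 * (\<eta> * \<bar>h\<bar>) * K + \<bar>h\<bar> * ((4 * M * K) * ((M + 1) * \<bar>h\<bar>) * K)"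
        unfolding E_def by (intro order_trans [OF norm_triangle_ineq] add_mono)
      then have "norm (E h \<sigma> ** adj (g \<sigma> h)) \<le>
          (4 * (\<eta> * \<bar>h\<bar>) * K + \<bar>h\<bar> * ((4 * M * K) * ((M + 1) * \<bar>h\<bar>) * K)) * 4 * K"
        using K(1) M(1) \<eta>(1) by (intro order_trans [OF K(2)] mult_right_mono mult_mono ng) auto
      also have "\<dots> = (C1 * \<eta> + C2 * \<bar>h\<bar>) * \<bar>h\<bar>"
        by (simp add: C1_def C2_def power2_eq_square power3_eq_cube algebra_simps)
      also have "\<dots> \<le> \<epsilon> * \<bar>h\<bar>"
        using \<eta>(3) hd(3) by (intro mult_right_mono) auto
      finally show ?thesis .
    qed
    moreover have "\<delta> > 0" using d C that by (simp add: \<delta>_def)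
    ultimately show ?thesis by blast
  qed
  have "\<exists>\<delta>>0. \<forall>h. \<bar>h\<bar> < \<delta> \<longrightarrow> norm (g s h - g s 0 - h *\<^sub>R (g s 0 ** B s)) \<le> \<epsilon> * \<bar>h\<bar>"
    if \<epsilon>: "\<epsilon> > 0" for \<epsilon>
  proof -
    (* Shares of epsilon: 1 for the growth of D along the segment, 2 for its initial value. *)
    define \<epsilon>1 \<epsilon>2 where "\<epsilon>1 = \<epsilon> / (8 * K * (\<bar>s\<bar> + 1))" and "\<epsilon>2 = \<epsilon> / (32 * K\<^sup>2)"
    have \<epsilon>12: "\<epsilon>1 > 0" "\<epsilon>2 > 0"
      using \<epsilon> K(1) by (simp_all add: \<epsilon>1_def \<epsilon>2_def add_nonneg_pos)
    obtain \<delta>1 where \<delta>1: "\<delta>1 > 0" "\<And>h \<sigma>. \<bar>h\<bar> < \<delta>1 \<Longrightarrow> \<sigma> \<in> S \<Longrightarrow> norm (E h \<sigma> ** adj (g \<sigma> h)) \<le> \<epsilon>1 * \<bar>h\<bar>"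
      using est [OF \<epsilon>12(1)] by blast
    obtain \<delta>2 where \<delta>2: "\<delta>2 > 0" "\<And>h. \<bar>h\<bar> < \<delta>2 \<Longrightarrow> norm (g 0 h - g 0 0 - h *\<^sub>R (g 0 0 ** B 0)) \<le> \<epsilon>2 * \<bar>h\<bar>"
      using init \<epsilon>12(2) unfolding has_vector_derivative_def has_derivative_at_alt
      by (metis diff_zero real_norm_def)
    have "norm (g s h - g s 0 - h *\<^sub>R (g s 0 ** B s)) \<le> \<epsilon> * \<bar>h\<bar>" if h: "\<bar>h\<bar> < min \<delta>1 \<delta>2" for h
    proof -
      have "norm (D h s - D h 0) \<le> \<epsilon>1 * \<bar>h\<bar> * \<bar>s - 0\<bar>"
        by (rule deriv_bound_segment [OF dD]) (use h \<delta>1(2) in \<open>simp add: S_def\<close>)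
      moreover have "norm (D h 0) \<le> \<epsilon>2 * \<bar>h\<bar> * 4 * K"
      proof -
        have "D h 0 = (g 0 h - g 0 0 - h *\<^sub>R (g 0 0 ** B 0)) ** adj (g 0 h)"
          by (simp add: D_def matmul.add_right matmul.scaleR_right diff_diff_eq)
        then show ?thesis
          using \<delta>2(2) [of h] h K(1) \<epsilon>12 by (auto intro!: order_trans [OF K(2)] mult_right_mono mult_mono ng)
      qed
      ultimately have 1: "norm (D h s) \<le> \<epsilon>1 * \<bar>h\<bar> * \<bar>s\<bar> + \<epsilon>2 * \<bar>h\<bar> * 4 * K"
        using norm_triangle_ineq [of "D h s - D h 0" "D h 0"] by simp
      have 2: "g s h - g s 0 - h *\<^sub>R (g s 0 ** B s) = D h s ** g s h"
        using SU2_unitary(2) [OF unit, of s h]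
        by (simp add: D_def matrix_mul_assoc [symmetric] matmul.add_right matmul.scaleR_right diff_diff_eq)
      have "norm (g s h - g s 0 - h *\<^sub>R (g s 0 ** B s)) \<le>
          (\<epsilon>1 * \<bar>h\<bar> * \<bar>s\<bar> + \<epsilon>2 * \<bar>h\<bar> * 4 * K) * 4 * K"
        unfolding 2
        by (rule order_trans [OF K(2) mult_right_mono [OF mult_mono [OF 1 ng(1)]]])
          (use K(1) \<epsilon>12 in simp_all)
      also have "\<dots> = (\<epsilon> / 2 * (\<bar>s\<bar> / (\<bar>s\<bar> + 1)) + \<epsilon> / 2) * \<bar>h\<bar>"
      proof -
        have "\<bar>s\<bar> + 1 \<noteq> 0" by linarith
        then show ?thesis
          using K(1) by (simp add: \<epsilon>1_def \<epsilon>2_def power2_eq_square divide_simps) (simp add: algebra_simps)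
      qed
      also have "\<dots> \<le> (\<epsilon> / 2 * 1 + \<epsilon> / 2) * \<bar>h\<bar>"
        using \<epsilon> by (intro mult_right_mono add_mono mult_left_mono) (auto simp: divide_le_eq)
      finally show ?thesis by simp
    qed
    then show ?thesis using \<delta>1(1) \<delta>2(1) by (metis min_less_iff_conj)
  qed
  then show ?thesis
    unfolding has_vector_derivative_def has_derivative_at_alt
    by (auto simp: bounded_linear_scaleR_left)
qed

lemma parallel_transport:
  assumes e: "e \<bullet> e = 1" and cA: "continuous_on UNIV A" and su: "\<And>w. A w \<in> su2"
    and G0: "\<And>w. G0 w \<in> SU2"
  obtains G where "\<And>w. G w \<in> SU2" "\<And>w. w \<bullet> e = 0 \<Longrightarrow> G w = G0 w" "deriv_along e G (\<lambda>w. G w ** A w)"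
proof -
  have "\<exists>\<gamma>. \<gamma> 0 = G0 w \<and> (\<forall>s. (\<gamma> has_vector_derivative \<gamma> s ** A (w + s *\<^sub>R e)) (at s))" for w
    by (rule linear_ode_solution_exists [OF bounded_bilinear_matmul])
      (intro continuous_on_compose2 [OF cA _ subset_UNIV] continuous_intros)
  then obtain \<gamma> where \<gamma>: "\<And>w. \<gamma> w 0 = G0 w"
      "\<And>w s. (\<gamma> w has_vector_derivative \<gamma> w s ** A (w + s *\<^sub>R e)) (at s)"
    by metis
  (* The foot of w on the hyperplane; the solutions starting there are glued to one function. *)
  define base where "base w = w - (w \<bullet> e) *\<^sub>R e" for w
  define G where "G w = \<gamma> (base w) (w \<bullet> e)" for w
  have 1: "G w \<in> SU2" for w
    unfolding G_def by (rule SU2_invariant [OF \<gamma>(2) su]) (simp add: \<gamma>(1) G0)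
  have 2: "G w = G0 w" if "w \<bullet> e = 0" for w
    using that by (simp add: G_def base_def \<gamma>(1))
  have 3: "deriv_along e G (\<lambda>w. G w ** A w)"
    unfolding deriv_along_def
  proof
    fix w
    have b: "base w + (w \<bullet> e) *\<^sub>R e = w" "base (w + s *\<^sub>R e) = base w" "(w + s *\<^sub>R e) \<bullet> e = w \<bullet> e + s" for s
      using e by (simp_all add: base_def inner_add_left algebra_simps)
    have "(\<gamma> (base w) has_vector_derivative G w ** A w) (at (w \<bullet> e + 0))"
      using \<gamma>(2) [of "base w" "w \<bullet> e"] by (simp add: G_def b)
    then have "((\<lambda>s. \<gamma> (base w) (w \<bullet> e + s)) has_vector_derivative G w ** A w) (at 0)"
      by (simp only: has_vector_derivative_shift)
    then show "((\<lambda>s. G (w + s *\<^sub>R e)) has_vector_derivative G w ** A w) (at 0)"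
      by (simp add: G_def b)
  qed
  show ?thesis by (rule that [OF 1 2 3])
qed

text \<open>Equality of the mixed derivatives of a matrix \<open>G\<close> with \<open>G\<^sub>e = G A\<^sub>e\<close>, after cancelling \<open>G\<close>.\<close>

definition flat_at :: "(spacetime \<Rightarrow> spacetime \<Rightarrow> cmat) \<Rightarrow> spacetime \<Rightarrow> spacetime \<Rightarrow> spacetime \<Rightarrow> bool" where
  "flat_at A e e' w \<longleftrightarrow> (\<forall>A' B'. deriv_along e' (A e) A' \<longrightarrow> deriv_along e (A e') B' \<longrightarrow>
     A' w + A e' w ** A e w = B' w + A e w ** A e' w)"

lemma flat_at_iff:
  assumes "deriv_along e' (A e) A'" "deriv_along e (A e') B'"
  shows "flat_at A e e' w \<longleftrightarrow> A' w + A e' w ** A e w = B' w + A e w ** A e' w"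
proof -
  have "A'' = A'" if "deriv_along e' (A e) A''" for A''
    by (rule deriv_along_unique [OF that assms(1)])
  moreover have "B'' = B'" if "deriv_along e (A e') B''" for B''
    by (rule deriv_along_unique [OF that assms(2)])
  ultimately show ?thesis unfolding flat_at_def using assms by blast
qed

lemma propagate_along:
  assumes axes: "e \<in> axes" "e' \<in> axes"
    and C1: "\<And>e. e \<in> axes \<Longrightarrow> Ck 1 (A e)" and su: "\<And>e w. e \<in> axes \<Longrightarrow> A e w \<in> su2"
    and G: "\<And>w. G w \<in> SU2" and dG: "deriv_along e G (\<lambda>w. G w ** A e w)"
    and flat: "\<And>s. flat_at A e e' (w + s *\<^sub>R e)"
    and init: "((\<lambda>h. G (w + h *\<^sub>R e')) has_vector_derivative G w ** A e' w) (at 0)"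
  shows "((\<lambda>h. G (w + s *\<^sub>R e + h *\<^sub>R e')) has_vector_derivative
    G (w + s *\<^sub>R e) ** A e' (w + s *\<^sub>R e)) (at 0)"
proof -
  obtain A' where A': "deriv_along e' (A e) A'" "Ck (1 - 1) A'"
    by (rule Ck_deriv_along [OF C1 [OF axes(1)] _ axes(2)]) auto
  obtain B' where B': "deriv_along e (A e') B'"
    by (rule Ck_deriv_along [OF C1 [OF axes(2)] _ axes(1)]) auto
  have cA': "continuous_on UNIV A'" using A'(2) by simp
  let ?p = "\<lambda>\<sigma> h. w + \<sigma> *\<^sub>R e + h *\<^sub>R e'"
  have "((\<lambda>h. G (?p s h)) has_vector_derivative G (?p s 0) ** A e' (w + s *\<^sub>R e)) (at 0)"
  proof (rule flat_propagation [where g = "\<lambda>\<sigma> h. G (?p \<sigma> h)" and A = "\<lambda>\<sigma> h. A e (?p \<sigma> h)"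
        and A' = "\<lambda>\<sigma> h. A' (?p \<sigma> h)" and B = "\<lambda>\<sigma>. A e' (w + \<sigma> *\<^sub>R e)" and B' = "\<lambda>\<sigma>. B' (w + \<sigma> *\<^sub>R e)"])
    fix \<sigma> h
    show "((\<lambda>\<sigma>. G (?p \<sigma> h)) has_vector_derivative G (?p \<sigma> h) ** A e (?p \<sigma> h)) (at \<sigma>)"
      using deriv_along_line [OF dG, of "w + h *\<^sub>R e'"] by (simp add: add_ac)
    show "adj (A e (?p \<sigma> h)) = - A e (?p \<sigma> h)" using su [OF axes(1)] by (simp add: su2_def)
    show "((\<lambda>h. A e (?p \<sigma> h)) has_vector_derivative A' (?p \<sigma> h)) (at h)"
      by (rule deriv_along_line [OF A'(1)])
    show "((\<lambda>\<sigma>. A e' (w + \<sigma> *\<^sub>R e)) has_vector_derivative B' (w + \<sigma> *\<^sub>R e)) (at \<sigma>)"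
      by (rule deriv_along_line [OF B'])
    show "A' (?p \<sigma> 0) + A e' (w + \<sigma> *\<^sub>R e) ** A e (?p \<sigma> 0) =
        B' (w + \<sigma> *\<^sub>R e) + A e (?p \<sigma> 0) ** A e' (w + \<sigma> *\<^sub>R e)"
      using flat [of \<sigma>] A'(1) B' unfolding flat_at_def by simp
    show "continuous_on UNIV (\<lambda>p. A' (?p (fst p) (snd p)))"
      by (intro continuous_on_compose2 [OF cA' _ subset_UNIV] continuous_intros)
  qed (use G init in auto)
  then show ?thesis by simp
qed

text \<open>Transport the initial value along \<open>y\<close>, then along \<open>x\<close>, then along \<open>t\<close>. The last transport leaves the
  \<open>x\<close>- and \<open>y\<close>-equations intact if the connection is flat in the \<open>(t, x)\<close>- and \<open>(t, y)\<close>-planes;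
  the one before it acts only inside \<open>t = 0\<close>, hence flatness between \<open>x\<close> and \<open>y\<close> is needed only there.\<close>

theorem flat_connection_integrable:
  assumes C1: "\<And>e. e \<in> axes \<Longrightarrow> Ck 1 (A e)" and su: "\<And>e w. e \<in> axes \<Longrightarrow> A e w \<in> su2"
    and g0: "g0 \<in> SU2"
    and flat: "\<And>w. flat_at A e_t e_x w" "\<And>w. flat_at A e_t e_y w"
      "\<And>w. w \<bullet> e_t = 0 \<Longrightarrow> flat_at A e_x e_y w"
  shows "\<exists>G. G (0, 0, 0) = g0 \<and> (\<forall>w. G w \<in> SU2) \<and> (\<forall>e\<in>axes. deriv_along e G (\<lambda>w. G w ** A e w))"
proof -
  have cont: "continuous_on UNIV (A e)" if "e \<in> axes" for e
    using C1 [OF that] by (rule Ck_continuous)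
  obtain G1 where G1: "\<And>w. G1 w \<in> SU2" "\<And>w. w \<bullet> e_y = 0 \<Longrightarrow> G1 w = g0"
      "deriv_along e_y G1 (\<lambda>w. G1 w ** A e_y w)"
    by (rule parallel_transport [of e_y "A e_y" "\<lambda>w. g0"]) (auto simp: cont su g0 in_axes)
  obtain G2 where G2: "\<And>w. G2 w \<in> SU2" "\<And>w. w \<bullet> e_x = 0 \<Longrightarrow> G2 w = G1 w"
      "deriv_along e_x G2 (\<lambda>w. G2 w ** A e_x w)"
    by (rule parallel_transport [of e_x "A e_x" G1]) (auto simp: cont su G1(1) in_axes)
  obtain G where G: "\<And>w. G w \<in> SU2" "\<And>w. w \<bullet> e_t = 0 \<Longrightarrow> G w = G2 w"
      "deriv_along e_t G (\<lambda>w. G w ** A e_t w)"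
    by (rule parallel_transport [of e_t "A e_t" G2]) (auto simp: cont su G2(1) in_axes)
  have y2: "((\<lambda>h. G2 (w + h *\<^sub>R e_y)) has_vector_derivative G2 w ** A e_y w) (at 0)"
    if "w \<bullet> e_t = 0" for w
  proof -
    define v where "v = w - (w \<bullet> e_x) *\<^sub>R e_x"
    have v: "v \<bullet> e_x = 0" "\<And>h. (v + h *\<^sub>R e_y) \<bullet> e_x = 0" "\<And>s. (v + s *\<^sub>R e_x) \<bullet> e_t = 0"
      "v + (w \<bullet> e_x) *\<^sub>R e_x = w"
      using that by (auto simp: v_def inner_add_left inner_diff_left)
    have "((\<lambda>h. G2 (v + h *\<^sub>R e_y)) has_vector_derivative G2 v ** A e_y v) (at 0)"
      using deriv_alongD [OF G1(3), of v] G2(2) v by simp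
    then have "((\<lambda>h. G2 (v + (w \<bullet> e_x) *\<^sub>R e_x + h *\<^sub>R e_y)) has_vector_derivative
      G2 (v + (w \<bullet> e_x) *\<^sub>R e_x) ** A e_y (v + (w \<bullet> e_x) *\<^sub>R e_x)) (at 0)"
      by (intro propagate_along [where A = A] in_axes C1 su G2 flat(3) v)
    then show ?thesis unfolding v(4) .
  qed
  have "deriv_along e G (\<lambda>w. G w ** A e w)" if e: "e = e_x \<or> e = e_y" for e
    unfolding deriv_along_def
  proof
    fix w
    define v where "v = w - (w \<bullet> e_t) *\<^sub>R e_t"
    have v: "v \<bullet> e_t = 0" "\<And>h. (v + h *\<^sub>R e) \<bullet> e_t = 0" "v + (w \<bullet> e_t) *\<^sub>R e_t = w"
      using e by (auto simp: v_def inner_add_left inner_diff_left)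
    have "((\<lambda>h. G2 (v + h *\<^sub>R e)) has_vector_derivative G2 v ** A e v) (at 0)"
      using e y2 [OF v(1)] deriv_alongD [OF G2(3), of v] by blast
    then have "((\<lambda>h. G (v + h *\<^sub>R e)) has_vector_derivative G v ** A e v) (at 0)"
      using G(2) v by simp
    moreover have "flat_at A e_t e w" for w using e flat by blast
    moreover have "e \<in> axes" using e in_axes by auto
    ultimately have "((\<lambda>h. G (v + (w \<bullet> e_t) *\<^sub>R e_t + h *\<^sub>R e)) has_vector_derivative
      G (v + (w \<bullet> e_t) *\<^sub>R e_t) ** A e (v + (w \<bullet> e_t) *\<^sub>R e_t)) (at 0)"
      by (intro propagate_along [where A = A] in_axes C1 su G)
    then show "((\<lambda>h. G (w + h *\<^sub>R e)) has_vector_derivative G w ** A e w) (at 0)"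
      unfolding v(3) .
  qed
  then have "\<forall>e\<in>axes. deriv_along e G (\<lambda>w. G w ** A e w)"
    using G(3) unfolding axes_def by blast
  moreover have "G (0, 0, 0) = g0"
    using G(2) [of "(0, 0, 0)"] G2(2) [of "(0, 0, 0)"] G1(2) [of "(0, 0, 0)"] by simp
  ultimately show ?thesis using G(1) by blast
qed


section \<open>Moving frames in SU(2)\<close>

definition frame :: "(spacetime \<Rightarrow> spacetime \<Rightarrow> cmat) \<Rightarrow> (spacetime \<Rightarrow> cmat) \<Rightarrow> bool" where
  "frame A G \<longleftrightarrow> (\<forall>w. G w \<in> SU2) \<and> (\<forall>e\<in>axes. deriv_along e G (\<lambda>w. G w ** A e w))"

lemma frame_SU2: "frame A G \<Longrightarrow> G w \<in> SU2"
  and frame_deriv: "frame A G \<Longrightarrow> e \<in> axes \<Longrightarrow> deriv_along e G (\<lambda>w. G w ** A e w)"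
  unfolding frame_def by blast+

text \<open>Differentiate \<open>G\<^sup>* G = 1\<close>.\<close>

lemma frame_skew:
  assumes "frame A G" "e \<in> axes"
  shows "adj (A e w) = - A e w"
proof -
  note d = frame_deriv [OF assms]
  have "deriv_along e (\<lambda>w. adj (G w) ** G w)
      (\<lambda>w. adj (G w) ** (G w ** A e w) + adj (G w ** A e w) ** G w)"
    by (intro deriv_along_matmul deriv_along_adj d)
  then have "deriv_along e (\<lambda>w. mat 1)
      (\<lambda>w. adj (G w) ** (G w ** A e w) + adj (G w ** A e w) ** G w)"
    by (simp only: SU2_unitary(2) [OF frame_SU2 [OF assms(1)]])
  from deriv_along_unique [OF this deriv_along_const]
  have "adj (G w) ** (G w ** A e w) + adj (G w ** A e w) ** G w = 0"
    by (rule fun_cong)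
  moreover have "adj (G w) ** (G w ** A e w) = A e w"
    by (simp add: matrix_mul_assoc SU2_unitary [OF frame_SU2 [OF assms(1)]])
  moreover have "adj (G w ** A e w) ** G w = adj (A e w)"
    by (simp add: adj_matmul matrix_mul_assoc [symmetric] SU2_unitary [OF frame_SU2 [OF assms(1)]])
  ultimately have "A e w + adj (A e w) = 0" by simp
  then show ?thesis by (metis add_eq_0_iff)
qed

text \<open>Bootstrapping in \<open>G\<^sub>e = G A\<^sub>e\<close>: the frame gains one derivative over the connection. The induction starts
  from continuity of \<open>G\<close>, which holds since \<open>G\<close> is bounded and \<open>A\<close> locally bounded.\<close>

lemma Ck_frame:
  assumes "frame A G" and A: "\<And>e. e \<in> axes \<Longrightarrow> Ck k (A e)"
  shows "Ck (Suc k) G"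
proof -
  note d = frame_deriv [OF assms(1)]
  obtain K where K: "K > 0" "\<And>(X::cmat) (Y::cmat). norm (X ** Y) \<le> norm X * norm Y * K"
    using matmul.pos_bounded by blast
  have "continuous_on UNIV G"
  proof (rule continuous_of_locally_bounded_partials [OF d])
    fix R :: real
    have *: "\<exists>M. \<forall>w\<in>cball 0 R. norm (A e w) \<le> M" if "e \<in> axes" for e
      using compact_imp_bounded [OF compact_continuous_image [OF continuous_on_subset
            [OF Ck_continuous [OF A [OF that]] subset_UNIV] compact_cball [of 0 R]]]
      by (auto simp: bounded_iff)
    obtain M where M: "\<And>e w. e \<in> axes \<Longrightarrow> w \<in> cball 0 R \<Longrightarrow> norm (A e w) \<le> M e"
      using * by metis
    define N where "N = 4 * max (M e_t) (max (M e_x) (M e_y)) * K"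
    have "norm (G w ** A e w) \<le> N" if "w \<in> cball 0 R" "e \<in> axes" for w e
    proof -
      have "norm (A e w) \<le> max (M e_t) (max (M e_x) (M e_y))"
        using M [OF that(2,1)] that(2) unfolding axes_def by auto
      moreover have "norm (G w) \<le> 4"
        using unitary_norm_le SU2_unitary(1) [OF frame_SU2 [OF assms(1)]] by blast
      ultimately show ?thesis
        unfolding N_def using K(1) by (intro order_trans [OF K(2)] mult_right_mono mult_mono) auto
    qed
    then show "\<exists>M. \<forall>w\<in>cball 0 R. \<forall>e\<in>axes. norm (G w ** A e w) \<le> M" by blast
  qed
  then have "Ck 0 G" by simp
  have "Ck j G" if "j \<le> Suc k" for j
    using that
  proof (induction j)
    case 0
    show ?case by (rule \<open>Ck 0 G\<close>)
  next
    case (Suc j)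
    then have j: "Ck j G" "j \<le> k" by auto
    show ?case
    proof (rule Ck_SucI)
      show "continuous_on UNIV G" using \<open>Ck 0 G\<close> by simp
      fix e assume "e \<in> axes"
      then show "deriv_along e G (\<lambda>w. G w ** A e w)" "Ck j (\<lambda>w. G w ** A e w)"
        using d by (auto intro: Ck_matmul j Ck_mono [OF A])
    qed
  qed
  then show ?thesis by blast
qed

lemma frame_flat:
  assumes "frame A G" and A: "\<And>e. e \<in> axes \<Longrightarrow> Ck 1 (A e)" and in_axes: "e \<in> axes" "e' \<in> axes"
  shows "flat_at A e e' w"
  unfolding flat_at_def
proof (intro allI impI)
  fix A' B' assume d: "deriv_along e' (A e) A'" "deriv_along e (A e') B'"
  note dG = frame_deriv [OF assms(1)]
  have "(\<lambda>w. G w ** A' w + G w ** A e' w ** A e w) = (\<lambda>w. G w ** B' w + G w ** A e w ** A e' w)"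
  proof (rule Ck2_mixed_derivatives_commute)
    show "Ck 2 G" using Ck_frame [OF assms(1) A] by (simp add: numeral_2_eq_2)
    show "deriv_along e' (\<lambda>w. G w ** A e w) (\<lambda>w. G w ** A' w + G w ** A e' w ** A e w)"
      by (intro deriv_along_matmul dG d in_axes)
    show "deriv_along e (\<lambda>w. G w ** A e' w) (\<lambda>w. G w ** B' w + G w ** A e w ** A e' w)"
      by (intro deriv_along_matmul dG d in_axes)
  qed (use dG in_axes in auto)
  then have "G w ** A' w + G w ** A e' w ** A e w = G w ** B' w + G w ** A e w ** A e' w"
    by (rule fun_cong)
  then have "G w ** (A' w + A e' w ** A e w) = G w ** (B' w + A e w ** A e' w)"
    by (simp add: matmul.add_right matrix_mul_assoc)
  then show "A' w + A e' w ** A e w = B' w + A e w ** A e' w"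
    by (simp add: SU2_cancel [OF frame_SU2 [OF assms(1)]])
qed

text \<open>For two frames \<open>G\<close> and \<open>H\<close> of the same connection, \<open>G H\<^sup>*\<close> is constant.\<close>

lemma frame_unique:
  assumes "frame A G" "frame A H" "G (0, 0, 0) = H (0, 0, 0)"
  shows "G = H"
proof
  fix w :: spacetime
  have "deriv_along e (\<lambda>w. G w ** adj (H w)) (\<lambda>w. 0)" if e: "e \<in> axes" for e
  proof -
    have "deriv_along e (\<lambda>w. G w ** adj (H w)) (\<lambda>w. G w ** adj (H w ** A e w) + G w ** A e w ** adj (H w))"
      using assms(1,2) e by (intro deriv_along_matmul deriv_along_adj frame_deriv)
    moreover have "(\<lambda>w. G w ** adj (H w ** A e w) + G w ** A e w ** adj (H w)) = (\<lambda>w. 0)"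
      by (simp add: adj_matmul frame_skew [OF assms(1) e] matmul.minus_left matmul.minus_right matrix_mul_assoc)
    ultimately show ?thesis by simp
  qed
  from constant_of_zero_derivatives [OF this]
  have "G w ** adj (H w) = mat 1"
    by (simp add: assms(3) SU2_unitary [OF frame_SU2 [OF assms(2)]])
  then have "G w ** adj (H w) ** H w = H w" by simp
  then show "G w = H w"
    by (simp add: matrix_mul_assoc [symmetric] SU2_unitary [OF frame_SU2 [OF assms(2)]])
qed

text \<open>Differentiation in the moving frame is the covariant derivative.\<close>

lemma deriv_along_conjugate:
  assumes "frame A G" "e \<in> axes" "deriv_along e M M'"
  shows "deriv_along e (\<lambda>w. G w ** M w ** adj (G w))
    (\<lambda>w. G w ** (M' w + commutator (A e w) (M w)) ** adj (G w))"
proof -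
  have "deriv_along e (\<lambda>w. G w ** M w ** adj (G w))
      (\<lambda>w. G w ** M w ** adj (G w ** A e w) + (G w ** M' w + G w ** A e w ** M w) ** adj (G w))"
    using assms by (intro deriv_along_matmul deriv_along_adj frame_deriv)
  moreover have "G w ** M w ** adj (G w ** A e w) + (G w ** M' w + G w ** A e w ** M w) ** adj (G w)
      = G w ** (M' w + commutator (A e w) (M w)) ** adj (G w)" for w
    by (simp add: commutator_def adj_matmul frame_skew [OF assms(1,2)] matmul.add_left matmul.add_right
        matmul.diff_left matmul.diff_right matmul.minus_left matmul.minus_right matrix_mul_assoc)
  ultimately show ?thesis by simp
qed

section \<open>The Lax connection of the Schroedinger system\<close>

text \<open>The real components of \<open>G\<^sub>z = - G U\<close>: solve \<open>A\<^sub>x - \<i> A\<^sub>y = - U\<close> and its adjoint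
  \<open>A\<^sub>x + \<i> A\<^sub>y = U\<^sup>*\<close> for \<open>A\<^sub>x\<close> and \<open>A\<^sub>y\<close>.\<close>

definition lax_x where
  "lax_x p q r w = cscale (1 / 2) (adj (U_matrix p q r w) - U_matrix p q r w)"

definition lax_y where
  "lax_y p q r w = cscale (- \<i> / 2) (adj (U_matrix p q r w) + U_matrix p q r w)"

text \<open>The matrix by which \<open>G\<close> is multiplied in the equation for \<open>G\<^sub>t\<close> of the gauge transformation.\<close>

definition lax_t where
  "lax_t p q r u w = mat22 (- \<i> * of_real (u w)) (\<i> * (D_zbar q w + 2 * (cnj (p w) * q w)))
     (- \<i> * (D_zbar r w - 2 * (cnj (p w) * r w))) (\<i> * of_real (u w))"

definition lax where
  "lax p q r u e = (if e = e_t then lax_t p q r u else if e = e_x then lax_x p q r else lax_y p q r)"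

lemma lax_simps:
  "lax p q r u e_t = lax_t p q r u" "lax p q r u e_x = lax_x p q r" "lax p q r u e_y = lax_y p q r"
  by (simp_all add: lax_def)

lemma D_z_eq:
  "deriv_along e_x f fx \<Longrightarrow> deriv_along e_y f fy \<Longrightarrow> D_z f = (\<lambda>w. fx w - \<i> * fy w)"
  "deriv_along e_x f fx \<Longrightarrow> deriv_along e_y f fy \<Longrightarrow> D_zbar f = (\<lambda>w. fx w + \<i> * fy w)"
  by (auto simp: D_z_def D_zbar_def deriv_along_partials)

lemma matD_z_eq:
  "deriv_along e_x f fx \<Longrightarrow> deriv_along e_y f fy \<Longrightarrow> matD_z f = (\<lambda>w. fx w - cscale \<i> (fy w))"
  "deriv_along e_x f fx \<Longrightarrow> deriv_along e_y f fy \<Longrightarrow> matD_zbar f = (\<lambda>w. fx w + cscale \<i> (fy w))"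
  by (auto simp: matD_z_def matD_zbar_def deriv_along_partials)

lemma Ck_D_z:
  assumes "Ck k f" "1 \<le> k"
  shows "Ck (k - 1) (D_z f)" "Ck (k - 1) (D_zbar f)"
  using Ck_partials [OF assms]
  by (auto simp: D_z_def [abs_def] D_zbar_def [abs_def] intro!: Ck_rules)

lemma deriv_along_U:
  assumes "deriv_along e p p'" "deriv_along e q q'" "deriv_along e r r'"
  shows "deriv_along e (U_matrix p q r) (U_matrix p' q' r')"
  unfolding U_matrix_def [abs_def] by (intro deriv_along_mat22 deriv_along_minus assms)

lemma deriv_along_lax:
  assumes "deriv_along e p p'" "deriv_along e q q'" "deriv_along e r r'"
  shows "deriv_along e (lax_x p q r) (lax_x p' q' r')" "deriv_along e (lax_y p q r) (lax_y p' q' r')"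
  unfolding lax_x_def [abs_def] lax_y_def [abs_def]
  by (intro deriv_along_cscale deriv_along_adj deriv_along_diff deriv_along_add deriv_along_U assms)+

lemma Ck_U: "Ck k p \<Longrightarrow> Ck k q \<Longrightarrow> Ck k r \<Longrightarrow> Ck k (U_matrix p q r)"
  unfolding U_matrix_def [abs_def] by (intro Ck_rules)

lemma Ck_lax_xy:
  assumes "Ck k p" "Ck k q" "Ck k r"
  shows "Ck k (lax_x p q r)" "Ck k (lax_y p q r)"
  unfolding lax_x_def [abs_def] lax_y_def [abs_def] by (intro Ck_rules Ck_U assms)+

lemma Ck_lax_t:
  assumes "Ck k p" "Ck k q" "Ck k r" "Ck k u" "Ck k (D_zbar q)" "Ck k (D_zbar r)"
  shows "Ck k (lax_t p q r u)"
  unfolding lax_t_def [abs_def] by (intro Ck_rules assms)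

lemma Ck_lax:
  assumes "Ck k p" "Ck k q" "Ck k r" "Ck k u" "1 \<le> k" "e \<in> axes"
  shows "Ck (k - 1) (lax p q r u e)"
proof -
  have "Ck (k - 1) p" "Ck (k - 1) q" "Ck (k - 1) r" "Ck (k - 1) u"
    using assms by (auto intro: Ck_mono)
  then show ?thesis
    using assms(6) Ck_lax_t Ck_lax_xy Ck_D_z(2) [OF assms(2,5)] Ck_D_z(2) [OF assms(3,5)]
    by (auto simp: axes_def lax_simps)
qed

lemma lax_xy_su2: "lax_x p q r w \<in> su2" "lax_y p q r w \<in> su2"
  by (simp_all add: su2_entries lax_x_def lax_y_def U_matrix_def entries complex_eq_iff)
    (simp_all add: field_simps)

lemma lax_z:
  "lax_x p q r w - cscale \<i> (lax_y p q r w) = - U_matrix p q r w"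
  "lax_x p q r w + cscale \<i> (lax_y p q r w) = adj (U_matrix p q r w)"
  by (simp_all add: lax_x_def lax_y_def cmat_eq_iff entries field_simps)

lemma matmul_cscale_right: "A ** cscale c B = cscale c (A ** B)"
  by (simp add: cmat_eq_iff entries algebra_simps)

lemma lax_t_su2_iff:
  assumes "Ck 1 q" "Ck 1 r"
  shows "lax_t p q r u w \<in> su2 \<longleftrightarrow>
    D_z (\<lambda>v. cnj (r v)) w + D_zbar q w = 2 * (p w * cnj (r w) - cnj (p w) * q w)"
proof -
  note dr = Ck_partials(2,3) [OF assms(2) order_refl]
  have "D_z (\<lambda>v. cnj (r v)) w = cnj (D_zbar r w)"
    using D_z_eq(1) [OF deriv_along_cnj deriv_along_cnj, OF dr] by (simp add: D_zbar_def)
  then show ?thesis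
    by (simp add: su2_entries lax_t_def entries complex_eq_iff algebra_simps) argo
qed

text \<open>The complex equation for \<open>G\<^sub>z\<close> determines both real derivatives, since \<open>G\<^sup>* G\<^sub>x\<close> and \<open>G\<^sup>* G\<^sub>y\<close> are skew-adjoint.\<close>

lemma gauge_transformation_iff_frame:
  assumes q: "Ck 1 q" and r: "Ck 1 r"
  shows "gauge_transformation G p q r u S \<longleftrightarrow>
    Ck 1 G \<and> frame (lax p q r u) G \<and> (\<forall>w. S w = - (G w ** sigma3 ** adj (G w)))"
proof -
  note dq = Ck_partials(2,3) [OF q order_refl] and dr = Ck_partials(2,3) [OF r order_refl]
  have "matD_zbar (U_offdiag q r) w = mat22 0 (D_zbar q w) (D_zbar r w) 0" for w
  proof -
    have "deriv_along e_x (U_offdiag q r) (\<lambda>w. mat22 0 (partial_x q w) (partial_x r w) 0)"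
      "deriv_along e_y (U_offdiag q r) (\<lambda>w. mat22 0 (partial_y q w) (partial_y r w) 0)"
      unfolding U_offdiag_def [abs_def] by (intro deriv_along_mat22 deriv_along_const dq dr)+
    from matD_z_eq(2) [OF this] show ?thesis
      by (simp add: cmat_eq_iff entries D_zbar_def)
  qed
  then have t: "cscale (- \<i>) (G w **
       ((mat (of_real (u w)) + matD_zbar (U_offdiag q r) w) ** sigma3 + Q_matrix p q r w))
      = G w ** lax_t p q r u w" for w
    by (simp add: cmat_eq_iff entries Q_matrix_def lax_t_def algebra_simps)
  have z: "matD_z G w = - (G w ** U_matrix p q r w) \<longleftrightarrow>
      partial_x G w = G w ** lax_x p q r w \<and> partial_y G w = G w ** lax_y p q r w"
    if G: "Ck 1 G" "\<And>w. G w \<in> SU2" for w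
  proof
    assume "partial_x G w = G w ** lax_x p q r w \<and> partial_y G w = G w ** lax_y p q r w"
    then have "matD_z G w = G w ** (lax_x p q r w - cscale \<i> (lax_y p q r w))"
      by (simp add: matD_z_def matmul_cscale_right matmul.diff_right)
    then show "matD_z G w = - (G w ** U_matrix p q r w)"
      by (simp add: lax_z matmul.minus_right)
  next
    assume z: "matD_z G w = - (G w ** U_matrix p q r w)"
    define A where "A e w = adj (G w) ** (if e = e_t then partial_t G w else if e = e_x then partial_x G w
      else partial_y G w)" for e w
    have GA: "G w ** A e_t w = partial_t G w" "G w ** A e_x w = partial_x G w" "G w ** A e_y w = partial_y G w" for w
      by (simp_all add: A_def matrix_mul_assoc SU2_unitary [OF G(2)])
    have "frame A G"
      unfolding frame_def using Ck_partials [OF G(1) order_refl] G(2) by (auto simp: axes_def GA)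
    from frame_skew [OF this] have sk: "adj (A e_x w) = - A e_x w" "adj (A e_y w) = - A e_y w"
      by (auto simp: axes_def)
    have "G w ** (A e_x w - cscale \<i> (A e_y w)) = G w ** (- U_matrix p q r w)"
    proof -
      have "G w ** (A e_x w - cscale \<i> (A e_y w)) = matD_z G w"
        unfolding matD_z_def GA [symmetric] by (simp add: matmul_cscale_right matmul.diff_right)
      then show ?thesis by (simp add: z matmul.minus_right)
    qed
    then have 1: "A e_x w - cscale \<i> (A e_y w) = - U_matrix p q r w"
      by (simp add: SU2_cancel [OF G(2)])
    have "adj (A e_x w - cscale \<i> (A e_y w)) = adj (- U_matrix p q r w)"
      by (simp only: 1)
    then have 2: "A e_x w + cscale \<i> (A e_y w) = adj (U_matrix p q r w)"
    proof -
      have "adj (A e_x w - cscale \<i> (A e_y w)) = adj (A e_x w) + cscale \<i> (adj (A e_y w))"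
        by (simp add: cmat_eq_iff entries)
      then show ?thesis
        using \<open>adj (A e_x w - cscale \<i> (A e_y w)) = adj (- U_matrix p q r w)\<close>
        by (simp add: sk cmat_eq_iff entries) (simp add: algebra_simps add_eq_0_iff)
    qed
    have U: "U_matrix p q r w = cscale \<i> (A e_y w) - A e_x w"
      using arg_cong [OF 1, of uminus] by simp
    have "A e_x w = lax_x p q r w" "A e_y w = lax_y p q r w"
      unfolding lax_x_def lax_y_def 2 [symmetric] unfolding U by (simp_all add: cmat_eq_iff entries field_simps)
    then show "partial_x G w = G w ** lax_x p q r w \<and> partial_y G w = G w ** lax_y p q r w"
      using GA(2,3) [of w] by simp
  qed
  have fr: "frame (lax p q r u) G \<longleftrightarrow> (\<forall>w. G w \<in> SU2) \<and>
      (\<forall>w. partial_t G w = G w ** lax_t p q r u w) \<and>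
      (\<forall>w. partial_x G w = G w ** lax_x p q r w \<and> partial_y G w = G w ** lax_y p q r w)"
    if "Ck 1 G"
  proof -
    note d = Ck_partials(1-3) [OF that order_refl]
    have *: "deriv_along e G f \<longleftrightarrow> g = f" if "deriv_along e G g" for e f g
      using that deriv_along_unique by metis
    show ?thesis
      unfolding frame_def axes_def ball_simps lax_simps using d
      by (simp add: * [OF d(1)] * [OF d(2)] * [OF d(3)] fun_eq_iff split_paired_All)
        (auto simp: fun_eq_iff)
  qed
  show ?thesis
  proof (cases "Ck 1 G \<and> (\<forall>w. G w \<in> SU2)")
    case True
    then have C: "Ck 1 G" and SU: "\<And>w. G w \<in> SU2" by blast+
    show ?thesis
      unfolding gauge_transformation_def t fr [OF C] z [OF C SU] SU2_matrix_inv [OF SU]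
      using C SU by blast
  next
    case False
    then show ?thesis unfolding gauge_transformation_def frame_def by blast
  qed
qed


section \<open>The Schroedinger system as flatness of the Lax connection\<close>

lemma D_z_add_cmult:
  assumes "Ck 1 f" "Ck 1 g"
  shows "D_z (\<lambda>v. a * f v + b * g v) w = a * D_z f w + b * D_z g w"
proof -
  note df = Ck_partials(2,3) [OF assms(1) order_refl] and dg = Ck_partials(2,3) [OF assms(2) order_refl]
  have "D_z (\<lambda>v. a * f v + b * g v) = (\<lambda>w. (a * partial_x f w + 0 * f w + (b * partial_x g w + 0 * g w))
      - \<i> * (a * partial_y f w + 0 * f w + (b * partial_y g w + 0 * g w)))"
    by (intro D_z_eq deriv_along_add deriv_along_mult deriv_along_const df dg)
  then show ?thesis by (simp add: D_z_def algebra_simps)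
qed

lemma D_zbar_mult:
  assumes "Ck 1 f" "Ck 1 g"
  shows "D_zbar (\<lambda>v. f v * g v) w = f w * D_zbar g w + D_zbar f w * g w"
proof -
  note df = Ck_partials(2,3) [OF assms(1) order_refl] and dg = Ck_partials(2,3) [OF assms(2) order_refl]
  have "D_zbar (\<lambda>v. f v * g v) = (\<lambda>w. (f w * partial_x g w + partial_x f w * g w)
      + \<i> * (f w * partial_y g w + partial_y f w * g w))"
    by (intro D_z_eq deriv_along_mult df dg)
  then show ?thesis by (simp add: D_zbar_def algebra_simps)
qed

lemma D_z_cnj:
  assumes "Ck 1 f"
  shows "D_z (\<lambda>v. cnj (f v)) w = cnj (D_zbar f w)"
  using D_z_eq(1) [OF deriv_along_cnj deriv_along_cnj, OF Ck_partials(2,3) [OF assms order_refl]]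
  by (simp add: D_zbar_def)

lemma D_zbar_D_z_commute:
  assumes "Ck 2 f"
  shows "D_zbar (D_z f) w = D_z (D_zbar f) w"
proof -
  have fx: "Ck 1 (partial_x f)" and fy: "Ck 1 (partial_y f)"
    using Ck_partials(5,6) [OF assms] by simp_all
  note d = Ck_partials(2,3) [OF assms one_le_numeral] and dx = Ck_partials(2,3) [OF fx order_refl]
    and dy = Ck_partials(2,3) [OF fy order_refl]
  have c: "partial_y (partial_x f) = partial_x (partial_y f)"
    by (rule Ck2_mixed_derivatives_commute [OF assms in_axes(2,3) d dx(2) dy(1)])
  have "D_zbar (D_z f) = (\<lambda>w. (partial_x (partial_x f) w - (\<i> * partial_x (partial_y f) w + 0 * partial_y f w))
      + \<i> * (partial_y (partial_x f) w - (\<i> * partial_y (partial_y f) w + 0 * partial_y f w)))"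
    unfolding D_z_def [abs_def]
    by (intro D_z_eq deriv_along_diff deriv_along_mult deriv_along_const dx dy)
  moreover have "D_z (D_zbar f) = (\<lambda>w. (partial_x (partial_x f) w + (\<i> * partial_x (partial_y f) w + 0 * partial_y f w))
      - \<i> * (partial_y (partial_x f) w + (\<i> * partial_y (partial_y f) w + 0 * partial_y f w)))"
    unfolding D_zbar_def [abs_def]
    by (intro D_z_eq deriv_along_add deriv_along_mult deriv_along_const dx dy)
  ultimately show ?thesis by (simp add: c algebra_simps)
qed

definition nls_at where
  "nls_at p q r u w \<longleftrightarrow>
       \<i> * partial_t q w - D_zbar (D_z q) w + 2 * of_real (u w) * q w
         - 2 * D_z (\<lambda>v. cnj (p v) * q v) w + 2 * p w * D_zbar q w
         + 4 * of_real ((cmod (p w))\<^sup>2) * q w = 0 \<and>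
       \<i> * partial_t r w + D_zbar (D_z r) w - 2 * of_real (u w) * r w
         - 2 * D_z (\<lambda>v. cnj (p v) * r v) w + 2 * p w * D_zbar r w
         - 4 * of_real ((cmod (p w))\<^sup>2) * r w = 0 \<and>
       \<i> * partial_t p w = D_zbar (\<lambda>v. q v * r v) w - D_z (\<lambda>v. of_real (u v)) w"

lemma nls_solution_iff:
  "nls_solution k p q r u \<longleftrightarrow> Ck k p \<and> Ck k q \<and> Ck k r \<and> Ck k u \<and> (\<forall>w. nls_at p q r u w)"
  by (simp add: nls_solution_def nls_at_def)

text \<open>The diagonal of the matrix equation \<open>U\<^sub>t + C\<^sub>z = [U, C]\<close> is the third equation of the system, and
  its off-diagonal entries are the other two, up to the factor \<open>\<i>\<close>.\<close>

lemma nls_at_iff_flat: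
  assumes p: "Ck 2 p" and q: "Ck 2 q" and r: "Ck 2 r" and u: "Ck 2 u"
    and C: "deriv_along e_x (lax_t p q r u) Cx" "deriv_along e_y (lax_t p q r u) Cy"
  shows "nls_at p q r u w \<longleftrightarrow>
    U_matrix (partial_t p) (partial_t q) (partial_t r) w + Cx w - cscale \<i> (Cy w) =
    commutator (U_matrix p q r w) (lax_t p q r u w)"
proof -
  have C1: "Ck 1 p" "Ck 1 q" "Ck 1 r" "Ck 1 u"
    by (rule Ck_mono [OF _ one_le_numeral], fact)+
  have C1': "Ck 1 (\<lambda>v. complex_of_real (u v))" "Ck 1 (D_zbar q)" "Ck 1 (D_zbar r)"
      "Ck 1 (\<lambda>v. cnj (p v) * q v)" "Ck 1 (\<lambda>v. cnj (p v) * r v)"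
    using C1 Ck_D_z(2) [OF q] Ck_D_z(2) [OF r] by (auto intro!: Ck_rules)
  have z: "D_z (\<lambda>v. lax_t p q r u v $ i $ j) w = (Cx w - cscale \<i> (Cy w)) $ i $ j" for i j
    using D_z_eq(1) [OF deriv_along_entry deriv_along_entry, OF C] by (simp add: entries)
  have z11: "(Cx w - cscale \<i> (Cy w)) $ 1 $ 1 = - \<i> * D_z (\<lambda>v. complex_of_real (u v)) w"
    using D_z_add_cmult [OF C1'(1) C1'(1), of "- \<i>" 0] unfolding z [symmetric] lax_t_def entries by simp
  have z22: "(Cx w - cscale \<i> (Cy w)) $ 2 $ 2 = \<i> * D_z (\<lambda>v. complex_of_real (u v)) w"
    using D_z_add_cmult [OF C1'(1) C1'(1), of "\<i>" 0] unfolding z [symmetric] lax_t_def entries by simp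
  have z12: "(Cx w - cscale \<i> (Cy w)) $ 1 $ 2 = \<i> * (D_zbar (D_z q) w + 2 * D_z (\<lambda>v. cnj (p v) * q v) w)"
    using D_z_add_cmult [OF C1'(2,4), of "\<i>" "2 * \<i>"] D_zbar_D_z_commute [OF q]
    unfolding z [symmetric] lax_t_def entries by (simp add: algebra_simps)
  have z21: "(Cx w - cscale \<i> (Cy w)) $ 2 $ 1 = - \<i> * (D_zbar (D_z r) w - 2 * D_z (\<lambda>v. cnj (p v) * r v) w)"
    using D_z_add_cmult [OF C1'(3,5), of "- \<i>" "2 * \<i>"] D_zbar_D_z_commute [OF r]
    unfolding z [symmetric] lax_t_def entries by (simp add: algebra_simps)
  have n: "complex_of_real ((cmod (p w))\<^sup>2) = p w * cnj (p w)"
    by (rule complex_norm_square)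
  have mult_i: "a = b \<longleftrightarrow> \<i> * a = \<i> * b" for a b :: complex by simp
  have "U_matrix (partial_t p) (partial_t q) (partial_t r) w + (Cx w - cscale \<i> (Cy w)) =
    commutator (U_matrix p q r w) (lax_t p q r u w) \<longleftrightarrow>
    (partial_t q w + \<i> * (D_zbar (D_z q) w + 2 * D_z (\<lambda>v. cnj (p v) * q v) w) =
      2 * p w * (\<i> * (D_zbar q w + 2 * (cnj (p w) * q w))) + 2 * \<i> * of_real (u w) * q w) \<and>
    (partial_t r w - \<i> * (D_zbar (D_z r) w - 2 * D_z (\<lambda>v. cnj (p v) * r v) w) =
      - 2 * \<i> * of_real (u w) * r w + 2 * p w * (\<i> * (D_zbar r w - 2 * (cnj (p w) * r w)))) \<and>
    (partial_t p w - \<i> * D_z (\<lambda>v. complex_of_real (u v)) w =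
      q w * (- \<i> * (D_zbar r w - 2 * (cnj (p w) * r w))) - \<i> * (D_zbar q w + 2 * (cnj (p w) * q w)) * r w)"
    unfolding cmat_eq_iff vector_add_component z11 z12 z21 z22 
    by (auto simp: U_matrix_def commutator_def lax_t_def entries algebra_simps)
  also have "\<dots> \<longleftrightarrow> nls_at p q r u w"
    unfolding nls_at_def D_zbar_mult [OF C1(2,3)] n
    apply (subst (1 2 3) mult_i)
    apply (intro arg_cong2 [of _ _ _ _ "(\<and>)"])
    by (auto simp: algebra_simps)
  finally show ?thesis by (simp add: add_diff_eq)
qed

text \<open>In complex form flatness in the \<open>(x, y)\<close>-plane is the Hermitian equation that equates the
  \<open>\<partial>\<close>-bar derivative of \<open>U\<close> plus the \<open>\<partial>\<close>-derivative of \<open>U\<^sup>*\<close> with \<open>[U, U\<^sup>*]\<close>. Its first row gives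
  the two restrictions and the second row repeats them.\<close>

lemma flat_xy_iff_restrictions:
  assumes p: "Ck 1 p" and q: "Ck 1 q" and r: "Ck 1 r"
  shows "flat_at (lax p q r u) e_x e_y w \<longleftrightarrow>
     D_z (\<lambda>v. cnj (p v)) w + D_zbar p w = of_real ((cmod (q w))\<^sup>2 - (cmod (r w))\<^sup>2) \<and>
     D_z (\<lambda>v. cnj (r v)) w + D_zbar q w = 2 * (p w * cnj (r w) - cnj (p w) * q w)"
proof -
  note dp = Ck_partials(2,3) [OF p order_refl] and dq = Ck_partials(2,3) [OF q order_refl]
    and dr = Ck_partials(2,3) [OF r order_refl]
  define Ux Uy where "Ux = U_matrix (partial_x p) (partial_x q) (partial_x r) w"
    and "Uy = U_matrix (partial_y p) (partial_y q) (partial_y r) w"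
  let ?U = "U_matrix p q r w"
  have "flat_at (lax p q r u) e_x e_y w \<longleftrightarrow>
      lax_x (partial_y p) (partial_y q) (partial_y r) w + lax_y p q r w ** lax_x p q r w =
      lax_y (partial_x p) (partial_x q) (partial_x r) w + lax_x p q r w ** lax_y p q r w"
    by (rule flat_at_iff [where A = "lax p q r u" and e = e_x and e' = e_y, unfolded lax_simps])
      (rule deriv_along_lax dp dq dr)+
  also have "\<dots> \<longleftrightarrow> adj Ux + Ux + cscale \<i> (Uy - adj Uy) = ?U ** adj ?U - adj ?U ** ?U"
  proof -
    have "lax_x (partial_y p) (partial_y q) (partial_y r) w + lax_y p q r w ** lax_x p q r w
        - (lax_y (partial_x p) (partial_x q) (partial_x r) w + lax_x p q r w ** lax_y p q r w)
        = cscale (\<i> / 2) ((adj Ux + Ux + cscale \<i> (Uy - adj Uy)) - (?U ** adj ?U - adj ?U ** ?U))"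
      unfolding lax_x_def lax_y_def Ux_def [symmetric] Uy_def [symmetric]
      by (simp add: cmat_eq_iff entries field_simps)
    moreover have "cscale (\<i> / 2) M = 0 \<longleftrightarrow> M = 0" for M
      by (simp add: cmat_eq_iff entries)
    ultimately show ?thesis by (metis eq_iff_diff_eq_0)
  qed
  also have "\<dots> \<longleftrightarrow>
     D_z (\<lambda>v. cnj (p v)) w + D_zbar p w = of_real ((cmod (q w))\<^sup>2 - (cmod (r w))\<^sup>2) \<and>
     D_z (\<lambda>v. cnj (r v)) w + D_zbar q w = 2 * (p w * cnj (r w) - cnj (p w) * q w)"
    (is "?L \<longleftrightarrow> ?R1 \<and> ?R2")
  proof -
    have "?L \<longleftrightarrow> ?R1 \<and> ?R2 \<and> cnj (D_z (\<lambda>v. cnj (r v)) w + D_zbar q w) = cnj (2 * (p w * cnj (r w) - cnj (p w) * q w))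
       \<and> - (D_z (\<lambda>v. cnj (p v)) w + D_zbar p w) = - of_real ((cmod (q w))\<^sup>2 - (cmod (r w))\<^sup>2)"
      unfolding D_z_cnj [OF p] D_z_cnj [OF r] of_real_diff complex_norm_square D_zbar_def Ux_def Uy_def
      by (auto simp: cmat_eq_iff entries U_matrix_def algebra_simps)
    then show ?thesis unfolding complex_cnj_cancel_iff neg_equal_iff_equal by blast
  qed
  finally show ?thesis .
qed

text \<open>The system gives \<open>U\<^sub>t + C\<^sub>z = [U, C]\<close>. As \<open>C\<close> is skew-adjoint by the restrictions, the adjoint
  equation holds as well, and the two combine to flatness in the real directions.\<close>

lemma nls_frame_exists:
  assumes m: "2 \<le> m" and nls: "nls_solution m p q r u" and R: "nls_restrictions p q r" and "g0 \<in> SU2"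
  shows "\<exists>G. G (0, 0, 0) = g0 \<and> frame (lax p q r u) G"
proof -
  have C2: "Ck 2 p" "Ck 2 q" "Ck 2 r" "Ck 2 u" and eq: "nls_at p q r u w" for w
    using nls m by (auto simp: nls_solution_iff intro: Ck_mono)
  have C1: "Ck 1 p" "Ck 1 q" "Ck 1 r"
    by (rule Ck_mono [OF _ one_le_numeral], fact)+
  have CA: "Ck 1 (lax p q r u e)" if "e \<in> axes" for e
    using Ck_lax [OF C2 one_le_numeral that] by simp
  have su: "lax p q r u e w \<in> su2" if "e \<in> axes" for e w
  proof -
    have "lax_t p q r u w \<in> su2"
      using R lax_t_su2_iff [OF C1(2,3), of p u w] unfolding nls_restrictions_def by blast
    then show ?thesis
      using that lax_xy_su2 unfolding axes_def by (elim insertE emptyE) (simp_all add: lax_simps)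
  qed
  obtain Ct where Ct: "deriv_along e_x (lax_t p q r u) (Ct e_x)" "deriv_along e_y (lax_t p q r u) (Ct e_y)"
  proof -
    obtain Cx where "deriv_along e_x (lax_t p q r u) Cx"
      by (rule Ck_deriv_along [OF CA [OF in_axes(1), unfolded lax_simps] order_refl in_axes(2)])
    moreover obtain Cy where "deriv_along e_y (lax_t p q r u) Cy"
      by (rule Ck_deriv_along [OF CA [OF in_axes(1), unfolded lax_simps] order_refl in_axes(3)])
    ultimately show ?thesis using that [of "\<lambda>e. if e = e_x then Cx else Cy"] by simp
  qed
  have adjC: "adj (lax_t p q r u w) = - lax_t p q r u w" for w
    using su [OF in_axes(1), of w] by (simp add: su2_def lax_simps)
  have adjCt: "adj (Ct e w) = - Ct e w" if "deriv_along e (lax_t p q r u) (Ct e)" for e w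
  proof -
    have "deriv_along e (\<lambda>w. adj (lax_t p q r u w)) (\<lambda>w. - Ct e w)"
      unfolding adjC by (rule deriv_along_minus [OF that])
    from deriv_along_unique [OF deriv_along_adj [OF that] this] show ?thesis by (rule fun_cong)
  qed
  note d = Ck_partials(1) [OF C2(1) one_le_numeral] Ck_partials(1) [OF C2(2) one_le_numeral]
    Ck_partials(1) [OF C2(3) one_le_numeral]
  have main: "lax_x (partial_t p) (partial_t q) (partial_t r) w =
        Ct e_x w + lax_t p q r u w ** - lax_x p q r w + lax_x p q r w ** lax_t p q r u w"
      "lax_y (partial_t p) (partial_t q) (partial_t r) w =
        Ct e_y w + lax_t p q r u w ** - lax_y p q r w + lax_y p q r w ** lax_t p q r u w" for w
  proof -
    let ?Ut = "U_matrix (partial_t p) (partial_t q) (partial_t r) w"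
      and ?U = "U_matrix p q r w" and ?C = "lax_t p q r u w"
    have 1: "?Ut = ?U ** ?C - ?C ** ?U - Ct e_x w + cscale \<i> (Ct e_y w)"
      using eq nls_at_iff_flat [OF C2 Ct] by (simp add: commutator_def algebra_simps)
    have "adj ?Ut = adj (?U ** ?C - ?C ** ?U - Ct e_x w + cscale \<i> (Ct e_y w))"
      by (simp only: 1)
    also have "\<dots> = adj ?C ** adj ?U - adj ?U ** adj ?C - adj (Ct e_x w) - cscale \<i> (adj (Ct e_y w))"
      by (simp add: cmat_eq_iff entries algebra_simps)
    finally have 2: "adj ?Ut = adj ?U ** ?C - ?C ** adj ?U + Ct e_x w + cscale \<i> (Ct e_y w)"
      by (simp add: adjC adjCt Ct cmat_eq_iff entries algebra_simps)
    show "lax_x (partial_t p) (partial_t q) (partial_t r) w =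
        Ct e_x w + lax_t p q r u w ** - lax_x p q r w + lax_x p q r w ** lax_t p q r u w"
      unfolding lax_x_def 2 unfolding 1 by (simp add: cmat_eq_iff entries field_simps)
    show "lax_y (partial_t p) (partial_t q) (partial_t r) w =
        Ct e_y w + lax_t p q r u w ** - lax_y p q r w + lax_y p q r w ** lax_t p q r u w"
      unfolding lax_y_def 2 unfolding 1 by (simp add: cmat_eq_iff entries field_simps)
  qed
  have t: "flat_at (lax p q r u) e_t e_x w" "flat_at (lax p q r u) e_t e_y w" for w
    using flat_at_iff [of e_x "lax p q r u" e_t, unfolded lax_simps, OF Ct(1) deriv_along_lax(1) [OF d]]
      flat_at_iff [of e_y "lax p q r u" e_t, unfolded lax_simps, OF Ct(2) deriv_along_lax(2) [OF d]]
    by (simp_all add: main matmul.minus_right)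
  have xy: "flat_at (lax p q r u) e_x e_y w" for w
    using R flat_xy_iff_restrictions [OF C1] unfolding nls_restrictions_def by blast
  show ?thesis
    unfolding frame_def by (rule flat_connection_integrable) (rule CA su assms(4) t xy, assumption?)+
qed

text \<open>The converse of \<open>nls_frame_exists\<close>. It spares every direct verification of the
  Schroedinger system for transformed potentials: it is enough to exhibit a frame.\<close>

lemma frame_imp_nls:
  assumes m: "2 \<le> m" and C: "Ck m p" "Ck m q" "Ck m r" "Ck m u" and G: "frame (lax p q r u) G"
  shows "nls_solution m p q r u" "nls_restrictions p q r"
proof -
  have C2: "Ck 2 p" "Ck 2 q" "Ck 2 r" "Ck 2 u"
    using C m by (auto intro: Ck_mono)
  have C1: "Ck 1 p" "Ck 1 q" "Ck 1 r"
    by (rule Ck_mono [OF _ one_le_numeral], fact)+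
  have CA: "Ck 1 (lax p q r u e)" if "e \<in> axes" for e
    using Ck_lax [OF C2 one_le_numeral that] by simp
  note flat = frame_flat [OF G CA]
  show "nls_restrictions p q r"
    using flat [OF _ in_axes(2,3)] flat_xy_iff_restrictions [OF C1]
    unfolding nls_restrictions_def by blast
  obtain Cx where Cx: "deriv_along e_x (lax_t p q r u) Cx"
    by (rule Ck_deriv_along [OF CA [OF in_axes(1), unfolded lax_simps] order_refl in_axes(2)])
  obtain Cy where Cy: "deriv_along e_y (lax_t p q r u) Cy"
    by (rule Ck_deriv_along [OF CA [OF in_axes(1), unfolded lax_simps] order_refl in_axes(3)])
  note d = Ck_partials(1) [OF C2(1) one_le_numeral] Ck_partials(1) [OF C2(2) one_le_numeral]
    Ck_partials(1) [OF C2(3) one_le_numeral]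
  have "nls_at p q r u w" for w
  proof -
    have 1: "lax_x (partial_t p) (partial_t q) (partial_t r) w =
        Cx w + lax_x p q r w ** lax_t p q r u w - lax_t p q r u w ** lax_x p q r w"
      and 2: "lax_y (partial_t p) (partial_t q) (partial_t r) w =
        Cy w + lax_y p q r w ** lax_t p q r u w - lax_t p q r u w ** lax_y p q r w"
      using flat [OF _ in_axes(1,2), of w] flat [OF _ in_axes(1,3), of w]
        flat_at_iff [of e_x "lax p q r u" e_t, unfolded lax_simps, OF Cx deriv_along_lax(1) [OF d], of w]
        flat_at_iff [of e_y "lax p q r u" e_t, unfolded lax_simps, OF Cy deriv_along_lax(2) [OF d], of w]
      by (simp_all add: algebra_simps)
    have "- U_matrix (partial_t p) (partial_t q) (partial_t r) w =
        Cx w - cscale \<i> (Cy w) - U_matrix p q r w ** lax_t p q r u w + lax_t p q r u w ** U_matrix p q r w"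
    proof -
      have "- U_matrix (partial_t p) (partial_t q) (partial_t r) w =
          Cx w - cscale \<i> (Cy w) + (lax_x p q r w - cscale \<i> (lax_y p q r w)) ** lax_t p q r u w
          - lax_t p q r u w ** (lax_x p q r w - cscale \<i> (lax_y p q r w))"
        unfolding lax_z(1) [of "partial_t p", symmetric] 1 2
        by (simp add: cmat_eq_iff entries algebra_simps)
      then show ?thesis unfolding lax_z by (simp add: matmul.minus_left matmul.minus_right)
    qed
    then show ?thesis
      unfolding nls_at_iff_flat [OF C2 Cx Cy] commutator_def by (simp add: algebra_simps)
  qed
  then show "nls_solution m p q r u" using C by (simp add: nls_solution_iff)
qed


section \<open>The Landau-Lifshitz equation in a moving frame\<close>

definition spin_of :: "(spacetime \<Rightarrow> cmat) \<Rightarrow> spacetime \<Rightarrow> cmat" where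
  "spin_of G w = - (G w ** sigma3 ** adj (G w))"

lemma spin_of_conjugate: "spin_of G w = G w ** (- sigma3) ** adj (G w)"
  by (simp add: spin_of_def matmul.minus_left matmul.minus_right)

lemma deriv_along_spin_of:
  assumes "frame A G" "e \<in> axes"
  shows "deriv_along e (spin_of G) (\<lambda>w. G w ** commutator sigma3 (A e w) ** adj (G w))"
proof -
  have "commutator (A e w) (- sigma3) = commutator sigma3 (A e w)" for w
    by (simp add: commutator_def matmul.minus_left matmul.minus_right)
  then show ?thesis
    using deriv_along_conjugate [OF assms deriv_along_const [of e "- sigma3"]]
    unfolding spin_of_conjugate [abs_def] by simp
qed

lemma conjugate_cscale: "G ** cscale c M ** H = cscale c (G ** M ** H)"
  by (simp add: cmat_eq_iff entries algebra_simps)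

text \<open>In the frame, \<open>S\<^sub>z\<close> is the off-diagonal matrix with entries \<open>-2q\<close> and \<open>2r\<close>; one more covariant
  derivative gives the Laplacian.\<close>

lemma spin_of_laplacian:
  assumes G: "frame A G" and A: "A e_x = lax_x p q r" "A e_y = lax_y p q r"
    and C: "Ck 1 q" "Ck 1 r"
  shows "matD_zbar (matD_z (spin_of G)) w = G w **
    (mat22 0 (- 2 * D_zbar q w) (2 * D_zbar r w) 0 +
      commutator (adj (U_matrix p q r w)) (mat22 0 (- 2 * q w) (2 * r w) 0)) ** adj (G w)"
proof -
  define V where "V w = mat22 0 (- 2 * q w) (2 * r w) 0" for w
  have z: "matD_z (spin_of G) = (\<lambda>w. G w ** V w ** adj (G w))"
  proof
    fix w
    have "matD_z (spin_of G) w = G w ** commutator sigma3 (A e_x w) ** adj (G w)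
        - cscale \<i> (G w ** commutator sigma3 (A e_y w) ** adj (G w))"
      using matD_z_eq(1) [OF deriv_along_spin_of deriv_along_spin_of, OF G in_axes(2) G in_axes(3)] by simp
    also have "\<dots> = G w ** commutator sigma3 (A e_x w - cscale \<i> (A e_y w)) ** adj (G w)"
      unfolding conjugate_cscale [symmetric] matmul.diff_right [symmetric] matmul.diff_left [symmetric]
      by (intro arg_cong [where f = "\<lambda>M. G w ** M ** adj (G w)"])
        (simp add: commutator_def cmat_eq_iff entries algebra_simps)
    also have "commutator sigma3 (A e_x w - cscale \<i> (A e_y w)) = V w"
      unfolding A lax_z V_def by (simp add: commutator_def cmat_eq_iff entries U_matrix_def)
    finally show "matD_z (spin_of G) w = G w ** V w ** adj (G w)" .
  qed
  note dq = Ck_partials(2,3) [OF C(1) order_refl] and dr = Ck_partials(2,3) [OF C(2) order_refl]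
  have V: "deriv_along e_x V (\<lambda>w. mat22 0 (- 2 * partial_x q w + 0 * q w) (2 * partial_x r w + 0 * r w) 0)"
    "deriv_along e_y V (\<lambda>w. mat22 0 (- 2 * partial_y q w + 0 * q w) (2 * partial_y r w + 0 * r w) 0)"
    unfolding V_def [abs_def] by (intro deriv_along_mat22 deriv_along_mult deriv_along_const dq dr)+
  have "matD_zbar (matD_z (spin_of G)) w =
      G w ** (mat22 0 (- 2 * partial_x q w + 0 * q w) (2 * partial_x r w + 0 * r w) 0 + commutator (A e_x w) (V w)) ** adj (G w)
      + cscale \<i> (G w ** (mat22 0 (- 2 * partial_y q w + 0 * q w) (2 * partial_y r w + 0 * r w) 0 + commutator (A e_y w) (V w)) ** adj (G w))"
    unfolding z
    using matD_z_eq(2) [OF deriv_along_conjugate deriv_along_conjugate, OF G in_axes(2) V(1) G in_axes(3) V(2)] by simp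
  also have "\<dots> = G w ** (mat22 0 (- 2 * D_zbar q w) (2 * D_zbar r w) 0 +
      commutator (A e_x w + cscale \<i> (A e_y w)) (V w)) ** adj (G w)"
    unfolding conjugate_cscale [symmetric] matmul.add_right [symmetric] matmul.add_left [symmetric]
    by (intro arg_cong [where f = "\<lambda>M. G w ** M ** adj (G w)"])
      (simp add: commutator_def cmat_eq_iff entries D_zbar_def algebra_simps)
  finally show ?thesis unfolding A lax_z V_def .
qed

text \<open>Conjugation by \<open>G\<close> drops out, and the commutator with \<open>\<sigma>\<^sub>3\<close> retains exactly the off-diagonal entries.\<close>

lemma landau_lifshitz_iff:
  assumes G: "frame A G" and A: "A e_x = lax_x p q r" "A e_y = lax_y p q r"
    and C: "Ck 1 q" "Ck 1 r"
  shows "partial_t (spin_of G) w =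
      cscale (- (1 / (2 * \<i>))) (commutator (spin_of G w) (matD_zbar (matD_z (spin_of G)) w)) \<longleftrightarrow>
    A e_t w $ 1 $ 2 = \<i> * (D_zbar q w + 2 * (cnj (p w) * q w)) \<and>
    A e_t w $ 2 $ 1 = - \<i> * (D_zbar r w - 2 * (cnj (p w) * r w))"
proof -
  let ?W = "mat22 0 (- 2 * D_zbar q w) (2 * D_zbar r w) 0 +
      commutator (adj (U_matrix p q r w)) (mat22 0 (- 2 * q w) (2 * r w) 0)"
  have t: "partial_t (spin_of G) w = G w ** commutator sigma3 (A e_t w) ** adj (G w)"
    using deriv_along_partials(1) [OF deriv_along_spin_of [OF G in_axes(1)]] by simp
  have k: "- (1 / (2 * \<i>)) = \<i> / 2" by (simp add: field_simps)
  have GG: "adj (G w) ** G w = mat 1" by (rule SU2_unitary [OF frame_SU2 [OF G]])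
  have "commutator (G w ** (- sigma3) ** adj (G w)) (G w ** ?W ** adj (G w)) =
      G w ** commutator (- sigma3) ?W ** adj (G w)"
  proof -
    have "(G w ** X ** adj (G w)) ** (G w ** Y ** adj (G w)) = G w ** (X ** Y) ** adj (G w)" for X Y
    proof -
      have "(G w ** X ** adj (G w)) ** (G w ** Y ** adj (G w)) =
          G w ** X ** (adj (G w) ** G w) ** Y ** adj (G w)"
        by (simp only: matrix_mul_assoc)
      then show ?thesis by (simp only: GG matrix_mul_rid) (simp only: matrix_mul_assoc)
    qed
    then show ?thesis
      by (simp only: commutator_def matmul.diff_right matmul.diff_left)
  qed
  then have "cscale (- (1 / (2 * \<i>))) (commutator (spin_of G w) (matD_zbar (matD_z (spin_of G)) w))
      = G w ** cscale (- (1 / (2 * \<i>))) (commutator (- sigma3) ?W) ** adj (G w)"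
    unfolding spin_of_laplacian [OF assms] conjugate_cscale by (simp add: spin_of_conjugate)
  then have "partial_t (spin_of G) w =
      cscale (- (1 / (2 * \<i>))) (commutator (spin_of G w) (matD_zbar (matD_z (spin_of G)) w)) \<longleftrightarrow>
      commutator sigma3 (A e_t w) = cscale (- (1 / (2 * \<i>))) (commutator (- sigma3) ?W)"
    by (simp add: t SU2_cancel [OF frame_SU2 [OF G]])
  also have "\<dots> \<longleftrightarrow> 4 * A e_t w $ 1 $ 2 = 4 * (\<i> * (D_zbar q w + 2 * (cnj (p w) * q w))) \<and>
    4 * (- \<i> * (D_zbar r w - 2 * (cnj (p w) * r w))) = 4 * A e_t w $ 2 $ 1"
    unfolding k by (auto simp: cmat_eq_iff entries commutator_def U_matrix_def field_simps)
  also have "\<dots> \<longleftrightarrow> A e_t w $ 1 $ 2 = \<i> * (D_zbar q w + 2 * (cnj (p w) * q w)) \<and>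
    A e_t w $ 2 $ 1 = - \<i> * (D_zbar r w - 2 * (cnj (p w) * r w))"
  proof -
    have 4: "4 * a = 4 * b \<longleftrightarrow> a = b" for a b :: complex by simp
    show ?thesis unfolding 4 by (rule conj_cong [OF refl eq_commute])
  qed
  finally show ?thesis .
qed

lemma spin_matrix_iff:
  "(\<exists>s1 s2 s3. \<forall>w. S w = spin_matrix (s1 w) (s2 w) (s3 w)) \<longleftrightarrow>
    (\<forall>w. adj (S w) = S w \<and> S w $ 1 $ 1 + S w $ 2 $ 2 = 0)" (is "?L \<longleftrightarrow> ?R")
proof
  assume ?L
  then obtain s1 s2 s3 where "\<And>w. S w = spin_matrix (s1 w) (s2 w) (s3 w)" by blast
  then show ?R by (simp add: spin_matrix_def cmat_eq_iff entries)
next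
  assume R: ?R
  have *: "S w = spin_matrix (Re (S w $ 1 $ 2)) (Im (S w $ 1 $ 2)) (Re (S w $ 1 $ 1))" for w
  proof -
    have *: "adj (S w) = S w" "S w $ 1 $ 1 + S w $ 2 $ 2 = 0" using R by blast+
    have "S w $ 2 $ 1 = cnj (S w $ 1 $ 2)" "cnj (S w $ 1 $ 1) = S w $ 1 $ 1"
      using arg_cong [OF *(1), of "\<lambda>M. M $ 2 $ 1"] arg_cong [OF *(1), of "\<lambda>M. M $ 1 $ 1"]
      by (simp_all add: adj_nth)
    moreover have "S w $ 2 $ 2 = - S w $ 1 $ 1" using *(2) by (simp add: add_eq_0_iff)
    ultimately show ?thesis
      by (simp add: spin_matrix_def cmat_eq_iff mat22_nth complex_eq_iff)
  qed
  show ?L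
    by (rule exI [of _ "\<lambda>w. Re (S w $ 1 $ 2)"], rule exI [of _ "\<lambda>w. Im (S w $ 1 $ 2)"],
        rule exI [of _ "\<lambda>w. Re (S w $ 1 $ 1)"], rule allI, rule *)
qed

lemma spin_of_algebra:
  assumes "G w \<in> SU2"
  shows "adj (spin_of G w) = spin_of G w" "spin_of G w $ 1 $ 1 + spin_of G w $ 2 $ 2 = 0"
    "spin_of G w ** spin_of G w = mat 1"
proof -
  have s: "adj sigma3 = sigma3" "sigma3 ** sigma3 = mat 1" by (simp_all add: cmat_eq_iff entries)
  show "adj (spin_of G w) = spin_of G w"
    by (simp add: spin_of_def adj_uminus adj_matmul s matrix_mul_assoc)
  have "(adj (G w) ** G w) $ 1 $ 1 = 1" "(adj (G w) ** G w) $ 2 $ 2 = 1"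
    using SU2_unitary(2) [OF assms] by (simp_all add: mat_nth)
  then show "spin_of G w $ 1 $ 1 + spin_of G w $ 2 $ 2 = 0"
    by (simp add: spin_of_def entries algebra_simps)
  have "spin_of G w ** spin_of G w = G w ** sigma3 ** (adj (G w) ** G w) ** sigma3 ** adj (G w)"
    by (simp add: spin_of_def matmul.minus_left matmul.minus_right matrix_mul_assoc)
  also have "\<dots> = G w ** (sigma3 ** sigma3) ** adj (G w)"
    by (simp add: SU2_unitary [OF assms] matrix_mul_assoc)
  finally show "spin_of G w ** spin_of G w = mat 1" by (simp add: s SU2_unitary [OF assms])
qed

lemma ll_solution_spin_of_iff:
  assumes "frame A G" "A e_x = lax_x p q r" "A e_y = lax_y p q r" "Ck 1 q" "Ck 1 r"
  shows "ll_solution k (spin_of G) \<longleftrightarrow> Ck k (spin_of G) \<and> (\<forall>w.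
    A e_t w $ 1 $ 2 = \<i> * (D_zbar q w + 2 * (cnj (p w) * q w)) \<and>
    A e_t w $ 2 $ 1 = - \<i> * (D_zbar r w - 2 * (cnj (p w) * r w)))"
  unfolding ll_solution_def spin_matrix_iff landau_lifshitz_iff [OF assms]
  using spin_of_algebra [of G, OF frame_SU2 [OF assms(1)]] by blast

text \<open>All derivatives of \<open>S\<close> are \<open>G [\<sigma>\<^sub>3, A\<^sub>e] G\<^sup>*\<close>. For the spatial ones \<open>A\<^sub>e\<close> is as smooth as \<open>p, q, r\<close>; for
  \<open>S\<^sub>t\<close> the off-diagonal part of \<open>A\<^sub>t\<close> contains the derivatives of \<open>q\<close> and \<open>r\<close>, and can be recovered from \<open>S\<^sub>t\<close>.\<close>

lemma spin_of_regularity: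
  assumes C: "Ck m p" "Ck m q" "Ck m r" "Ck m u" and m: "1 \<le> m" and G: "frame (lax p q r u) G"
  shows "ll_solution m (spin_of G)" "Ck m (partial_x (spin_of G))" "Ck m (partial_y (spin_of G))"
    "ll_solution (m + 1) (spin_of G) \<longleftrightarrow> Ck m (D_zbar q) \<and> Ck m (D_zbar r)"
proof -
  have C1: "Ck 1 q" "Ck 1 r" using C m by (auto intro: Ck_mono)
  have CA: "Ck (m - 1) (lax p q r u e)" if "e \<in> axes" for e
    by (rule Ck_lax [OF C m that])
  have CG: "Ck m G" using Ck_frame [OF G CA] m by simp
  note ll = ll_solution_spin_of_iff [OF G lax_simps(2,3) C1]
  have S: "Ck m (spin_of G)" unfolding spin_of_def [abs_def] by (intro Ck_rules CG)
  note dS = deriv_along_spin_of [OF G]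
  show "ll_solution m (spin_of G)"
    unfolding ll using S by (simp add: lax_simps lax_t_def entries)
  have Ccomm: "Ck m (\<lambda>w. G w ** commutator sigma3 (f w) ** adj (G w))" if "Ck m f" for f
    unfolding commutator_def by (intro Ck_rules CG that)
  show x: "Ck m (partial_x (spin_of G))" and y: "Ck m (partial_y (spin_of G))"
    unfolding deriv_along_partials(2) [OF dS [OF in_axes(2)]] deriv_along_partials(3) [OF dS [OF in_axes(3)]] lax_simps
    by (intro Ccomm Ck_lax_xy C)+
  have t: "partial_t (spin_of G) = (\<lambda>w. G w ** commutator sigma3 (lax_t p q r u w) ** adj (G w))"
    using deriv_along_partials(1) [OF dS [OF in_axes(1)]] by (simp add: lax_simps)
  have "ll_solution (m + 1) (spin_of G) \<longleftrightarrow> Ck (Suc m) (spin_of G)"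
    unfolding ll by (simp add: lax_simps lax_t_def entries)
  also have "\<dots> \<longleftrightarrow> Ck m (partial_t (spin_of G))"
    using x y Ck_continuous [OF S] Ck_partials(1-3) [OF S m] by (simp add: Ck.simps(2) has_partials_iff)
  also have "\<dots> \<longleftrightarrow> Ck m (D_zbar q) \<and> Ck m (D_zbar r)"
  proof
    assume "Ck m (D_zbar q) \<and> Ck m (D_zbar r)"
    then show "Ck m (partial_t (spin_of G))" unfolding t by (intro Ccomm Ck_lax_t C) auto
  next
    assume *: "Ck m (partial_t (spin_of G))"
    have "adj (G w) ** partial_t (spin_of G) w ** G w = commutator sigma3 (lax_t p q r u w)" for w
    proof -
      have "adj (G w) ** partial_t (spin_of G) w ** G w =
          (adj (G w) ** G w) ** commutator sigma3 (lax_t p q r u w) ** (adj (G w) ** G w)"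
        unfolding t by (simp only: matrix_mul_assoc)
      then show ?thesis by (simp add: SU2_unitary [OF frame_SU2 [OF G]])
    qed
    moreover have "Ck m (\<lambda>w. adj (G w) ** partial_t (spin_of G) w ** G w)"
      by (intro Ck_rules CG *)
    ultimately have c: "Ck m (\<lambda>w. commutator sigma3 (lax_t p q r u w))" by simp
    have "Ck m (\<lambda>w. - (\<i> / 2) * commutator sigma3 (lax_t p q r u w) $ 1 $ 2 - 2 * (cnj (p w) * q w))"
      "Ck m (\<lambda>w. - (\<i> / 2) * commutator sigma3 (lax_t p q r u w) $ 2 $ 1 + 2 * (cnj (p w) * r w))"
      by (intro Ck_rules c C)+
    moreover have "- (\<i> / 2) * commutator sigma3 (lax_t p q r u w) $ 1 $ 2 - 2 * (cnj (p w) * q w) = D_zbar q w"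
      "- (\<i> / 2) * commutator sigma3 (lax_t p q r u w) $ 2 $ 1 + 2 * (cnj (p w) * r w) = D_zbar r w" for w
      by (simp_all add: commutator_def entries lax_t_def algebra_simps)
    ultimately show "Ck m (D_zbar q) \<and> Ck m (D_zbar r)" by simp
  qed
  finally show "ll_solution (m + 1) (spin_of G) \<longleftrightarrow> Ck m (D_zbar q) \<and> Ck m (D_zbar r)" .
qed


section \<open>Lifting a map to the sphere to SU(2)\<close>

text \<open>Hermitian and trace free, that is, a point of \<open>\<real>\<^sup>3\<close>.\<close>

definition spin_like :: "cmat \<Rightarrow> bool" where
  "spin_like S \<longleftrightarrow> adj S = S \<and> S $ 1 $ 1 + S $ 2 $ 2 = 0"

lemma spin_like_cases:
  assumes "spin_like S"
  obtains a b c :: real where "S = spin_matrix a b c"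
proof -
  have "\<forall>w::spacetime. adj S = S \<and> S $ 1 $ 1 + S $ 2 $ 2 = 0"
    using assms by (simp add: spin_like_def)
  then obtain s1 s2 s3 where "\<forall>w::spacetime. S = spin_matrix (s1 w) (s2 w) (s3 w)"
    using spin_matrix_iff [of "\<lambda>w. S"] by blast
  then show ?thesis using that by blast
qed

lemma spin_square:
  assumes "spin_matrix a b c ** spin_matrix a b c = mat 1"
  shows "a\<^sup>2 + b\<^sup>2 + c\<^sup>2 = 1"
proof -
  have "(spin_matrix a b c ** spin_matrix a b c) $ 1 $ 1 = 1" by (simp add: assms mat_nth)
  then have "complex_of_real (a\<^sup>2 + b\<^sup>2 + c\<^sup>2) = 1"
    by (simp add: spin_matrix_def entries complex_eq_iff power2_eq_square algebra_simps)
  then show ?thesis by (metis of_real_eq_1_iff)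
qed

text \<open>Transitivity of \<open>SU(2)\<close> on the sphere. Away from \<open>c = - 1\<close> the lift is chosen with a positive upper
  right entry, which degenerates at that pole.\<close>

lemma spin_matrix_lift:
  assumes "spin_like S" "S ** S = mat 1"
  shows "\<exists>g\<in>SU2. S = - (g ** sigma3 ** adj g)"
proof -
  obtain a b c where S: "S = spin_matrix a b c" using spin_like_cases [OF assms(1)] .
  have n: "a\<^sup>2 + b\<^sup>2 + c\<^sup>2 = 1" using assms(2) unfolding S by (rule spin_square)
  have "\<exists>\<alpha> \<beta> :: complex. \<alpha> * cnj \<alpha> + \<beta> * cnj \<beta> = 1 \<and> \<beta> * cnj \<beta> - \<alpha> * cnj \<alpha> = of_real c
      \<and> 2 * \<alpha> * \<beta> = of_real a + \<i> * of_real b"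
  proof (cases "c = - 1")
    case True
    then have "a = 0 \<and> b = 0" using n by (simp add: sum_power2_eq_zero_iff)
    then show ?thesis using True by (intro exI [of _ 1] exI [of _ 0]) simp
  next
    case False
    have "c\<^sup>2 \<le> 1" using n by (smt (verit) zero_le_power2)
    then have "- 1 \<le> c" by (simp add: abs_square_le_1 abs_le_iff)
    then have c: "0 < 1 + c" using False by simp
    define \<beta> where "\<beta> = sqrt ((1 + c) / 2)"
    have \<beta>: "\<beta> > 0" "\<beta>\<^sup>2 = (1 + c) / 2" using c by (simp_all add: \<beta>_def)
    define \<alpha> where "\<alpha> = (of_real a + \<i> * of_real b) / (2 * of_real \<beta> :: complex)"
    have "\<alpha> * cnj \<alpha> = of_real ((a\<^sup>2 + b\<^sup>2) / (4 * \<beta>\<^sup>2))"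
      using \<beta>(1) by (simp add: \<alpha>_def complex_eq_iff power2_eq_square field_simps)
    also have "(a\<^sup>2 + b\<^sup>2) / (4 * \<beta>\<^sup>2) = (1 - c) / 2"
    proof -
      have "a\<^sup>2 + b\<^sup>2 = (1 - c) * (1 + c)" using n by (simp add: power2_eq_square algebra_simps)
      moreover have "4 * \<beta>\<^sup>2 = 2 * (1 + c)" by (simp add: \<beta>(2))
      ultimately have "(a\<^sup>2 + b\<^sup>2) / (4 * \<beta>\<^sup>2) = ((1 - c) * (1 + c)) / (2 * (1 + c))" by (simp only:)
      also have "\<dots> = (1 - c) / 2"
        by (rule mult_divide_mult_cancel_right) (use c in simp)
      finally show ?thesis .
    qed
    finally have "\<alpha> * cnj \<alpha> = of_real ((1 - c) / 2)" .
    moreover have "complex_of_real \<beta> * cnj (of_real \<beta>) = of_real ((1 + c) / 2)"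
      unfolding \<beta>(2) [symmetric] by (simp add: power2_eq_square)
    moreover have "2 * \<alpha> * of_real \<beta> = of_real a + \<i> * of_real b"
      using \<beta>(1) by (simp add: \<alpha>_def)
    ultimately show ?thesis
      by (intro exI [of _ \<alpha>] exI [of _ "of_real \<beta>"]) (auto simp: complex_eq_iff field_simps)
  qed
  then obtain \<alpha> \<beta> where ab: "\<alpha> * cnj \<alpha> + \<beta> * cnj \<beta> = 1" "\<beta> * cnj \<beta> - \<alpha> * cnj \<alpha> = of_real c"
    "2 * \<alpha> * \<beta> = of_real a + \<i> * of_real b" by blast
  have ab4: "2 * cnj \<alpha> * cnj \<beta> = of_real a - \<i> * of_real b"
    using arg_cong [OF ab(3), of cnj] by simp
  define g where "g = mat22 \<alpha> \<beta> (- cnj \<beta>) (cnj \<alpha>)"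
  have "g \<in> SU2"
    using ab(1) by (simp add: SU2_iff g_def cmat_eq_iff entries det_2 algebra_simps)
  moreover have "S = - (g ** sigma3 ** adj g)"
    using ab(2) ab(3) ab4
    by (simp add: S g_def spin_matrix_def cmat_eq_iff entries algebra_simps)
  ultimately show ?thesis by blast
qed

text \<open>A multiple of the triple product of the three vectors, hence the area form of the sphere when
  \<open>X\<close> and \<open>T\<close> are tangent at \<open>S\<close>.\<close>

definition curvature :: "cmat \<Rightarrow> cmat \<Rightarrow> cmat \<Rightarrow> real" where
  "curvature S X T = Re (\<i> / 8 * ((S ** commutator X T) $ 1 $ 1 + (S ** commutator X T) $ 2 $ 2))"

text \<open>The cross product of two tangent vectors is normal to the sphere, hence a multiple of \<open>S\<close>.\<close>

lemma commutator_tangent: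
  assumes S: "spin_like S" "S ** S = mat 1" and X: "spin_like X" "S ** X = - (X ** S)"
    and T: "spin_like T" "S ** T = - (T ** S)"
  shows "cscale (\<i> / 4) (commutator X T) = cscale (of_real (curvature S X T)) S"
proof -
  obtain s1 s2 s3 where s: "S = spin_matrix s1 s2 s3" using spin_like_cases [OF S(1)] .
  obtain x1 x2 x3 where x: "X = spin_matrix x1 x2 x3" using spin_like_cases [OF X(1)] .
  obtain t1 t2 t3 where t: "T = spin_matrix t1 t2 t3" using spin_like_cases [OF T(1)] .
  have n: "s1 * s1 + s2 * s2 + s3 * s3 = 1"
    using spin_square S(2) unfolding s by (simp add: power2_eq_square)
  have "(S ** X) $ 1 $ 1 = (- (X ** S)) $ 1 $ 1" "(S ** T) $ 1 $ 1 = (- (T ** S)) $ 1 $ 1"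
    by (simp_all only: X(2) T(2))
  then have o: "s1 * x1 + s2 * x2 + s3 * x3 = 0" "s1 * t1 + s2 * t2 + s3 * t3 = 0"
    by (simp_all add: s x t spin_matrix_def entries complex_eq_iff algebra_simps)
  define c1 c2 c3 where "c1 = x2 * t3 - x3 * t2" and "c2 = x3 * t1 - x1 * t3" and "c3 = x1 * t2 - x2 * t1"
  define d where "d = s1 * c1 + s2 * c2 + s3 * c3"
  have par: "s2 * c3 = s3 * c2" "s3 * c1 = s1 * c3" "s1 * c2 = s2 * c1"
  proof -
    have "s2 * c3 - s3 * c2 = x1 * (s1 * t1 + s2 * t2 + s3 * t3) - t1 * (s1 * x1 + s2 * x2 + s3 * x3)"
      "s3 * c1 - s1 * c3 = x2 * (s1 * t1 + s2 * t2 + s3 * t3) - t2 * (s1 * x1 + s2 * x2 + s3 * x3)"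
      "s1 * c2 - s2 * c1 = x3 * (s1 * t1 + s2 * t2 + s3 * t3) - t3 * (s1 * x1 + s2 * x2 + s3 * x3)"
      unfolding c1_def c2_def c3_def by (simp_all add: algebra_simps)
    then show "s2 * c3 = s3 * c2" "s3 * c1 = s1 * c3" "s1 * c2 = s2 * c1" by (simp_all add: o)
  qed
  have "c1 = (s1 * s1 + s2 * s2 + s3 * s3) * c1" by (simp add: n)
  also have "\<dots> = s1 * (s1 * c1) + s2 * (s2 * c1) + s3 * (s3 * c1)" by (simp add: algebra_simps)
  also have "\<dots> = d * s1" unfolding par(2) par(3) [symmetric] d_def by (simp add: algebra_simps)
  finally have 1: "c1 = d * s1" .
  have "c2 = (s1 * s1 + s2 * s2 + s3 * s3) * c2" by (simp add: n)
  also have "\<dots> = s1 * (s1 * c2) + s2 * (s2 * c2) + s3 * (s3 * c2)" by (simp add: algebra_simps)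
  also have "\<dots> = d * s2" unfolding par(3) par(1) [symmetric] d_def by (simp add: algebra_simps)
  finally have 2: "c2 = d * s2" .
  have "c3 = (s1 * s1 + s2 * s2 + s3 * s3) * c3" by (simp add: n)
  also have "\<dots> = s1 * (s1 * c3) + s2 * (s2 * c3) + s3 * (s3 * c3)" by (simp add: algebra_simps)
  also have "\<dots> = d * s3" unfolding par(1) par(2) [symmetric] d_def by (simp add: algebra_simps)
  finally have 3: "c3 = d * s3" .
  have comm: "commutator X T = cscale (- 2 * \<i>) (spin_matrix c1 c2 c3)"
    by (simp add: commutator_def x t spin_matrix_def cmat_eq_iff entries c1_def c2_def c3_def
        complex_eq_iff algebra_simps)
  have "curvature S X T = d / 2"
    unfolding curvature_def comm
    by (simp add: s spin_matrix_def entries d_def algebra_simps)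
  moreover have "spin_matrix c1 c2 c3 = cscale (of_real d) S"
    by (simp add: s spin_matrix_def cmat_eq_iff entries 1 2 3 algebra_simps)
  moreover have "cscale (\<i> / 4) (cscale (- 2 * \<i>) (cscale (of_real d) S)) = cscale (of_real (d / 2)) S"
    by (simp add: cmat_eq_iff entries)
  ultimately show ?thesis unfolding comm by (simp only:)
qed

text \<open>With \<open>K\<^sub>e = S\<^sub>e S / 2 + \<i> \<alpha>\<^sub>e S\<close>, this is flatness of \<open>- K\<close> between a direction with derivative \<open>T\<close> and \<open>\<alpha> = 0\<close>, and a
  direction with derivative \<open>X\<close>. Here \<open>M\<close> is the mixed second derivative, and the condition on \<open>\<alpha>'\<close>,
  the derivative of \<open>\<alpha>\<close> along the first direction, is that it cancels the curvature.\<close>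

lemma lift_flatness:
  assumes S: "S ** S = mat 1" and X: "S ** X = - (X ** S)" and T: "S ** T = - (T ** S)"
    and \<alpha>': "cscale (\<i> / 4) (commutator X T) = cscale \<alpha>' S"
  shows "- (cscale (1/2) (M ** S + T ** X))
      + (cscale (1/2) (X ** S) + cscale (\<i> * \<alpha>) S) ** (cscale (1/2) (T ** S)) =
    - (cscale (1/2) (M ** S + X ** T) + (cscale (\<i> * \<alpha>') S + cscale (\<i> * \<alpha>) T))
      + cscale (1/2) (T ** S) ** (cscale (1/2) (X ** S) + cscale (\<i> * \<alpha>) S)"
proof -
  have sc: "cscale c A ** B = cscale c (A ** B)" "A ** cscale c B = cscale c (A ** B)" for c A B
    by (simp_all add: cmat_eq_iff entries algebra_simps)
  have 1: "S ** (T ** S) = - T"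
    using S by (simp add: matrix_mul_assoc T matmul.minus_left) (simp add: matrix_mul_assoc [symmetric] S)
  have 2: "(X ** S) ** (T ** S) = - (X ** T)"
    using 1 by (simp add: matrix_mul_assoc [symmetric] matmul.minus_right)
  have 3: "S ** (X ** S) = - X"
    using S by (simp add: matrix_mul_assoc X matmul.minus_left) (simp add: matrix_mul_assoc [symmetric] S)
  have 4: "(T ** S) ** (X ** S) = - (T ** X)"
    using 3 by (simp add: matrix_mul_assoc [symmetric] matmul.minus_right)
  have 5: "(T ** S) ** S = T" by (simp add: matrix_mul_assoc [symmetric] S)
  have a: "cscale (\<i> * \<alpha>') S = cscale (- 1 / 4) (X ** T - T ** X)"
  proof -
    have "cscale (\<i> * \<alpha>') S = cscale \<i> (cscale (\<i> / 4) (commutator X T))"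
      unfolding \<alpha>' by (simp add: cmat_eq_iff entries)
    also have "\<dots> = cscale (- 1 / 4) (X ** T - T ** X)"
      by (simp add: commutator_def cmat_eq_iff cscale_nth field_simps)
    finally show ?thesis .
  qed
  show ?thesis
    unfolding matmul.add_left matmul.add_right sc 1 2 4 5 a
    by (simp add: cmat_eq_iff cscale_nth field_simps)
qed

lemma trace_matmul_commute: "(P ** Q) $ 1 $ 1 + (P ** Q) $ 2 $ 2 = (Q ** P) $ 1 $ 1 + (Q ** P :: cmat) $ 2 $ 2"
  for P Q :: cmat
  by (simp add: entries algebra_simps)

lemma su2_conjugate:
  assumes "H \<in> SU2" "X \<in> su2"
  shows "H ** X ** adj H \<in> su2"
proof -
  have "adj (H ** X ** adj H) = - (H ** X ** adj H)"
    using assms(2) by (simp add: su2_def adj_matmul matmul.minus_left matmul.minus_right matrix_mul_assoc)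
  moreover have "(H ** X ** adj H) $ 1 $ 1 + (H ** X ** adj H) $ 2 $ 2 = X $ 1 $ 1 + X $ 2 $ 2"
    using trace_matmul_commute [of "H ** X" "adj H"]
    by (simp add: matrix_mul_assoc SU2_unitary [OF assms(1)])
  ultimately show ?thesis using assms(2) by (simp add: su2_def)
qed

lemma lift_connection_su2:
  assumes "spin_like S" "spin_like X" "S ** X = - (X ** S)"
  shows "- (cscale (1/2) (X ** S) + cscale \<i> (a *\<^sub>R S)) \<in> su2"
proof -
  let ?K = "cscale (1/2) (X ** S) + cscale \<i> (a *\<^sub>R S)"
  have aS: "adj S = S" "S $ 1 $ 1 + S $ 2 $ 2 = 0" using assms(1) by (auto simp: spin_like_def)
  have aXS: "adj (X ** S) = - (X ** S)"
    using assms by (simp add: spin_like_def adj_matmul)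
  have tr: "(X ** S) $ 1 $ 1 + (X ** S) $ 2 $ 2 = 0"
  proof -
    have "(X ** S) $ 1 $ 1 + (X ** S) $ 2 $ 2 = - ((X ** S) $ 1 $ 1 + (X ** S) $ 2 $ 2)"
      using trace_matmul_commute [of X S] unfolding assms(3) by simp
    then show ?thesis by (simp add: complex_eq_iff)
  qed
  have "adj (- ?K) = - (cscale (1/2) (adj (X ** S)) + cscale (- \<i>) (a *\<^sub>R adj S))"
    by (simp add: cmat_eq_iff adj_nth cscale_nth)
  also have "\<dots> = - (- ?K)" unfolding aS aXS by (simp add: cmat_eq_iff cscale_nth)
  finally have "adj (- ?K) = - (- ?K)" .
  moreover have "(- ?K) $ 1 $ 1 + (- ?K) $ 2 $ 2 =
      - (1/2 * ((X ** S) $ 1 $ 1 + (X ** S) $ 2 $ 2) + \<i> * a * (S $ 1 $ 1 + S $ 2 $ 2))"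
    unfolding uminus_vec_def vec_lambda_beta vector_add_component cscale_nth vector_scaleR_component
    by (simp add: scaleR_conv_of_real algebra_simps)
  ultimately show ?thesis unfolding su2_def by (simp only: tr aS mem_Collect_eq) simp
qed

lemma deriv_along_scaleR:
  "deriv_along e f f' \<Longrightarrow> deriv_along e g g' \<Longrightarrow> deriv_along e (\<lambda>w. f w *\<^sub>R g w) (\<lambda>w. f w *\<^sub>R g' w + f' w *\<^sub>R g w)"
  by (rule deriv_along_bilinear [OF bounded_bilinear_scaleR])

lemma Ck_scaleR: "Ck k f \<Longrightarrow> Ck k g \<Longrightarrow> Ck k (\<lambda>w. f w *\<^sub>R g w)"
  by (rule Ck_bilinear [OF bounded_bilinear_scaleR])

lemma cscale_add: "cscale c (X + Y) = cscale c X + cscale c Y"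
  by (simp add: cmat_eq_iff cscale_nth algebra_simps)

lemma cscale_zero: "cscale c 0 = 0"
  by (simp add: cmat_eq_iff cscale_nth)

lemma deriv_along_primitive_axis:
  assumes "Ck 1 f" "e \<in> axes"
  shows "deriv_along e (primitive_along e f) f"
proof -
  obtain f' where "deriv_along e f f'" "Ck (1 - 1) f'"
    by (rule Ck_deriv_along [OF assms(1) order_refl assms(2)])
  then show ?thesis
    using deriv_along_primitive [OF _ Ck_continuous [OF assms(1)]] axes_inner [OF assms(2,2)] by simp
qed

text \<open>The connection of \<open>lift_flatness\<close> acts from the left, \<open>G\<^sub>e = K\<^sub>e G\<close>; its adjoint is a frame for
  \<open>B = - K\<close>. The coefficient \<open>\<alpha>\<close> vanishes in the direction \<open>t\<close>, and in the direction \<open>x\<close> on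
  \<open>t = 0\<close>. Flatness then prescribes the \<open>t\<close>-derivatives of the other two coefficients
  everywhere, and one more derivative inside \<open>t = 0\<close>, so that plain integrals along axes, which
  do not lose smoothness, give \<open>\<alpha>\<close>. Since \<open>S\<^sub>e = [K\<^sub>e, S]\<close>, the matrix \<open>G\<^sup>* S G\<close> is constant.\<close>

theorem sphere_map_lift:
  assumes C: "Ck (Suc k) S" "1 \<le> k" and sp: "\<And>w. spin_like (S w)" and sq: "\<And>w. S w ** S w = mat 1"
    and g0: "g0 \<in> SU2" "S (0, 0, 0) = - (g0 ** sigma3 ** adj g0)"
  shows "\<exists>A G. frame A G \<and> G (0, 0, 0) = g0 \<and> (\<forall>e\<in>axes. Ck k (A e) \<and> (\<forall>w. A e w \<in> su2)) \<and> S = spin_of G"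
proof -
  have Sk: "Ck k S" by (rule Ck_SucD [OF C(1)])
  have C2: "Ck 2 S" using C by (intro Ck_mono [OF C(1)]) simp
  obtain D where D: "\<And>e. e \<in> axes \<Longrightarrow> deriv_along e S (D e)" "\<And>e. e \<in> axes \<Longrightarrow> Ck k (D e)"
    using C(1) unfolding Ck_Suc_iff by metis
  have "\<forall>e\<in>axes. \<forall>e'\<in>axes. \<exists>M. deriv_along e' (D e) M"
    using Ck_deriv_along [OF D(2) C(2)] by metis
  then obtain M where M: "\<And>e e'. e \<in> axes \<Longrightarrow> e' \<in> axes \<Longrightarrow> deriv_along e' (D e) (M e e')"
    by metis
  have Mc: "M e e' = M e' e" if "e \<in> axes" "e' \<in> axes" for e e'
    by (rule Ck2_mixed_derivatives_commute
        [OF C2 that D(1) [OF that(1)] D(1) [OF that(2)] M [OF that] M [OF that(2,1)]])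
  have SD: "S w ** D e w = - (D e w ** S w)" if "e \<in> axes" for e w
  proof -
    have "deriv_along e (\<lambda>w. S w ** S w) (\<lambda>w. S w ** D e w + D e w ** S w)"
      using D(1) [OF that] by (intro deriv_along_matmul)
    then have "deriv_along e (\<lambda>w. mat 1) (\<lambda>w. S w ** D e w + D e w ** S w)" by (simp only: sq)
    from deriv_along_unique [OF this deriv_along_const]
    have "S w ** D e w + D e w ** S w = 0" by (rule fun_cong)
    then show ?thesis by (simp add: eq_neg_iff_add_eq_0)
  qed
  have spD: "spin_like (D e w)" if e: "e \<in> axes" for e w
  proof -
    have "deriv_along e (\<lambda>w. adj (S w)) (D e)"
      using D(1) [OF e] sp by (simp add: spin_like_def)
    from deriv_along_unique [OF deriv_along_adj [OF D(1) [OF e]] this]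
    have 1: "adj (D e w) = D e w" by (rule fun_cong)
    have "deriv_along e (\<lambda>w. S w $ 1 $ 1 + S w $ 2 $ 2) (\<lambda>w. D e w $ 1 $ 1 + D e w $ 2 $ 2)"
      by (intro deriv_along_add deriv_along_entry D(1) e)
    then have "deriv_along e (\<lambda>w. 0) (\<lambda>w. D e w $ 1 $ 1 + D e w $ 2 $ 2)"
      using sp by (simp add: spin_like_def)
    from deriv_along_unique [OF this deriv_along_const]
    have "D e w $ 1 $ 1 + D e w $ 2 $ 2 = 0" by (rule fun_cong)
    with 1 show ?thesis by (simp add: spin_like_def)
  qed
  define \<kappa> where "\<kappa> e e' w = curvature (S w) (D e w) (D e' w)" for e e' w
  have C\<kappa>: "Ck k (\<kappa> e e')" if "e \<in> axes" "e' \<in> axes" for e e'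
    unfolding \<kappa>_def [abs_def] curvature_def commutator_def by (intro Ck_rules Sk D that)
  (* The first term prescribes the t-derivative, the second one the x-derivative on t = 0. *)
  define \<alpha> where "\<alpha> e = (if e = e_t then (\<lambda>w. 0) else if e = e_x then primitive_along e_t (\<kappa> e_x e_t)
    else (\<lambda>w. primitive_along e_t (\<kappa> e_y e_t) w + restrict_along e_t (primitive_along e_x (\<kappa> e_y e_x)) w))" for e
  have \<alpha>: "\<alpha> e_t = (\<lambda>w. 0)" "\<alpha> e_x = primitive_along e_t (\<kappa> e_x e_t)"
    "\<alpha> e_y = (\<lambda>w. primitive_along e_t (\<kappa> e_y e_t) w + restrict_along e_t (primitive_along e_x (\<kappa> e_y e_x)) w)"
    by (simp_all add: \<alpha>_def)
  have C\<alpha>: "Ck k (\<alpha> e)" if "e \<in> axes" for e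
    using that unfolding axes_def
    by (elim insertE emptyE; simp only: \<alpha>; intro Ck_const Ck_add Ck_restrict_along Ck_primitive_along C\<kappa> in_axes)
  define B where "B e w = - (cscale (1/2) (D e w ** S w) + cscale \<i> (\<alpha> e w *\<^sub>R S w))" for e w
  have CB: "Ck k (B e)" if "e \<in> axes" for e
    unfolding B_def [abs_def] by (intro Ck_rules Ck_scaleR C\<alpha> D Sk that)
  have suB: "B e w \<in> su2" if "e \<in> axes" for e w
    unfolding B_def by (rule lift_connection_su2 [OF sp spD SD]) (rule that)+
  have flat: "flat_at B e e' w"
    if e: "e \<in> axes" "e' \<in> axes" and \<beta>: "deriv_along e' (\<alpha> e) \<beta>" "\<alpha> e w = 0" "\<beta> w = 0"
      and \<alpha>': "deriv_along e (\<alpha> e') \<alpha>'" "\<alpha>' w = \<kappa> e' e w" for e e' w \<beta> \<alpha>'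
  proof -
    have 1: "deriv_along e' (B e) (\<lambda>w. - (cscale (1/2) (D e w ** D e' w + M e e' w ** S w)
        + cscale \<i> (\<alpha> e w *\<^sub>R D e' w + \<beta> w *\<^sub>R S w)))"
      unfolding B_def [abs_def]
      by (intro deriv_along_minus deriv_along_add deriv_along_cscale deriv_along_matmul deriv_along_scaleR D M e \<beta>)
    have 2: "deriv_along e (B e') (\<lambda>w. - (cscale (1/2) (D e' w ** D e w + M e' e w ** S w)
        + cscale \<i> (\<alpha> e' w *\<^sub>R D e w + \<alpha>' w *\<^sub>R S w)))"
      unfolding B_def [abs_def]
      by (intro deriv_along_minus deriv_along_add deriv_along_cscale deriv_along_matmul deriv_along_scaleR D M e \<alpha>')
    have sc: "cscale \<i> (a *\<^sub>R X) = cscale (\<i> * of_real a) X" for a X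
      unfolding cmat_eq_iff cscale_nth vector_scaleR_component by (simp add: scaleR_conv_of_real)
    have "cscale (\<i> / 4) (commutator (D e' w) (D e w)) = cscale (of_real (\<alpha>' w)) (S w)"
      unfolding \<alpha>'(2) \<kappa>_def by (rule commutator_tangent [OF sp sq spD SD spD SD]) (rule e)+
    note lift = lift_flatness [OF sq SD SD this, OF e(2,1), of "M e e' w" "of_real (\<alpha> e' w)"]
    have Be: "B e w = - cscale (1/2) (D e w ** S w)"
      by (simp add: B_def \<beta>(2) cscale_zero)
    have Be': "B e' w = - (cscale (1/2) (D e' w ** S w) + cscale (\<i> * of_real (\<alpha> e' w)) (S w))"
      by (simp only: B_def sc)
    show ?thesis
      unfolding flat_at_iff [OF 1 2] Mc [OF e] Be Be' matmul.minus_left matmul.minus_right minus_minus \<beta>(2,3)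
      using lift by (simp add: sc cscale_add cscale_zero Mc [OF e] add_ac)
  qed
  have C1: "Ck 1 (\<kappa> e e')" if "e \<in> axes" "e' \<in> axes" for e e'
    using C\<kappa> [OF that] C(2) by (rule Ck_mono)
  have cont: "continuous_on UNIV (\<kappa> e e')" if "e \<in> axes" "e' \<in> axes" for e e'
    using C\<kappa> [OF that] by (rule Ck_continuous)
  have prim: "deriv_along e'' (primitive_along e'' (\<kappa> e e')) (\<kappa> e e')"
    if "e \<in> axes" "e' \<in> axes" "e'' \<in> axes" for e e' e''
    using deriv_along_primitive_axis [OF C1] that by blast
  have \<alpha>t: "deriv_along e_t (\<alpha> e_x) (\<kappa> e_x e_t)" "deriv_along e_t (\<alpha> e_y) (\<lambda>w. \<kappa> e_y e_t w + 0)"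
    unfolding \<alpha> by (intro deriv_along_add prim deriv_along_restrict in_axes; simp)+
  have ft: "flat_at B e_t e_x w" "flat_at B e_t e_y w" for w
    by (rule flat [OF _ _ _ _ _ \<alpha>t(1)]; simp add: \<alpha> in_axes deriv_along_const)
      (rule flat [OF _ _ _ _ _ \<alpha>t(2)]; simp add: \<alpha> in_axes deriv_along_const)
  have fx: "flat_at B e_x e_y w" if w: "w \<bullet> e_t = 0" for w
  proof -
    obtain a where a: "deriv_along e_y (\<kappa> e_x e_t) a" "Ck 0 a"
      by (rule Ck_deriv_along [OF C1 [OF in_axes(2,1)] _ in_axes(3)]) auto
    obtain b where b: "deriv_along e_x (\<kappa> e_y e_t) b" "Ck 0 b"
      by (rule Ck_deriv_along [OF C1 [OF in_axes(3,1)] _ in_axes(2)]) auto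
    have 1: "deriv_along e_y (\<alpha> e_x) (primitive_along e_t a)"
      unfolding \<alpha> using a by (intro deriv_along_primitive_orthogonal cont in_axes) auto
    have 2: "deriv_along e_x (\<alpha> e_y) (\<lambda>w. primitive_along e_t b w + restrict_along e_t (\<kappa> e_y e_x) w)"
      unfolding \<alpha> using b
      by (intro deriv_along_add deriv_along_primitive_orthogonal deriv_along_restrict_orthogonal prim cont in_axes) auto
    show ?thesis
      by (rule flat [OF in_axes(2,3) 1 _ _ 2])
        (use w in \<open>simp_all add: \<alpha> primitive_along_zero restrict_along_def zero_prod_def [symmetric]\<close>)
  qed
  have "\<exists>H. H (0, 0, 0) = adj g0 \<and> (\<forall>w. H w \<in> SU2) \<and> (\<forall>e\<in>axes. deriv_along e H (\<lambda>w. H w ** B e w))"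
    by (rule flat_connection_integrable) (rule ft fx suB SU2_adj g0 Ck_mono [OF CB C(2)], assumption?)+
  then obtain H where H0: "H (0, 0, 0) = adj g0" and H: "frame B H"
    unfolding frame_def by blast
  define G where "G w = adj (H w)" for w
  define A where "A e w = H w ** (- B e w) ** adj (H w)" for e w
  have CH: "Ck k H" using Ck_SucD [OF Ck_frame [OF H CB]] .
  have "frame A G"
    unfolding frame_def
  proof (intro conjI allI ballI)
    show "G w \<in> SU2" for w unfolding G_def by (intro SU2_adj frame_SU2 [OF H])
    fix e assume e: "e \<in> axes"
    have "G w ** A e w = adj (H w ** B e w)" for w
      by (simp add: G_def A_def adj_matmul frame_skew [OF H e] matrix_mul_assoc SU2_unitary [OF frame_SU2 [OF H]])
    then show "deriv_along e G (\<lambda>w. G w ** A e w)"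
      using deriv_along_adj [OF frame_deriv [OF H e]] by (simp add: G_def [abs_def])
  qed
  moreover have "Ck k (A e)" "A e w \<in> su2" if "e \<in> axes" for e w
  proof -
    show "Ck k (A e)" unfolding A_def [abs_def] by (intro Ck_rules CH CB that)
    have "- B e w \<in> su2" using suB [OF that, of w] by (simp add: su2_entries)
    then show "A e w \<in> su2" unfolding A_def by (rule su2_conjugate [OF frame_SU2 [OF H]])
  qed
  moreover have "S = spin_of G"
  proof
    fix w
    have "deriv_along e (\<lambda>w. H w ** S w ** adj (H w)) (\<lambda>w. 0)" if e: "e \<in> axes" for e
    proof -
      have "D e w + commutator (B e w) (S w) = 0" for w
      proof -
        let ?K = "cscale (1/2) (D e w ** S w) + cscale \<i> (\<alpha> e w *\<^sub>R S w)"
        have 1: "D e w ** S w ** S w = D e w" by (simp add: matrix_mul_assoc [symmetric] sq)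
        have 2: "S w ** (D e w ** S w) = - D e w"
          by (simp add: matrix_mul_assoc SD [OF e] matmul.minus_left) (simp add: matrix_mul_assoc [symmetric] sq)
        have sc: "cscale c X ** Y = cscale c (X ** Y)" "X ** cscale c Y = cscale c (X ** Y)" for c X Y
          by (simp_all add: cmat_eq_iff entries algebra_simps)
        have KS: "?K ** S w = cscale (1/2) (D e w) + cscale \<i> (\<alpha> e w *\<^sub>R mat 1)"
          by (simp only: matmul.add_left sc matmul.scaleR_left 1 sq)
        have SK: "S w ** ?K = cscale (1/2) (- D e w) + cscale \<i> (\<alpha> e w *\<^sub>R mat 1)"
          by (simp only: matmul.add_right sc matmul.scaleR_right 2 sq)
        show ?thesis
          unfolding commutator_def B_def matmul.minus_left matmul.minus_right KS SK
          by (simp add: cmat_eq_iff cscale_nth)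
      qed
      then show ?thesis using deriv_along_conjugate [OF H e D(1) [OF e]] by simp
    qed
    from constant_of_zero_derivatives [OF this]
    have "H w ** S w ** adj (H w) = adj g0 ** S (0, 0, 0) ** g0" by (simp add: H0)
    also have "\<dots> = - ((adj g0 ** g0) ** sigma3 ** (adj g0 ** g0))"
      unfolding g0(2) by (simp only: matmul.minus_left matmul.minus_right matrix_mul_assoc)
    also have "\<dots> = - sigma3" by (simp add: SU2_unitary [OF g0(1)])
    finally have *: "H w ** S w ** adj (H w) = - sigma3" .
    have "S w = (adj (H w) ** H w) ** S w ** (adj (H w) ** H w)"
      by (simp add: SU2_unitary [OF frame_SU2 [OF H]])
    also have "\<dots> = adj (H w) ** (H w ** S w ** adj (H w)) ** H w" by (simp only: matrix_mul_assoc)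
    also have "\<dots> = spin_of G w" unfolding * spin_of_conjugate G_def by simp
    finally show "S w = spin_of G w" .
  qed
  moreover have "G (0, 0, 0) = g0" by (simp add: G_def H0)
  ultimately show ?thesis by blast
qed


section \<open>From the Landau-Lifshitz equation to the Schroedinger system\<close>

text \<open>The potentials read off from a connection: \<open>p, q, r\<close> are entries of
  \<open>U = - (A\<^sub>x - \<i> A\<^sub>y)\<close> and \<open>- \<i> u\<close> is the upper left entry of \<open>A\<^sub>t\<close>.\<close>

definition conn_p where "conn_p A w = - (A e_x w - cscale \<i> (A e_y w) :: cmat) $ 1 $ 1"
definition conn_q where "conn_q A w = - (A e_x w - cscale \<i> (A e_y w) :: cmat) $ 1 $ 2"
definition conn_r where "conn_r A w = - (A e_x w - cscale \<i> (A e_y w) :: cmat) $ 2 $ 1"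
definition conn_u where "conn_u A w = - Im ((A e_t w :: cmat) $ 1 $ 1)"

lemma conn_lax_xy:
  assumes "A e_x w \<in> su2" "A e_y w \<in> su2"
  shows "lax_x (conn_p A) (conn_q A) (conn_r A) w = A e_x w" "lax_y (conn_p A) (conn_q A) (conn_r A) w = A e_y w"
proof -
  have sk: "adj (A e_x w) = - A e_x w" "adj (A e_y w) = - A e_y w"
    and tr: "A e_x w $ 2 $ 2 = - A e_x w $ 1 $ 1" "A e_y w $ 2 $ 2 = - A e_y w $ 1 $ 1"
    using assms by (auto simp: su2_def add_eq_0_iff)
  have U: "U_matrix (conn_p A) (conn_q A) (conn_r A) w = cscale \<i> (A e_y w) - A e_x w"
    by (simp add: U_matrix_def conn_p_def conn_q_def conn_r_def cmat_eq_iff mat22_nth cscale_nth tr)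
  have "adj (U_matrix (conn_p A) (conn_q A) (conn_r A) w) = cscale (- \<i>) (adj (A e_y w)) - adj (A e_x w)"
    unfolding U by (simp add: cmat_eq_iff adj_nth cscale_nth)
  then have V: "adj (U_matrix (conn_p A) (conn_q A) (conn_r A) w) = cscale \<i> (A e_y w) + A e_x w"
    unfolding sk by (simp add: cmat_eq_iff cscale_nth)
  show "lax_x (conn_p A) (conn_q A) (conn_r A) w = A e_x w" "lax_y (conn_p A) (conn_q A) (conn_r A) w = A e_y w"
    unfolding lax_x_def lax_y_def V unfolding U by (simp_all add: cmat_eq_iff cscale_nth field_simps)
qed

text \<open>Every lift of a Landau-Lifshitz solution is a frame of a Lax connection: the spatial part of the
  connection is of Lax form anyway, and the equation forces the form of the \<open>t\<close>-component.\<close>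

lemma ll_frame_imp_nls:
  assumes m: "2 \<le> m" and ll: "ll_solution (m + 1) (spin_of G)" and G: "frame A G"
    and A: "\<And>e. e \<in> axes \<Longrightarrow> Ck m (A e)" "\<And>e w. e \<in> axes \<Longrightarrow> A e w \<in> su2"
  shows "nls_solution m (conn_p A) (conn_q A) (conn_r A) (conn_u A)"
    "nls_restrictions (conn_p A) (conn_q A) (conn_r A)"
    "gauge_transformation G (conn_p A) (conn_q A) (conn_r A) (conn_u A) (spin_of G)"
    "frame (lax (conn_p A) (conn_q A) (conn_r A) (conn_u A)) G"
proof -
  note A' = A(1) [OF in_axes(1)] A(1) [OF in_axes(2)] A(1) [OF in_axes(3)]
  have C: "Ck m (conn_p A)" "Ck m (conn_q A)" "Ck m (conn_r A)" "Ck m (conn_u A)"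
    unfolding conn_p_def [abs_def] conn_q_def [abs_def] conn_r_def [abs_def] conn_u_def [abs_def]
    by (intro Ck_rules A')+
  have m1: "1 \<le> m" using m by simp
  have C1: "Ck 1 (conn_q A)" "Ck 1 (conn_r A)"
    using Ck_mono [OF C(2) m1] Ck_mono [OF C(3) m1] .
  have xy: "A e_x = lax_x (conn_p A) (conn_q A) (conn_r A)" "A e_y = lax_y (conn_p A) (conn_q A) (conn_r A)"
    using conn_lax_xy [OF A(2) A(2), OF in_axes(2,3)] by auto
  have t: "A e_t = lax_t (conn_p A) (conn_q A) (conn_r A) (conn_u A)"
  proof
    fix w
    have off: "A e_t w $ 1 $ 2 = \<i> * (D_zbar (conn_q A) w + 2 * (cnj (conn_p A w) * conn_q A w))"
      "A e_t w $ 2 $ 1 = - \<i> * (D_zbar (conn_r A) w - 2 * (cnj (conn_p A w) * conn_r A w))"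
      using ll ll_solution_spin_of_iff [OF G xy C1] by blast+
    have "Re (A e_t w $ 1 $ 1) = 0" "A e_t w $ 2 $ 2 = - A e_t w $ 1 $ 1"
      using A(2) [OF in_axes(1), of w] by (simp_all add: su2_entries)
    then show "A e_t w = lax_t (conn_p A) (conn_q A) (conn_r A) (conn_u A) w"
      by (simp add: cmat_eq_iff lax_t_def mat22_nth off) (simp add: conn_u_def complex_eq_iff)
  qed
  have "\<forall>e\<in>axes. lax (conn_p A) (conn_q A) (conn_r A) (conn_u A) e = A e"
    unfolding axes_def by (simp add: lax_simps t xy)
  then show L: "frame (lax (conn_p A) (conn_q A) (conn_r A) (conn_u A)) G"
    using G unfolding frame_def by simp
  show "nls_solution m (conn_p A) (conn_q A) (conn_r A) (conn_u A)"
    "nls_restrictions (conn_p A) (conn_q A) (conn_r A)"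
    by (rule frame_imp_nls [OF m C L])+
  have "Ck 1 G" by (rule Ck_mono [OF Ck_frame [OF G A(1)]]) auto
  then show "gauge_transformation G (conn_p A) (conn_q A) (conn_r A) (conn_u A) (spin_of G)"
    using L by (simp add: gauge_transformation_iff_frame [OF C1] spin_of_def)
qed

lemma ll_solution_lift:
  assumes m: "2 \<le> m" and ll: "ll_solution (m + 1) S"
    and g0: "g0 \<in> SU2" "S (0, 0, 0) = - (g0 ** sigma3 ** adj g0)"
  obtains p q r u G where "nls_solution m p q r u" "nls_restrictions p q r" "gauge_transformation G p q r u S"
    "frame (lax p q r u) G" "G (0, 0, 0) = g0" "S = spin_of G"
proof -
  have S: "Ck (Suc m) S" "\<And>w. spin_like (S w)" "\<And>w. S w ** S w = mat 1"
    using ll unfolding ll_solution_def spin_matrix_iff spin_like_def by auto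
  obtain A G where AG: "frame A G" "G (0, 0, 0) = g0" "\<And>e. e \<in> axes \<Longrightarrow> Ck m (A e)"
      "\<And>e w. e \<in> axes \<Longrightarrow> A e w \<in> su2" "S = spin_of G"
    using sphere_map_lift [OF S(1) _ S(2,3) g0] m by auto
  note nls = ll_frame_imp_nls [OF m ll [unfolded AG(5)] AG(1,3,4), folded AG(5)]
  show ?thesis by (rule that [OF nls AG(2,5)])
qed

section \<open>The residual phase freedom\<close>

lemma deriv_along_cis:
  assumes "deriv_along e \<theta> \<theta>'"
  shows "deriv_along e (\<lambda>w. cis (c * \<theta> w)) (\<lambda>w. \<i> * of_real (c * \<theta>' w) * cis (c * \<theta> w))"
  unfolding deriv_along_def
proof
  fix w
  have "((\<lambda>s. \<i> * complex_of_real (c * \<theta> (w + s *\<^sub>R e))) has_vector_derivative \<i> * of_real (c * \<theta>' w)) (at 0)"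
    by (intro has_vector_derivative_mult_right bounded_linear.has_vector_derivative [OF bounded_linear_of_real]
        deriv_alongD [OF assms])
  moreover have "(exp has_field_derivative exp (\<i> * complex_of_real (c * \<theta> (w + 0 *\<^sub>R e))))
      (at (\<i> * complex_of_real (c * \<theta> (w + 0 *\<^sub>R e))))"
    by (rule DERIV_exp)
  ultimately have "(exp \<circ> (\<lambda>s. \<i> * complex_of_real (c * \<theta> (w + s *\<^sub>R e))) has_vector_derivative
      \<i> * of_real (c * \<theta>' w) * exp (\<i> * complex_of_real (c * \<theta> (w + 0 *\<^sub>R e)))) (at 0)"
    by (rule field_vector_diff_chain_at)
  then show "((\<lambda>s. cis (c * \<theta> (w + s *\<^sub>R e))) has_vector_derivative \<i> * of_real (c * \<theta>' w) * cis (c * \<theta> w)) (at 0)"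
    by (simp add: o_def cis_conv_exp)
qed

lemma Ck_cis: "Ck k \<theta> \<Longrightarrow> Ck k (\<lambda>w. cis (c * \<theta> w))"
proof (induction k)
  case 0
  then show ?case by (auto intro!: continuous_intros)
next
  case (Suc k)
  have IH: "Ck k (\<lambda>w. cis (c * \<theta> w))" by (rule Suc.IH [OF Ck_SucD [OF Suc.prems]])
  obtain \<theta>' where \<theta>': "\<And>e. e \<in> axes \<Longrightarrow> deriv_along e \<theta> (\<theta>' e)" "\<And>e. e \<in> axes \<Longrightarrow> Ck k (\<theta>' e)"
    using Suc.prems unfolding Ck_Suc_iff by metis
  show ?case
  proof (rule Ck_SucI)
    show "continuous_on UNIV (\<lambda>w. cis (c * \<theta> w))" using IH by (rule Ck_continuous)
    fix e assume e: "e \<in> axes"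
    show "deriv_along e (\<lambda>w. cis (c * \<theta> w)) (\<lambda>w. \<i> * of_real (c * \<theta>' e w) * cis (c * \<theta> w))"
      by (rule deriv_along_cis [OF \<theta>'(1) [OF e]])
    show "Ck k (\<lambda>w. \<i> * of_real (c * \<theta>' e w) * cis (c * \<theta> w))"
      by (intro Ck_rules IH \<theta>'(2) e)
  qed
qed

text \<open>The phase is integrated along the path \<open>y\<close>, \<open>x\<close>, \<open>t\<close> from the origin. Along each leg \<open>d\<close> and
  \<open>cis \<theta>\<close> satisfy the same equation, so they agree everywhere, and then the derivatives of \<open>\<theta>\<close> in
  all directions are those prescribed by \<open>d\<close>. No closedness condition on \<open>a\<close> has to be checked.\<close>

lemma phase_integral:
  assumes a: "\<And>e. e \<in> axes \<Longrightarrow> Ck k (a e)" and k: "1 \<le> k"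
    and d: "\<And>e. e \<in> axes \<Longrightarrow> deriv_along e d (\<lambda>w. \<i> * of_real (a e w) * d w)" and d0: "d (0, 0, 0) = 1"
  shows "\<exists>\<theta> :: spacetime \<Rightarrow> real. Ck (Suc k) \<theta> \<and> \<theta> (0, 0, 0) = 0 \<and> (\<forall>w. d w = cis (\<theta> w)) \<and>
    (\<forall>e\<in>axes. deriv_along e \<theta> (a e))"
proof -
  define \<theta> where "\<theta> w = primitive_along e_t (a e_t) w + (restrict_along e_t (primitive_along e_x (a e_x)) w
    + restrict_along e_t (restrict_along e_x (primitive_along e_y (a e_y))) w)" for w
  have C\<theta>: "Ck k \<theta>"
    unfolding \<theta>_def [abs_def] by (intro Ck_add Ck_restrict_along Ck_primitive_along a in_axes)
  have C1: "Ck 1 (a e)" and cont: "continuous_on UNIV (a e)" if "e \<in> axes" for e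
    using Ck_mono [OF a [OF that] k] Ck_continuous [OF a [OF that]] by auto
  note prim = deriv_along_primitive_axis [OF C1]
  have perp: "e_x \<bullet> e_t = 0" "e_y \<bullet> e_t = 0" "e_y \<bullet> e_x = 0" "e_t \<bullet> e_t = 1" "e_x \<bullet> e_x = 1" by simp_all
  have der: "\<exists>f'. deriv_along e' (a e) f' \<and> continuous_on UNIV f'" if "e \<in> axes" "e' \<in> axes" for e e'
    using Ck_deriv_along [OF C1 [OF that(1)] order_refl that(2)] by (metis Ck_continuous)
  have \<theta>t: "deriv_along e_t \<theta> (\<lambda>w. a e_t w + (0 + 0))"
    unfolding \<theta>_def [abs_def]
    by (intro deriv_along_add prim deriv_along_restrict in_axes perp)
  obtain ay where ay: "deriv_along e_y (a e_t) ay" "continuous_on UNIV ay" using der in_axes by blast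
  obtain ay' where ay': "deriv_along e_y (a e_x) ay'" "continuous_on UNIV ay'" using der in_axes by blast
  obtain ax' where ax': "deriv_along e_x (a e_t) ax'" "continuous_on UNIV ax'" using der in_axes by blast
  have \<theta>x: "deriv_along e_x \<theta> (\<lambda>w. primitive_along e_t ax' w + (restrict_along e_t (a e_x) w + restrict_along e_t (\<lambda>w. 0) w))"
    unfolding \<theta>_def [abs_def]
    by (intro deriv_along_add deriv_along_primitive_orthogonal deriv_along_restrict_orthogonal
        deriv_along_restrict prim cont in_axes perp ax')
  have \<theta>y: "deriv_along e_y \<theta> (\<lambda>w. primitive_along e_t ay w + (restrict_along e_t (primitive_along e_x ay') w
      + restrict_along e_t (restrict_along e_x (a e_y)) w))"
    unfolding \<theta>_def [abs_def]
    by (intro deriv_along_add deriv_along_primitive_orthogonal deriv_along_restrict_orthogonal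
        prim cont in_axes perp ay ay')
  (* F = 1 is to be shown; b will be the still unknown derivative of the phase. *)
  define F where "F w = d w * cis (- 1 * \<theta> w)" for w
  have dF: "deriv_along e F (\<lambda>w. \<i> * of_real (a e w - b w) * F w)" if "e \<in> axes" "deriv_along e \<theta> b" for e b
  proof -
    have "deriv_along e F (\<lambda>w. d w * (\<i> * of_real (- 1 * b w) * cis (- 1 * \<theta> w)) + \<i> * of_real (a e w) * d w * cis (- 1 * \<theta> w))"
      unfolding F_def [abs_def] by (intro deriv_along_mult d deriv_along_cis that)
    moreover have "d w * (\<i> * of_real (- 1 * b w) * cis (- 1 * \<theta> w)) + \<i> * of_real (a e w) * d w * cis (- 1 * \<theta> w)
        = \<i> * of_real (a e w - b w) * F w" for w
      by (simp add: F_def algebra_simps)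
    ultimately show ?thesis by simp
  qed
  have "F (t, x, y) = 1" for t x y
  proof -
    have "F ((0, x, y) + s *\<^sub>R e_t) = F ((0, x, y) + 0 *\<^sub>R e_t)" for s
      by (rule constant_of_zero_vector_derivative, rule has_vector_derivative_eq_rhs [OF deriv_along_line [OF dF [OF in_axes(1) \<theta>t]]]) simp
    from this [of t] have 1: "F (t, x, y) = F (0, x, y)" by simp
    have "F ((0, 0, y) + s *\<^sub>R e_x) = F ((0, 0, y) + 0 *\<^sub>R e_x)" for s
      by (rule constant_of_zero_vector_derivative, rule has_vector_derivative_eq_rhs [OF deriv_along_line [OF dF [OF in_axes(2) \<theta>x]]])
        (simp add: primitive_along_zero restrict_along_def)
    from this [of x] have 2: "F (0, x, y) = F (0, 0, y)" by simp
    have "F ((0, 0, 0) + s *\<^sub>R e_y) = F ((0, 0, 0) + 0 *\<^sub>R e_y)" for s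
      by (rule constant_of_zero_vector_derivative, rule has_vector_derivative_eq_rhs [OF deriv_along_line [OF dF [OF in_axes(3) \<theta>y]]])
        (simp add: primitive_along_zero restrict_along_def)
    from this [of y] have 3: "F (0, 0, y) = F (0, 0, 0)" by simp
    show ?thesis unfolding 1 2 3
      by (simp add: F_def d0 \<theta>_def primitive_along_zero restrict_along_def)
  qed
  then have F1: "F w = 1" for w by (metis prod_cases3)
  have dcis: "d w = cis (\<theta> w)" for w
  proof -
    have "d w = d w * (cis (- 1 * \<theta> w) * cis (\<theta> w))" by (simp add: cis_mult)
    also have "\<dots> = F w * cis (\<theta> w)" by (simp add: F_def)
    finally show ?thesis by (simp add: F1)
  qed
  have \<theta>a: "deriv_along e \<theta> (a e)" if e: "e \<in> axes" for e
  proof -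
    obtain b where b: "deriv_along e \<theta> b" by (rule Ck_deriv_along [OF C\<theta> k e])
    have "deriv_along e (\<lambda>w. 1) (\<lambda>w. \<i> * of_real (a e w - b w) * F w)"
      using dF [OF e b] by (simp only: F1 [abs_def])
    from deriv_along_unique [OF this deriv_along_const]
    have "\<i> * of_real (a e w - b w) * F w = 0" for w by (rule fun_cong)
    then have "a e = b" by (auto simp: F1 fun_eq_iff)
    then show ?thesis using b by simp
  qed
  have "Ck (Suc k) \<theta>"
    using Ck_continuous [OF C\<theta>] \<theta>a a by (rule Ck_SucI)
  moreover have "\<theta> (0, 0, 0) = 0"
    by (simp add: \<theta>_def primitive_along_zero restrict_along_def)
  ultimately show ?thesis using dcis \<theta>a by blast
qed

lemma lax_su2:
  assumes "frame (lax p q r u) G" "e \<in> axes"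
  shows "lax p q r u e w \<in> su2"
  using assms(2) frame_skew [OF assms] unfolding axes_def
  by (elim insertE emptyE) (simp_all add: lax_simps lax_xy_su2, simp add: su2_def lax_t_def mat22_nth)

lemma phase_rotation:
  fixes \<theta> :: "spacetime \<Rightarrow> real"
  assumes G: "frame A G" and \<theta>: "\<And>e. e \<in> axes \<Longrightarrow> deriv_along e \<theta> (\<theta>' e)"
  defines "D \<equiv> \<lambda>w. mat22 (cis (\<theta> w)) 0 0 (cis (- \<theta> w))"
  shows "frame (\<lambda>e w. adj (D w) ** A e w ** D w + cscale (\<i> * of_real (\<theta>' e w)) sigma3) (\<lambda>w. G w ** D w)"
    "spin_of (\<lambda>w. G w ** D w) = spin_of G"
proof -
  have D: "D w \<in> SU2" for w
    by (simp add: D_def SU2_iff cmat_eq_iff entries det_2 cis_mult cis_cnj)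
  show "spin_of (\<lambda>w. G w ** D w) = spin_of G"
  proof
    fix w
    have "D w ** sigma3 ** adj (D w) = sigma3"
      by (simp add: D_def cmat_eq_iff entries cis_mult cis_cnj)
    moreover have "(G w ** D w) ** sigma3 ** adj (G w ** D w) = G w ** (D w ** sigma3 ** adj (D w)) ** adj (G w)"
      by (simp only: adj_matmul matrix_mul_assoc)
    ultimately show "spin_of (\<lambda>w. G w ** D w) w = spin_of G w" by (simp add: spin_of_def)
  qed
  show "frame (\<lambda>e w. adj (D w) ** A e w ** D w + cscale (\<i> * of_real (\<theta>' e w)) sigma3) (\<lambda>w. G w ** D w)"
    unfolding frame_def
  proof (intro conjI allI ballI)
    show "G w ** D w \<in> SU2" for w by (intro SU2_mult D frame_SU2 [OF G])
    fix e assume e: "e \<in> axes"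
    have "deriv_along e (\<lambda>w. mat22 (cis (1 * \<theta> w)) 0 0 (cis (- 1 * \<theta> w)))
        (\<lambda>w. mat22 (\<i> * of_real (1 * \<theta>' e w) * cis (1 * \<theta> w)) 0 0 (\<i> * of_real (- 1 * \<theta>' e w) * cis (- 1 * \<theta> w)))"
      by (intro deriv_along_mat22 deriv_along_const deriv_along_cis \<theta> e)
    moreover have "mat22 (\<i> * of_real (1 * \<theta>' e w) * cis (1 * \<theta> w)) 0 0 (\<i> * of_real (- 1 * \<theta>' e w) * cis (- 1 * \<theta> w))
        = D w ** cscale (\<i> * of_real (\<theta>' e w)) sigma3" for w
      by (simp add: D_def cmat_eq_iff entries)
    ultimately have "deriv_along e D (\<lambda>w. D w ** cscale (\<i> * of_real (\<theta>' e w)) sigma3)"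
      by (simp add: D_def)
    then have "deriv_along e (\<lambda>w. G w ** D w)
        (\<lambda>w. G w ** (D w ** cscale (\<i> * of_real (\<theta>' e w)) sigma3) + G w ** A e w ** D w)"
      by (intro deriv_along_matmul frame_deriv [OF G e])
    moreover have "G w ** (D w ** cscale (\<i> * of_real (\<theta>' e w)) sigma3) + G w ** A e w ** D w =
        (G w ** D w) ** (adj (D w) ** A e w ** D w + cscale (\<i> * of_real (\<theta>' e w)) sigma3)" for w
    proof -
      have "(G w ** D w) ** (adj (D w) ** A e w ** D w) = G w ** (D w ** adj (D w)) ** A e w ** D w"
        by (simp only: matrix_mul_assoc)
      then show ?thesis by (simp add: SU2_unitary [OF D] matmul.add_right matrix_mul_assoc add.commute)
    qed
    ultimately show "deriv_along e (\<lambda>w. G w ** D w)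
        (\<lambda>w. (G w ** D w) ** (adj (D w) ** A e w ** D w + cscale (\<i> * of_real (\<theta>' e w)) sigma3))"
      by simp
  qed
qed


lemma SU2_diagonal:
  assumes "D \<in> SU2" "D ** sigma3 = sigma3 ** D"
  shows "D $ 1 $ 2 = 0" "D $ 2 $ 1 = 0" "D $ 1 $ 1 * cnj (D $ 1 $ 1) = 1" "D $ 2 $ 2 = cnj (D $ 1 $ 1)"
proof -
  have o: "D $ 1 $ 2 = 0 \<and> D $ 2 $ 1 = 0"
    using assms(2) by (simp add: cmat_eq_iff entries)
  then show "D $ 1 $ 2 = 0" "D $ 2 $ 1 = 0" by auto
  have u: "D $ 1 $ 1 * cnj (D $ 1 $ 1) = 1" and dt: "D $ 1 $ 1 * D $ 2 $ 2 = 1"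
    using assms(1) o by (simp_all add: SU2_iff cmat_eq_iff entries det_2)
  show "D $ 1 $ 1 * cnj (D $ 1 $ 1) = 1" by (rule u)
  have "cnj (D $ 1 $ 1) * (D $ 1 $ 1 * D $ 2 $ 2) = (D $ 1 $ 1 * cnj (D $ 1 $ 1)) * D $ 2 $ 2"
    by (simp only: mult_ac)
  then show "D $ 2 $ 2 = cnj (D $ 1 $ 1)" unfolding dt u by simp
qed

lemma lax_entries:
  "p w = - (lax_x p q r w $ 1 $ 1 - \<i> * lax_y p q r w $ 1 $ 1)"
  "q w = - (lax_x p q r w $ 1 $ 2 - \<i> * lax_y p q r w $ 1 $ 2)"
  "r w = - (lax_x p q r w $ 2 $ 1 - \<i> * lax_y p q r w $ 2 $ 1)"
  using lax_z(1) [of p q r w] by (simp_all add: cmat_eq_iff cscale_nth U_matrix_def mat22_nth)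

text \<open>Two normalized frames with the same \<open>S\<close> differ by \<open>D = G\<^sup>* G'\<close>, which commutes with \<open>\<sigma>\<^sub>3\<close> and is
  therefore diagonal. The equation \<open>D\<^sub>e = D A'\<^sub>e - A\<^sub>e D\<close> relates the diagonal entries of the
  connections by the derivative of the phase and the off-diagonal ones by its square.\<close>

lemma residual_gauge_necessary:
  assumes m: "2 \<le> m" and C: "Ck m p" "Ck m q" "Ck m r" "Ck m u" "Ck m p'" "Ck m q'" "Ck m r'" "Ck m u'"
    and G: "frame (lax p q r u) G" "G (0, 0, 0) = mat 1" and G': "frame (lax p' q' r' u') G'" "G' (0, 0, 0) = mat 1"
    and eq: "spin_of G = spin_of G'"
  shows "residual_gauge (m + 1) p q r u p' q' r' u'"
proof -
  let ?A = "lax p q r u" and ?A' = "lax p' q' r' u'"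
  have m1: "1 \<le> m" using m by simp
  note GU = SU2_unitary [OF frame_SU2 [OF G(1)]] and GU' = SU2_unitary [OF frame_SU2 [OF G'(1)]]
  define D where "D w = adj (G w) ** G' w" for w
  define d where "d w = D w $ 1 $ 1" for w
  have "D w ** sigma3 = sigma3 ** D w" for w
  proof -
    have "G w ** sigma3 ** adj (G w) = G' w ** sigma3 ** adj (G' w)"
      using fun_cong [OF eq, of w] by (simp add: spin_of_def)
    then have "adj (G w) ** (G w ** sigma3 ** adj (G w)) ** G' w = adj (G w) ** (G' w ** sigma3 ** adj (G' w)) ** G' w"
      by (simp only:)
    then have "(adj (G w) ** G w) ** sigma3 ** D w = D w ** sigma3 ** (adj (G' w) ** G' w)"
      by (simp only: D_def matrix_mul_assoc)
    then show ?thesis by (simp add: GU GU')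
  qed
  then have D: "D w $ 1 $ 2 = 0" "D w $ 2 $ 1 = 0" "d w * cnj (d w) = 1" "D w $ 2 $ 2 = cnj (d w)" for w
    unfolding d_def
    using SU2_diagonal [of "D w"] SU2_mult [OF SU2_adj [OF frame_SU2 [OF G(1)]] frame_SU2 [OF G'(1)]]
    by (auto simp: D_def)
  have dD: "deriv_along e D (\<lambda>w. D w ** ?A' e w - ?A e w ** D w)" if e: "e \<in> axes" for e
  proof -
    have "deriv_along e D (\<lambda>w. adj (G w) ** (G' w ** ?A' e w) + adj (G w ** ?A e w) ** G' w)"
      unfolding D_def [abs_def] by (intro deriv_along_matmul deriv_along_adj frame_deriv G(1) G'(1) e)
    moreover have "adj (G w) ** (G' w ** ?A' e w) + adj (G w ** ?A e w) ** G' w = D w ** ?A' e w - ?A e w ** D w" for w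
      by (simp add: D_def adj_matmul frame_skew [OF G(1) e] matmul.minus_left matrix_mul_assoc)
    ultimately show ?thesis by simp
  qed
  define a where "a e w = Im (?A' e w $ 1 $ 1 - ?A e w $ 1 $ 1)" for e w
  have a: "?A' e w $ 1 $ 1 = ?A e w $ 1 $ 1 + \<i> * of_real (a e w)" if e: "e \<in> axes" for e w
    using lax_su2 [OF G(1) e, of w] lax_su2 [OF G'(1) e, of w]
    by (simp add: a_def su2_entries complex_eq_iff)
  have dd: "deriv_along e d (\<lambda>w. \<i> * of_real (a e w) * d w)" if e: "e \<in> axes" for e
  proof -
    have "deriv_along e d (\<lambda>w. (D w ** ?A' e w - ?A e w ** D w) $ 1 $ 1)"
      unfolding d_def [abs_def] by (rule deriv_along_entry [OF dD [OF e]])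
    moreover have "(D w ** ?A' e w - ?A e w ** D w) $ 1 $ 1 = \<i> * of_real (a e w) * d w" for w
      by (simp add: matmul_nth D a [OF e] d_def [symmetric] algebra_simps)
    ultimately show ?thesis by simp
  qed
  have off: "?A' e w $ 1 $ 2 = cnj (d w) * cnj (d w) * ?A e w $ 1 $ 2" "?A' e w $ 2 $ 1 = d w * d w * ?A e w $ 2 $ 1"
    if e: "e \<in> axes" for e w
  proof -
    have "deriv_along e (\<lambda>w. 0) (\<lambda>w. (D w ** ?A' e w - ?A e w ** D w) $ 1 $ 2)"
      "deriv_along e (\<lambda>w. 0) (\<lambda>w. (D w ** ?A' e w - ?A e w ** D w) $ 2 $ 1)"
      using deriv_along_entry [OF dD [OF e], of 1 2] deriv_along_entry [OF dD [OF e], of 2 1] by (simp_all only: D)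
    from this [THEN deriv_along_unique, OF deriv_along_const, THEN fun_cong, of w]
    have 1: "d w * ?A' e w $ 1 $ 2 = ?A e w $ 1 $ 2 * cnj (d w)" "cnj (d w) * ?A' e w $ 2 $ 1 = ?A e w $ 2 $ 1 * d w"
      by (simp_all add: matmul_nth D d_def [symmetric])
    have "cnj (d w) * (d w * X) = (d w * cnj (d w)) * X" "d w * (cnj (d w) * X) = (d w * cnj (d w)) * X" for X
      by (simp_all only: mult_ac)
    then have "?A' e w $ 1 $ 2 = cnj (d w) * (d w * ?A' e w $ 1 $ 2)"
      "?A' e w $ 2 $ 1 = d w * (cnj (d w) * ?A' e w $ 2 $ 1)"
      by (simp_all only: D(3) mult_1)
    then show "?A' e w $ 1 $ 2 = cnj (d w) * cnj (d w) * ?A e w $ 1 $ 2" "?A' e w $ 2 $ 1 = d w * d w * ?A e w $ 2 $ 1"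
      unfolding 1 by (simp_all add: mult_ac)
  qed
  have at: "a e_t = (\<lambda>w. u w - u' w)"
    by (simp add: a_def lax_simps lax_t_def mat22_nth fun_eq_iff)
  have "Ck m (a e)" if "e \<in> axes" for e
  proof -
    have "Ck m (a e_t)" unfolding at by (intro Ck_rules C)
    moreover have "Ck m (a e_x)" "Ck m (a e_y)"
      unfolding a_def [abs_def] lax_simps by (intro Ck_rules Ck_lax_xy C)+
    ultimately show ?thesis using that unfolding axes_def by blast
  qed
  moreover have "d (0, 0, 0) = 1" by (simp add: d_def D_def G(2) G'(2) mat_nth)
  ultimately obtain \<theta> :: "spacetime \<Rightarrow> real" where \<theta>: "Ck (Suc m) \<theta>" "\<theta> (0, 0, 0) = 0" "\<And>w. d w = cis (\<theta> w)"
      "\<And>e. e \<in> axes \<Longrightarrow> deriv_along e \<theta> (a e)"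
    using phase_integral [OF _ m1 dd] by blast
  have z: "D_z (\<lambda>v. of_real (\<theta> v)) w = of_real (a e_x w) - \<i> * of_real (a e_y w)" for w
    using D_z_eq(1) [OF deriv_along_of_real [OF \<theta>(4)] deriv_along_of_real [OF \<theta>(4)], OF in_axes(2,3)] by simp
  have t: "partial_t \<theta> = a e_t" by (rule deriv_along_partials(1) [OF \<theta>(4) [OF in_axes(1)]])
  note A = a [OF in_axes(2), unfolded lax_simps] a [OF in_axes(3), unfolded lax_simps]
    off [OF in_axes(2), unfolded lax_simps] off [OF in_axes(3), unfolded lax_simps]
  have dd2: "d w * d w = cis (2 * \<theta> w)" "cnj (d w) * cnj (d w) = cis (- 2 * \<theta> w)" for w
    by (simp_all add: \<theta>(3) cis_mult cis_cnj)
  have "p' w = p w - \<i> * D_z (\<lambda>v. of_real (\<theta> v)) w" for w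
    unfolding lax_entries(1) [of p' w q' r'] lax_entries(1) [of p w q r] A z by (simp add: algebra_simps)
  moreover have "q' w = cis (- 2 * \<theta> w) * q w" for w
    unfolding lax_entries(2) [of q' w p' r'] lax_entries(2) [of q w p r] A dd2 by (simp add: algebra_simps)
  moreover have "r' w = cis (2 * \<theta> w) * r w" for w
    unfolding lax_entries(3) [of r' w p' q'] lax_entries(3) [of r w p q] A dd2 by (simp add: algebra_simps)
  moreover have "u' w = u w - partial_t \<theta> w" for w unfolding t at by simp
  ultimately show ?thesis unfolding residual_gauge_def using \<theta>(1,2) by auto
qed

text \<open>Rotating the frame by the phase leaves \<open>S\<close> unchanged, and \<open>ll_frame_imp_nls\<close> applies to the rotated
  frame. It needs the \<open>t\<close>-component of the connection to be as smooth as the potentials; this is where the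
  extra order of smoothness of \<open>S\<close> enters.\<close>

lemma residual_gauge_sufficient:
  assumes m: "2 \<le> m" and C: "Ck m p" "Ck m q" "Ck m r" "Ck m u" and ll: "ll_solution (m + 1) (spin_of G)"
    and G: "frame (lax p q r u) G" "G (0, 0, 0) = mat 1" and res: "residual_gauge (m + 1) p q r u p' q' r' u'"
  shows "nls_solution m p' q' r' u'" "nls_restrictions p' q' r'" "normalized_correspondence p' q' r' u' (spin_of G)"
proof -
  let ?A = "lax p q r u"
  have m1: "1 \<le> m" using m by simp
  obtain \<theta> :: "spacetime \<Rightarrow> real" where \<theta>: "Ck (Suc m) \<theta>" "\<theta> (0, 0, 0) = 0"
    and p': "\<And>w. p' w = p w - \<i> * D_z (\<lambda>v. of_real (\<theta> v)) w" and q': "\<And>w. q' w = cis (- 2 * \<theta> w) * q w"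
    and r': "\<And>w. r' w = cis (2 * \<theta> w) * r w" and u': "\<And>w. u' w = u w - partial_t \<theta> w"
    using res unfolding residual_gauge_def by auto
  obtain \<theta>' where \<theta>': "\<And>e. e \<in> axes \<Longrightarrow> deriv_along e \<theta> (\<theta>' e)" "\<And>e. e \<in> axes \<Longrightarrow> Ck m (\<theta>' e)"
    using \<theta>(1) unfolding Ck_Suc_iff by metis
  define D where "D w = mat22 (cis (\<theta> w)) 0 0 (cis (- \<theta> w))" for w
  define A where "A e w = adj (D w) ** ?A e w ** D w + cscale (\<i> * of_real (\<theta>' e w)) sigma3" for e w
  define H where "H w = G w ** D w" for w
  have H: "frame A H" "spin_of H = spin_of G"
    using phase_rotation [OF G(1) \<theta>'(1)] by (simp_all add: A_def [abs_def] H_def [abs_def] D_def)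
  have CD: "Ck m D"
    using Ck_mat22 [OF Ck_cis Ck_const Ck_const Ck_cis, OF Ck_SucD [OF \<theta>(1)] Ck_SucD [OF \<theta>(1)], of 1 0 0 "- 1"]
    by (simp add: D_def [abs_def])
  have CL: "Ck m (?A e)" if "e \<in> axes" for e
  proof -
    have "Ck m (D_zbar q)" "Ck m (D_zbar r)"
      using ll spin_of_regularity(4) [OF C m1 G(1)] by auto
    then show ?thesis
      using that Ck_lax_t [OF C] Ck_lax_xy [OF C(1-3)] unfolding axes_def
      by (elim insertE emptyE) (simp_all add: lax_simps)
  qed
  have sc: "cscale (\<i> * of_real (\<theta>' e w)) sigma3 = mat22 (\<i> * of_real (\<theta>' e w)) 0 0 (- (\<i> * of_real (\<theta>' e w)))" for e w
    by (simp add: cmat_eq_iff entries)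
  have CA: "Ck m (A e)" if e: "e \<in> axes" for e
    unfolding A_def [abs_def] sc by (intro Ck_rules CD CL \<theta>'(2) e)
  have DU: "adj (D w) \<in> SU2" for w
    by (simp add: D_def SU2_iff cmat_eq_iff entries det_2 cis_mult cis_cnj)
  have suA: "A e w \<in> su2" if e: "e \<in> axes" for e w
    using su2_conjugate [OF DU [of w] lax_su2 [OF G(1) e, of w]]
    by (simp add: A_def sc su2_entries mat22_nth)
  have entry: "(adj (D w) ** M ** D w) $ 1 $ 1 = M $ 1 $ 1" "(adj (D w) ** M ** D w) $ 1 $ 2 = cis (- 2 * \<theta> w) * M $ 1 $ 2"
    "(adj (D w) ** M ** D w) $ 2 $ 1 = cis (2 * \<theta> w) * M $ 2 $ 1" for M w
  proof -
    have "cis (- \<theta> w) * cis (\<theta> w) = 1" "cis (\<theta> w) * cis (- \<theta> w) = 1" "cis (- \<theta> w) * cis (- \<theta> w) = cis (- 2 * \<theta> w)"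
      "cis (\<theta> w) * cis (\<theta> w) = cis (2 * \<theta> w)" by (simp_all add: cis_mult)
    then show "(adj (D w) ** M ** D w) $ 1 $ 1 = M $ 1 $ 1" "(adj (D w) ** M ** D w) $ 1 $ 2 = cis (- 2 * \<theta> w) * M $ 1 $ 2"
      "(adj (D w) ** M ** D w) $ 2 $ 1 = cis (2 * \<theta> w) * M $ 2 $ 1"
      by (simp_all add: D_def entries cis_cnj mult.assoc mult.left_commute mult.commute [of "M $ _ $ _"])
  qed
  have z: "D_z (\<lambda>v. of_real (\<theta> v)) w = of_real (\<theta>' e_x w) - \<i> * of_real (\<theta>' e_y w)" for w
    using D_z_eq(1) [OF deriv_along_of_real [OF \<theta>'(1)] deriv_along_of_real [OF \<theta>'(1)], OF in_axes(2,3)] by simp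
  have t: "partial_t \<theta> = \<theta>' e_t" by (rule deriv_along_partials(1) [OF \<theta>'(1) [OF in_axes(1)]])
  have "conn_p A w = p' w" for w
  proof -
    have "conn_p A w = - ((lax_x p q r w $ 1 $ 1 + \<i> * of_real (\<theta>' e_x w))
        - \<i> * (lax_y p q r w $ 1 $ 1 + \<i> * of_real (\<theta>' e_y w)))"
      by (simp add: conn_p_def A_def sc lax_simps cscale_nth entry mat22_nth)
    also have "\<dots> = p' w"
      unfolding p' z lax_entries(1) [of p w q r] by (simp add: algebra_simps)
    finally show ?thesis .
  qed
  moreover have "conn_q A w = q' w" for w
  proof -
    have "conn_q A w = - (cis (- 2 * \<theta> w) * lax_x p q r w $ 1 $ 2 - \<i> * (cis (- 2 * \<theta> w) * lax_y p q r w $ 1 $ 2))"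
      by (simp add: conn_q_def A_def sc lax_simps cscale_nth entry mat22_nth)
    also have "\<dots> = q' w"
      unfolding q' lax_entries(2) [of q w p r] by (simp add: algebra_simps)
    finally show ?thesis .
  qed
  moreover have "conn_r A w = r' w" for w
  proof -
    have "conn_r A w = - (cis (2 * \<theta> w) * lax_x p q r w $ 2 $ 1 - \<i> * (cis (2 * \<theta> w) * lax_y p q r w $ 2 $ 1))"
      by (simp add: conn_r_def A_def sc lax_simps cscale_nth entry mat22_nth)
    also have "\<dots> = r' w"
      unfolding r' lax_entries(3) [of r w p q] by (simp add: algebra_simps)
    finally show ?thesis .
  qed
  moreover have "conn_u A w = u' w" for w
    unfolding u' t by (simp add: conn_u_def A_def sc lax_simps entry mat22_nth lax_t_def)
  ultimately have conn: "conn_p A = p'" "conn_q A = q'" "conn_r A = r'" "conn_u A = u'"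
    by (simp_all only: fun_eq_iff) simp_all
  note nls = ll_frame_imp_nls [OF m _ H(1) CA suA, unfolded H(2) conn, OF ll]
  show "nls_solution m p' q' r' u'" by (rule nls(1))
  show "nls_restrictions p' q' r'" by (rule nls(2))
  have "H (0, 0, 0) = mat 1" by (simp add: H_def D_def G(2) \<theta>(2) cmat_eq_iff entries)
  then show "normalized_correspondence p' q' r' u' (spin_of G)"
    unfolding normalized_correspondence_def using nls(3) by blast
qed

section \<open>The correspondence\<close>

lemma normalized_correspondence_iff:
  assumes "2 \<le> m" "nls_solution m p q r u"
  shows "normalized_correspondence p q r u S \<longleftrightarrow>
    (\<exists>G. frame (lax p q r u) G \<and> G (0, 0, 0) = mat 1 \<and> S = spin_of G)"
proof -
  have C: "Ck m p" "Ck m q" "Ck m r" "Ck m u" using assms(2) by (auto simp: nls_solution_iff)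
  have m1: "1 \<le> m" using assms(1) by simp
  have "Ck 1 G" if "frame (lax p q r u) G" for G
    by (rule Ck_mono [OF Ck_frame [OF that Ck_lax [OF C m1]]]) auto
  then show ?thesis
    unfolding normalized_correspondence_def gauge_transformation_iff_frame [OF Ck_mono [OF C(2) m1] Ck_mono [OF C(3) m1]]
      fun_eq_iff spin_of_def by blast
qed

theorem theorem2:
  fixes m :: nat
  assumes "m \<ge> 2"
  shows
    "(\<forall>p q r u. nls_solution m p q r u \<and> nls_restrictions p q r \<longrightarrow>
        (\<exists>G S. gauge_transformation G p q r u S \<and> ll_solution m S)) \<and>
     (\<forall>p q r u. nls_solution m p q r u \<and> nls_restrictions p q r \<longrightarrow>
        (\<exists>!S. normalized_correspondence p q r u S) \<and>
        (\<forall>S. normalized_correspondence p q r u S \<longrightarrow>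
           ll_solution m S \<and> Ck m (partial_x S) \<and> Ck m (partial_y S) \<and>
           (ll_solution (m + 1) S \<longleftrightarrow> Ck m (D_zbar q) \<and> Ck m (D_zbar r)))) \<and>
     (\<forall>S. ll_solution (m + 1) S \<longrightarrow>
        (\<exists>G p q r u. nls_solution m p q r u \<and> nls_restrictions p q r \<and>
           gauge_transformation G p q r u S)) \<and>
     (\<forall>S. ll_solution (m + 1) S \<and> S (0, 0, 0) = - sigma3 \<longrightarrow>
        (\<exists>p q r u. nls_solution m p q r u \<and> nls_restrictions p q r \<and>
           normalized_correspondence p q r u S \<and>
           (\<forall>p' q' r' u'.
              nls_solution m p' q' r' u' \<and> nls_restrictions p' q' r' \<and>
              normalized_correspondence p' q' r' u' S \<longleftrightarrow>
              residual_gauge (m + 1) p q r u p' q' r' u')))"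
proof -
  have m1: "1 \<le> m" using assms by simp
  have unique: "\<exists>!S. normalized_correspondence p q r u S"
    and regular: "\<And>S. normalized_correspondence p q r u S \<Longrightarrow>
           ll_solution m S \<and> Ck m (partial_x S) \<and> Ck m (partial_y S) \<and>
           (ll_solution (m + 1) S \<longleftrightarrow> Ck m (D_zbar q) \<and> Ck m (D_zbar r))"
    if nls: "nls_solution m p q r u" "nls_restrictions p q r" for p q r u
  proof -
    note iff = normalized_correspondence_iff [OF assms nls(1)]
    obtain G where G: "G (0, 0, 0) = mat 1" "frame (lax p q r u) G"
      using nls_frame_exists [OF assms nls SU2_mat_1] by blast
    show "\<exists>!S. normalized_correspondence p q r u S"
    proof (rule ex1I [of _ "spin_of G"])
      show "normalized_correspondence p q r u (spin_of G)" unfolding iff using G by blast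
      show "S = spin_of G" if "normalized_correspondence p q r u S" for S
        using that frame_unique [OF G(2)] G(1) unfolding iff by metis
    qed
    have C: "Ck m p" "Ck m q" "Ck m r" "Ck m u" using nls(1) by (auto simp: nls_solution_iff)
    show "ll_solution m S \<and> Ck m (partial_x S) \<and> Ck m (partial_y S) \<and>
        (ll_solution (m + 1) S \<longleftrightarrow> Ck m (D_zbar q) \<and> Ck m (D_zbar r))"
      if "normalized_correspondence p q r u S" for S
      using that spin_of_regularity [OF C m1] unfolding iff by blast
  qed
  have lift: "\<exists>G p q r u. nls_solution m p q r u \<and> nls_restrictions p q r \<and> gauge_transformation G p q r u S"
    if ll: "ll_solution (m + 1) S" for S
  proof -
    have "spin_like (S (0, 0, 0))" "S (0, 0, 0) ** S (0, 0, 0) = mat 1"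
      using ll unfolding ll_solution_def spin_matrix_iff spin_like_def by auto
    then obtain g0 where "g0 \<in> SU2" "S (0, 0, 0) = - (g0 ** sigma3 ** adj g0)"
      using spin_matrix_lift by blast
    then show ?thesis by (rule ll_solution_lift [OF assms ll]) blast
  qed
  have normalized: "\<exists>p q r u. nls_solution m p q r u \<and> nls_restrictions p q r \<and>
           normalized_correspondence p q r u S \<and>
           (\<forall>p' q' r' u'.
              nls_solution m p' q' r' u' \<and> nls_restrictions p' q' r' \<and>
              normalized_correspondence p' q' r' u' S \<longleftrightarrow>
              residual_gauge (m + 1) p q r u p' q' r' u')"
    if ll: "ll_solution (m + 1) S" and S0: "S (0, 0, 0) = - sigma3" for S
  proof -
    have "S (0, 0, 0) = - (mat 1 ** sigma3 ** adj (mat 1))" using S0 by simp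
    then obtain p q r u G where nls: "nls_solution m p q r u" "nls_restrictions p q r"
      and G: "frame (lax p q r u) G" "G (0, 0, 0) = mat 1" "S = spin_of G"
      by (rule ll_solution_lift [OF assms ll SU2_mat_1])
    have C: "Ck m p" "Ck m q" "Ck m r" "Ck m u" using nls(1) by (auto simp: nls_solution_iff)
    have "residual_gauge (m + 1) p q r u p' q' r' u'"
      if nls': "nls_solution m p' q' r' u'" and "normalized_correspondence p' q' r' u' S" for p' q' r' u'
    proof -
      from that(2) obtain G' where G': "frame (lax p' q' r' u') G'" "G' (0, 0, 0) = mat 1" "S = spin_of G'"
        unfolding normalized_correspondence_iff [OF assms nls'] by (elim exE conjE)
      have C': "Ck m p'" "Ck m q'" "Ck m r'" "Ck m u'" using nls' by (auto simp: nls_solution_iff)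
      show ?thesis
        by (rule residual_gauge_necessary [OF assms C C' G(1,2) G'(1,2)]) (simp flip: G(3) G'(3))
    qed
    moreover have "nls_solution m p' q' r' u' \<and> nls_restrictions p' q' r' \<and> normalized_correspondence p' q' r' u' S"
      if "residual_gauge (m + 1) p q r u p' q' r' u'" for p' q' r' u'
      using residual_gauge_sufficient [OF assms C ll [unfolded G(3)] G(1,2) that] unfolding G(3) by blast
    moreover have "normalized_correspondence p q r u S"
      unfolding normalized_correspondence_iff [OF assms nls(1)] using G by blast
    ultimately show ?thesis using nls by blast
  qed
  have exists: "\<exists>G S. gauge_transformation G p q r u S \<and> ll_solution m S"
    if nls: "nls_solution m p q r u" "nls_restrictions p q r" for p q r u
  proof -
    obtain S where S: "normalized_correspondence p q r u S" using unique [OF nls] by (elim ex1E)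
    then obtain G where "gauge_transformation G p q r u S"
      unfolding normalized_correspondence_def by (elim exE conjE)
    then show ?thesis using regular [OF nls S] by (intro exI conjI) (assumption, elim conjE)
  qed
  show ?thesis
  proof (rule conjI [OF _ conjI [OF _ conjI]])
    show "\<forall>p q r u. nls_solution m p q r u \<and> nls_restrictions p q r \<longrightarrow>
        (\<exists>G S. gauge_transformation G p q r u S \<and> ll_solution m S)"
      by (intro allI impI, elim conjE, rule exists)
    show "\<forall>p q r u. nls_solution m p q r u \<and> nls_restrictions p q r \<longrightarrow>
        (\<exists>!S. normalized_correspondence p q r u S) \<and>
        (\<forall>S. normalized_correspondence p q r u S \<longrightarrow>
           ll_solution m S \<and> Ck m (partial_x S) \<and> Ck m (partial_y S) \<and>
           (ll_solution (m + 1) S \<longleftrightarrow> Ck m (D_zbar q) \<and> Ck m (D_zbar r)))"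
    proof (intro allI impI, elim conjE)
      fix p q r u assume "nls_solution m p q r u" "nls_restrictions p q r"
      from unique [OF this] regular [OF this]
      show "(\<exists>!S. normalized_correspondence p q r u S) \<and>
        (\<forall>S. normalized_correspondence p q r u S \<longrightarrow>
           ll_solution m S \<and> Ck m (partial_x S) \<and> Ck m (partial_y S) \<and>
           (ll_solution (m + 1) S \<longleftrightarrow> Ck m (D_zbar q) \<and> Ck m (D_zbar r)))"
        by blast
    qed
  qed (use lift normalized in blast)+
qed

end
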